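(* Let $\Sigma(\mathsf{o}_{in}, \mathsf{o}_{out}, \vec a)$ be a $\Delta_0$ formula which implicitly defines $\mathsf{o}_{out}$ as a function of $\mathsf{o}_{in}$. Then there is an $\mathrm{NRC}$ expression $E$ (in the variant $\mathrm{NRC}[\mathsf{get}]$, i.e. possibly using the $\mathsf{get}$ operator) with the single free variable $\mathsf{o}_{in}$ such that for all nested relations $\mathsf{o}_{in}, \mathsf{o}_{out}, \vec a$ of the appropriate types, if $\Sigma(\mathsf{o}_{in}, \mathsf{o}_{out}, \vec a)$ holds then $E(\mathsf{o}_{in}) = \mathsf{o}_{out}$.
   Context: Types are generated by $T, U ::= \mathfrak{U} \mid \mathsf{Unit} \mid T \times U \mid \mathsf{Set}(T)$. Here $\mathfrak{U}$ is an arbitrary set of atoms ("Ur-elements"), $\mathsf{Unit}$ has a single element $\langle\rangle$, $T\times U$ is the cartesian product, and $\mathsf{Set}(T)$ is the set of all (finite or infinite) subsets of $T$. A nested relation of type $T$ is an element of the interpretation of $T$. Terms are $t,u ::= x \mid \langle\rangle \mid \langle t,u\rangle \mid \pi_1(t) \mid \pi_2(t)$ (well-typed). $\Delta_0$ formulas are $\varphi,\psi ::= t =_{\mathfrak U} u \mid t \neq_{\mathfrak U} u \mid \top \mid \bot \mid \varphi\vee\psi \mid \varphi\wedge\psi \mid \forall x \in t\,\varphi \mid \exists x\in t\,\varphi$, where in the bounded quantifiers $t$ has type $\mathsf{Set}(T)$ and $x$ has type $T$; $\neg\varphi$ is defined by dualizing all connectives and atoms, and $\varphi\to\psi := \neg\varphi\vee\psi$.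 Formulas are evaluated under assignments of nested relations to their free variables. A $\Delta_0$ formula $\Sigma(\vec i, o, \vec a)$ implicitly defines $o$ as a function of $\vec i$ if for any two assignments $\sigma_1,\sigma_2$ of nested relations (finite or infinite) to all free variables that both satisfy $\Sigma$, $\sigma_1(\vec i)=\sigma_2(\vec i)$ implies $\sigma_1(o)=\sigma_2(o)$. $\mathrm{NRC}[\mathsf{get}]$ expressions are typed expressions with free variables built from: variables; $\langle\rangle$; pairing $\langle E_1,E_2\rangle$; projections $\pi_1(E),\pi_2(E)$; the empty set $\emptyset$ of any type $\mathsf{Set}(T)$; singleton $\{E\}$; union $E_1\cup E_2$ and difference $E_1\setminus E_2$ of expressions of the same set type; the big union $\bigcup\{E_1 \mid x \in E_2\}$ (with $E_2:\mathsf{Set}(T)$, $x$ a variable of type $T$ bound in $E_1:\mathsf{Set}(U)$), denoting the union over all $x\in E_2$ of the values of $E_1$; and $\mathsf{get}_T(E)$ for $E:\mathsf{Set}(T)$, returning the unique element of $E$ if $E$ is a singleton and a fixed default element of $T$ otherwise. $\mathrm{NRC}$ is the fragment without $\mathsf{get}$. Booleans are encoded as $\mathsf{Set}(\mathsf{Unit})$ with true $=\{\langle\rangle\}$, false $=\emptyset$.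
   Formalization: The set of Ur-elements is assumed infinite (the claim fails for finite sets of two or more atoms); nested sets are those of size at most an arbitrary infinite cardinal, which can be chosen large enough to include all subsets at the types involved. *)

theory Defs
  imports Main
begin

datatype ty = TUr | TUnit | TProd ty ty | TSet ty

datatype ('u, 'i) nval =
    Atom 'u
  | UnitV
  | PairV "('u, 'i) nval" "('u, 'i) nval"
  | VSet "'i \<Rightarrow> ('u, 'i) nval option"

fun elems :: "('u, 'i) nval \<Rightarrow> ('u, 'i) nval set" where
  "elems (VSet f) = ran f"
| "elems _ = {}"

fun vfst :: "('u, 'i) nval \<Rightarrow> ('u, 'i) nval" where
  "vfst (PairV a b) = a"
| "vfst _ = undefined"

fun vsnd :: "('u, 'i) nval \<Rightarrow> ('u, 'i) nval" where
  "vsnd (PairV a b) = b"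
| "vsnd _ = undefined"

inductive veq :: "('u, 'i) nval \<Rightarrow> ('u, 'i) nval \<Rightarrow> bool" where
  "veq (Atom a) (Atom a)"
| "veq UnitV UnitV"
| "veq a a' \<Longrightarrow> veq b b' \<Longrightarrow> veq (PairV a b) (PairV a' b')"
| "(\<forall>v. v \<in> ran f \<longrightarrow> (\<exists>w. w \<in> ran g \<and> veq v w)) \<Longrightarrow>
   (\<forall>w. w \<in> ran g \<longrightarrow> (\<exists>v. v \<in> ran f \<and> veq v w)) \<Longrightarrow> veq (VSet f) (VSet g)"

primrec hastype :: "('u, 'i) nval \<Rightarrow> ty \<Rightarrow> bool" where
  "hastype v TUr = (\<exists>a. v = Atom a)"
| "hastype v TUnit = (v = UnitV)"
| "hastype v (TProd T U) = (\<exists>a b. v = PairV a b \<and> hastype a T \<and> hastype b U)"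
| "hastype v (TSet T) = (\<exists>f. v = VSet f \<and> (\<forall>w\<in>ran f. hastype w T))"

definition mkset :: "('u, 'i) nval set \<Rightarrow> ('u, 'i) nval" where
  "mkset S = VSet (SOME f. ran f = S)"

datatype trm = TVar nat | TUnitT | TPair trm trm | TPi1 trm | TPi2 trm

fun ttype :: "(nat \<Rightarrow> ty) \<Rightarrow> trm \<Rightarrow> ty option" where
  "ttype \<Gamma> (TVar x) = Some (\<Gamma> x)"
| "ttype \<Gamma> TUnitT = Some TUnit"
| "ttype \<Gamma> (TPair t u) = (case (ttype \<Gamma> t, ttype \<Gamma> u) of
      (Some A, Some B) \<Rightarrow> Some (TProd A B) | _ \<Rightarrow> None)"
| "ttype \<Gamma> (TPi1 t) = (case ttype \<Gamma> t of Some (TProd A B) \<Rightarrow> Some A | _ \<Rightarrow> None)"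
| "ttype \<Gamma> (TPi2 t) = (case ttype \<Gamma> t of Some (TProd A B) \<Rightarrow> Some B | _ \<Rightarrow> None)"

fun fvt :: "trm \<Rightarrow> nat set" where
  "fvt (TVar x) = {x}"
| "fvt TUnitT = {}"
| "fvt (TPair t u) = fvt t \<union> fvt u"
| "fvt (TPi1 t) = fvt t"
| "fvt (TPi2 t) = fvt t"

fun teval :: "(nat \<Rightarrow> ('u, 'i) nval) \<Rightarrow> trm \<Rightarrow> ('u, 'i) nval" where
  "teval \<sigma> (TVar x) = \<sigma> x"
| "teval \<sigma> TUnitT = UnitV"
| "teval \<sigma> (TPair t u) = PairV (teval \<sigma> t) (teval \<sigma> u)"
| "teval \<sigma> (TPi1 t) = vfst (teval \<sigma> t)"
| "teval \<sigma> (TPi2 t) = vsnd (teval \<sigma> t)"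

datatype fml =
    FEqU trm trm | FNeqU trm trm | FTop | FBot
  | FOr fml fml | FAnd fml fml
  | FAll nat trm fml
  | FEx nat trm fml

fun wtf :: "(nat \<Rightarrow> ty) \<Rightarrow> fml \<Rightarrow> bool" where
  "wtf \<Gamma> (FEqU t u) = (ttype \<Gamma> t = Some TUr \<and> ttype \<Gamma> u = Some TUr)"
| "wtf \<Gamma> (FNeqU t u) = (ttype \<Gamma> t = Some TUr \<and> ttype \<Gamma> u = Some TUr)"
| "wtf \<Gamma> FTop = True"
| "wtf \<Gamma> FBot = True"
| "wtf \<Gamma> (FOr p q) = (wtf \<Gamma> p \<and> wtf \<Gamma> q)"
| "wtf \<Gamma> (FAnd p q) = (wtf \<Gamma> p \<and> wtf \<Gamma> q)"
| "wtf \<Gamma> (FAll x t p) = (\<exists>T. ttype \<Gamma> t = Some (TSet T) \<and> wtf (\<Gamma>(x := T)) p)"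
| "wtf \<Gamma> (FEx x t p) = (\<exists>T. ttype \<Gamma> t = Some (TSet T) \<and> wtf (\<Gamma>(x := T)) p)"

fun fvf :: "fml \<Rightarrow> nat set" where
  "fvf (FEqU t u) = fvt t \<union> fvt u"
| "fvf (FNeqU t u) = fvt t \<union> fvt u"
| "fvf FTop = {}"
| "fvf FBot = {}"
| "fvf (FOr p q) = fvf p \<union> fvf q"
| "fvf (FAnd p q) = fvf p \<union> fvf q"
| "fvf (FAll x t p) = fvt t \<union> (fvf p - {x})"
| "fvf (FEx x t p) = fvt t \<union> (fvf p - {x})"

fun sat :: "(nat \<Rightarrow> ('u, 'i) nval) \<Rightarrow> fml \<Rightarrow> bool" where
  "sat \<sigma> (FEqU t u) = (teval \<sigma> t = teval \<sigma> u)"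
| "sat \<sigma> (FNeqU t u) = (teval \<sigma> t \<noteq> teval \<sigma> u)"
| "sat \<sigma> FTop = True"
| "sat \<sigma> FBot = False"
| "sat \<sigma> (FOr p q) = (sat \<sigma> p \<or> sat \<sigma> q)"
| "sat \<sigma> (FAnd p q) = (sat \<sigma> p \<and> sat \<sigma> q)"
| "sat \<sigma> (FAll x t p) = (\<forall>v\<in>elems (teval \<sigma> t). sat (\<sigma>(x := v)) p)"
| "sat \<sigma> (FEx x t p) = (\<exists>v\<in>elems (teval \<sigma> t). sat (\<sigma>(x := v)) p)"

definition wt_asg :: "(nat \<Rightarrow> ty) \<Rightarrow> nat set \<Rightarrow> (nat \<Rightarrow> ('u, 'i) nval) \<Rightarrow> bool" where
  "wt_asg \<Gamma> X \<sigma> = (\<forall>x\<in>X. hastype (\<sigma> x) (\<Gamma> x))"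

datatype nrc =
    EVar nat | EUnit | EPair nrc nrc | EPi1 nrc | EPi2 nrc
  | EEmpty ty
  | ESng nrc | EUn nrc nrc | EDiff nrc nrc
  | EBigU nat nrc nrc  \<comment> \<open>EBigU x E1 E2 = Union{E1 | x in E2}\<close>
  | EGet ty nrc

fun etype :: "(nat \<Rightarrow> ty) \<Rightarrow> nrc \<Rightarrow> ty option" where
  "etype \<Gamma> (EVar x) = Some (\<Gamma> x)"
| "etype \<Gamma> EUnit = Some TUnit"
| "etype \<Gamma> (EPair a b) = (case (etype \<Gamma> a, etype \<Gamma> b) of
      (Some A, Some B) \<Rightarrow> Some (TProd A B) | _ \<Rightarrow> None)"
| "etype \<Gamma> (EPi1 a) = (case etype \<Gamma> a of Some (TProd A B) \<Rightarrow> Some A | _ \<Rightarrow> None)"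
| "etype \<Gamma> (EPi2 a) = (case etype \<Gamma> a of Some (TProd A B) \<Rightarrow> Some B | _ \<Rightarrow> None)"
| "etype \<Gamma> (EEmpty T) = Some (TSet T)"
| "etype \<Gamma> (ESng a) = (case etype \<Gamma> a of Some A \<Rightarrow> Some (TSet A) | None \<Rightarrow> None)"
| "etype \<Gamma> (EUn a b) = (case (etype \<Gamma> a, etype \<Gamma> b) of
      (Some (TSet A), Some (TSet B)) \<Rightarrow> (if A = B then Some (TSet A) else None) | _ \<Rightarrow> None)"
| "etype \<Gamma> (EDiff a b) = (case (etype \<Gamma> a, etype \<Gamma> b) of
      (Some (TSet A), Some (TSet B)) \<Rightarrow> (if A = B then Some (TSet A) else None) | _ \<Rightarrow> None)"
| "etype \<Gamma> (EBigU x e1 e2) = (case etype \<Gamma> e2 of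
      Some (TSet T) \<Rightarrow> (case etype (\<Gamma>(x := T)) e1 of Some (TSet U) \<Rightarrow> Some (TSet U) | _ \<Rightarrow> None)
    | _ \<Rightarrow> None)"
| "etype \<Gamma> (EGet T a) = (if etype \<Gamma> a = Some (TSet T) then Some T else None)"

fun fve :: "nrc \<Rightarrow> nat set" where
  "fve (EVar x) = {x}"
| "fve EUnit = {}"
| "fve (EPair a b) = fve a \<union> fve b"
| "fve (EPi1 a) = fve a"
| "fve (EPi2 a) = fve a"
| "fve (EEmpty T) = {}"
| "fve (ESng a) = fve a"
| "fve (EUn a b) = fve a \<union> fve b"
| "fve (EDiff a b) = fve a \<union> fve b"
| "fve (EBigU x e1 e2) = (fve e1 - {x}) \<union> fve e2"
| "fve (EGet T a) = fve a"

primrec dflt :: "ty \<Rightarrow> ('u, 'i) nval" where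
  "dflt TUr = Atom undefined"
| "dflt TUnit = UnitV"
| "dflt (TProd T U) = PairV (dflt T) (dflt U)"
| "dflt (TSet T) = VSet Map.empty"

primrec eval :: "nrc \<Rightarrow> (nat \<Rightarrow> ('u, 'i) nval) \<Rightarrow> ('u, 'i) nval" where
  "eval (EVar x) \<rho> = \<rho> x"
| "eval EUnit \<rho> = UnitV"
| "eval (EPair a b) \<rho> = PairV (eval a \<rho>) (eval b \<rho>)"
| "eval (EPi1 a) \<rho> = vfst (eval a \<rho>)"
| "eval (EPi2 a) \<rho> = vsnd (eval a \<rho>)"
| "eval (EEmpty T) \<rho> = mkset {}"
| "eval (ESng a) \<rho> = mkset {eval a \<rho>}"
| "eval (EUn a b) \<rho> = mkset (elems (eval a \<rho>) \<union> elems (eval b \<rho>))"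
| "eval (EDiff a b) \<rho> =
     mkset {v \<in> elems (eval a \<rho>). \<not> (\<exists>w\<in>elems (eval b \<rho>). veq v w)}"
| "eval (EBigU x e1 e2) \<rho> =
     mkset (\<Union>y\<in>elems (eval e2 \<rho>). elems (eval e1 (\<rho>(x := y))))"
| "eval (EGet T a) \<rho> =
     (let S = elems (eval a \<rho>) in
        if (\<exists>v\<in>S. \<forall>w\<in>S. veq v w) then (SOME v. v \<in> S) else dflt T)"

end

theory Submission
  imports Defs "HOL-Library.Countable"
begin

text \<open>
  Take two copies of the formula, sharing only the input. Call a pair of finite sets of facts about
  named objects separable when some NRC expression \<open>E\<close> and some NRC-definable condition \<open>\<theta>\<close> on the shared
  names are such that every model of the left set satisfies \<open>\<theta>\<close> or has a distinguished left object \<open>r\<close>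
  in \<open>E\<close>, while every model of the right set violates \<open>\<theta>\<close>. Inseparable pairs form a consistency
  property: they extend step by step to a pair of Hintikka sets and hence to a joint model, whose
  hereditarily countable values embed into the given ones because both parameter types are infinite.

  In this model one can moreover force \<open>r\<close> to differ from every subobject of the right copy. For an atom
  this is done by separating \<open>r\<close> from all shared atoms. For a set, induction on the type yields an
  expression \<open>E'\<close> containing all members of \<open>r\<close>, and for each candidate \<open>y\<close> a shared witness from \<open>E'\<close>
  is put in exactly one of \<open>r\<close> and \<open>y\<close>; if this fails, the separators of the two alternatives
  combine into one that computes \<open>r\<close>. By implicit definability the left output equals the right
  one, so the pair is separable and, both sides being copies of the same formula, the output
  always belongs to \<open>E\<close>. Plain separation (interpolation) then yields a condition that
  singles out the output among the members of \<open>E\<close>, and \<open>get\<close> extracts it.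
\<close>

section \<open>Canonical values\<close>

text \<open>A condition that pins down the output is not enough by itself: NRC has neither a
  powerset nor unbounded comprehension, so the output can only be selected from a set already
  definable from the input. Producing this bounding set is the hard part, and it is why a separator
  carries an expression \<open>E\<close> next to the condition. The parameters add to the
  difficulty, since they are private to each copy and no expression may mention them. A separator is
  a purely semantic object, so no proof calculus is set up: the sequent rules of an interpolation
  proof become closure properties of separability, each combining expressions and conditions. A
  shared witness introduced on the way must be bounded by a definable set, because it is eliminated
  again by a union or a bounded quantifier. The countermodel has to be a valuation in the given
  value type, since implicit definability is assumed only there.\<close>

text \<open>Exactly the small sets have a code; on other sets \<open>mkset\<close> is junk.\<close>

definition small :: "('u, 'i) nval set \<Rightarrow> bool" where
  "small S \<longleftrightarrow> (\<exists>f :: 'i \<Rightarrow> ('u, 'i) nval option. ran f = S)"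

text \<open>
  \<open>mkset\<close> picks one code per set of members; applying it hereditarily gives normal forms on which
  \<open>veq\<close> is equality, so that everything below can be done with plain equality.
\<close>

primrec canon :: "('u, 'i) nval \<Rightarrow> ('u, 'i) nval" where
  "canon (Atom a) = Atom a"
| "canon UnitV = UnitV"
| "canon (PairV a b) = PairV (canon a) (canon b)"
| "canon (VSet f) = mkset (ran (map_option canon \<circ> f))"

lemma ran_map_option: "ran (map_option g \<circ> f) = g ` ran f"
  by (auto simp: ran_def image_iff)

lemma small_ran [simp]: "small (ran (f :: 'i \<Rightarrow> ('u, 'i) nval option))"
  by (auto simp: small_def)

lemma small_empty [simp]: "small {}"
  unfolding small_def by (rule exI[of _ Map.empty]) simp

lemma small_sing [simp]: "small {x :: ('u, 'i) nval}"
proof -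
  have "ran (\<lambda>i :: 'i. Some x) = {x}" by (auto simp: ran_def)
  then show ?thesis unfolding small_def by blast
qed

lemma small_image:
  fixes g :: "('u, 'i) nval \<Rightarrow> ('v, 'i) nval"
  assumes "small S" shows "small (g ` S)"
  using assms unfolding small_def by (metis ran_map_option)

lemma small_subset:
  fixes S :: "('u, 'i) nval set"
  assumes "small S" "T \<subseteq> S" shows "small T"
proof -
  obtain f :: "'i \<Rightarrow> ('u, 'i) nval option" where f: "ran f = S" using assms(1) by (auto simp: small_def)
  let ?g = "\<lambda>i. case f i of Some x \<Rightarrow> if x \<in> T then Some x else None | None \<Rightarrow> None"
  have "ran ?g = T"
  proof
    show "ran ?g \<subseteq> T" by (auto simp: ran_def split: option.splits if_splits)
    show "T \<subseteq> ran ?g"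
    proof
      fix x assume x: "x \<in> T"
      then obtain i where "f i = Some x" using f assms(2) by (auto simp: ran_def)
      then have "?g i = Some x" using x by simp
      then show "x \<in> ran ?g" unfolding ran_def by blast
    qed
  qed
  then show ?thesis unfolding small_def by blast
qed

lemma elems_mkset [simp]:
  fixes S :: "('u, 'i) nval set"
  assumes "small S" shows "elems (mkset S) = S"
proof -
  have "\<exists>f :: 'i \<Rightarrow> ('u, 'i) nval option. ran f = S" using assms by (simp add: small_def)
  then have "ran (SOME f :: 'i \<Rightarrow> ('u, 'i) nval option. ran f = S) = S" by (rule someI_ex)
  then show ?thesis by (simp add: mkset_def)
qed

lemma small_elems [simp]: "small (elems v)"
  by (cases v) auto

lemma mkset_neq [simp]: "mkset S \<noteq> Atom a" "mkset S \<noteq> UnitV" "mkset S \<noteq> PairV v w"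
  "Atom a \<noteq> mkset S" "UnitV \<noteq> mkset S" "PairV v w \<noteq> mkset S"
  by (auto simp: mkset_def)

lemma mkset_inject: "small S \<Longrightarrow> small T \<Longrightarrow> mkset S = mkset T \<longleftrightarrow> S = T"
  by (metis elems_mkset)

text \<open>The empty map is the only code of the empty set, so the default value of a set type is
  already in normal form.\<close>

lemma mkset_empty: "mkset {} = VSet Map.empty"
proof -
  have "ran f = {} \<longleftrightarrow> f = Map.empty" for f :: "'b \<Rightarrow> ('a, 'b) nval option"
    by (auto simp: ran_def fun_eq_iff) (metis not_None_eq)
  then show "mkset {} = VSet (Map.empty :: 'b \<Rightarrow> ('a, 'b) nval option)" by (simp add: mkset_def)
qed

lemma canon_VSet: "canon (VSet f) = mkset (canon ` ran f)"
  by (simp add: ran_map_option)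

declare canon.simps(4) [simp del]
declare canon_VSet [simp]

lemma veq_canon: "veq v w \<Longrightarrow> canon v = canon w"
proof (induction rule: veq.induct)
  case (4 f g)
  have "canon ` ran f = canon ` ran g"
  proof (intro equalityI subsetI)
    fix x assume "x \<in> canon ` ran f"
    then obtain v where "v \<in> ran f" "x = canon v" by blast
    then show "x \<in> canon ` ran g" using 4(1) by blast
  next
    fix x assume "x \<in> canon ` ran g"
    then obtain w where w: "w \<in> ran g" "x = canon w" by blast
    then obtain v where "v \<in> ran f" "canon v = canon w" using 4(2) by blast
    then show "x \<in> canon ` ran f" using w by (metis imageI)
  qed
  then show ?case by simp
qed auto

lemma canon_veq: "canon v = canon w \<Longrightarrow> veq v w"
proof (induction v arbitrary: w)
  case (Atom x) then show ?case by (cases w) (auto intro: veq.intros)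
next
  case UnitV then show ?case by (cases w) (auto intro: veq.intros)
next
  case (PairV v1 v2) then show ?case by (cases w) (auto intro: veq.intros)
next
  case (VSet f)
  from VSet.prems obtain g where w: "w = VSet g" by (cases w) auto
  \<comment> \<open>\<open>mkset\<close> is injective on small sets, so equal codes mean equal sets
    of normalised members.\<close>
  have e: "canon ` ran f = canon ` ran g"
    using VSet.prems w by (simp add: mkset_inject small_image)
  have IH: "veq v u" if "v \<in> ran f" "canon v = canon u" for v u
  proof -
    obtain i where "f i = Some v" using \<open>v \<in> ran f\<close> by (auto simp: ran_def)
    then have "Some v \<in> range f" by (metis rangeI)
    then show ?thesis using VSet.IH[of "Some v" v u] that by simp
  qed
  show ?case unfolding w
  proof (rule veq.intros; intro allI impI)
    fix v assume v: "v \<in> ran f"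
    then have "canon v \<in> canon ` ran g" using e by blast
    then show "\<exists>u. u \<in> ran g \<and> veq v u" using IH v by auto
  next
    fix u assume v: "u \<in> ran g"
    then have "canon u \<in> canon ` ran f" using e by blast
    then show "\<exists>v. v \<in> ran f \<and> veq v u" using IH by force
  qed
qed

lemma veq_iff: "veq v w \<longleftrightarrow> canon v = canon w"
  using veq_canon canon_veq by blast

lemma elems_canon: "elems (canon v) = canon ` elems v"
  by (cases v) (auto simp: small_image)

lemma canon_mkset: "small S \<Longrightarrow> canon (mkset S) = mkset (canon ` S)"
proof -
  assume a: "small S"
  obtain f where f: "mkset S = VSet f" by (simp add: mkset_def)
  then have "ran f = S" using elems_mkset[OF a] by simp
  then show ?thesis by (simp add: f)
qed

lemma canon_idem [simp]: "canon (canon v) = canon v"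
proof (induction v)
  case (VSet f)
  have "canon ` canon ` ran f = canon ` ran f"
  proof -
    have "canon (canon v) = canon v" if "v \<in> ran f" for v
    proof -
      from that obtain i where "f i = Some v" unfolding ran_def by blast
      then have "Some v \<in> range f" by (metis rangeI)
      then show ?thesis using VSet.IH[of "Some v" v] by simp
    qed
    then show ?thesis by (simp add: image_image)
  qed
  then show ?case by (simp add: canon_mkset small_image)
qed auto

text \<open>Up to extensional equality this is the interpretation of the type: one representative is
  kept from each class of \<open>veq\<close>.\<close>

definition cano :: "('u, 'i) nval \<Rightarrow> ty \<Rightarrow> bool" where
  "cano v T \<longleftrightarrow> hastype v T \<and> canon v = v"

lemma hastype_mkset: "small S \<Longrightarrow> hastype (mkset S) (TSet T) \<longleftrightarrow> (\<forall>w\<in>S. hastype w T)"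
proof -
  assume a: "small S"
  obtain f where f: "mkset S = VSet f" by (simp add: mkset_def)
  then have "ran f = S" using elems_mkset[OF a] by simp
  then show ?thesis by (simp add: f)
qed

lemma hastype_elems: "hastype v (TSet T) \<Longrightarrow> w \<in> elems v \<Longrightarrow> hastype w T"
  by auto

lemma hastype_canon: "hastype v T \<Longrightarrow> hastype (canon v) T"
proof (induction T arbitrary: v)
  case (TSet T)
  then obtain f where "v = VSet f" "\<forall>w\<in>ran f. hastype w T" by auto
  then show ?case using TSet.IH by (auto simp: hastype_mkset small_image simp del: hastype.simps)
qed auto

lemma cano_mkset: "small S \<Longrightarrow> cano (mkset S) (TSet T) \<longleftrightarrow> (\<forall>w\<in>S. cano w T)"
proof -
  assume a: "small S"
  have "canon (mkset S) = mkset S \<longleftrightarrow> canon ` S = S"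
    using a by (simp add: canon_mkset mkset_inject small_image)
  moreover have "canon ` S = S \<longleftrightarrow> (\<forall>w\<in>S. canon w = w)"
    by (metis (mono_tags, lifting) canon_idem imageE image_cong image_ident)
  ultimately show ?thesis using a by (auto simp: cano_def hastype_mkset simp del: hastype.simps)
qed

lemma mkset_elems: "cano v (TSet T) \<Longrightarrow> mkset (elems v) = v"
  unfolding cano_def by (cases v) (auto, metis elems.simps(1) elems_canon canon_VSet)

lemma cano_elems: "cano v (TSet T) \<Longrightarrow> w \<in> elems v \<Longrightarrow> cano w T"
  by (metis cano_mkset mkset_elems small_elems)

lemma cano_set_eq: "cano v (TSet T) \<Longrightarrow> cano w (TSet T) \<Longrightarrow> v = w \<longleftrightarrow> elems v = elems w"
  by (metis mkset_elems)

lemma cano_simps [simp]: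
  "cano v TUr \<longleftrightarrow> (\<exists>a. v = Atom a)"
  "cano v TUnit \<longleftrightarrow> v = UnitV"
  "cano v (TProd A B) \<longleftrightarrow> (\<exists>a b. v = PairV a b \<and> cano a A \<and> cano b B)"
  by (auto simp: cano_def)

lemma cano_dflt: "cano (dflt T) T"
proof (induction T)
  case (TSet T)
  have "cano (mkset {}) (TSet T)" by (subst cano_mkset) auto
  then show ?case by (simp add: mkset_empty)
qed auto

lemma cano_veq: "cano v T \<Longrightarrow> cano w U \<Longrightarrow> veq v w \<longleftrightarrow> v = w"
  by (simp add: veq_iff cano_def)

section \<open>Closure properties of small sets over an infinite index type\<close>

locale inf_types =
  fixes UT :: "'u itself" and IT :: "'i itself"
  assumes inf_u: "infinite (UNIV :: 'u set)" and inf_i: "infinite (UNIV :: 'i set)"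
begin

lemma small_countable:
  assumes "S \<subseteq> range (h :: nat \<Rightarrow> ('u,'i) nval)" shows "small S"
proof -
  obtain e :: "nat \<Rightarrow> 'i" where e: "inj e" using inf_i infinite_countable_subset by blast
  have "ran (\<lambda>i. Some (h (inv e i))) = range h"
    using e by (auto simp: ran_def image_iff) (metis inv_f_f)
  then have "small (range h)" unfolding small_def by blast
  then show ?thesis using assms small_subset by blast
qed

text \<open>An infinite type is equinumerous with its square, so one index can code two: the first
  selects a member \<open>y\<close> of \<open>S\<close>, the second a member of
  \<open>F y\<close>.\<close>

lemma small_UN:
  fixes F :: "('u,'i) nval \<Rightarrow> ('u,'i) nval set"
  assumes "small S" "\<And>y. y \<in> S \<Longrightarrow> small (F y)" shows "small (\<Union>y\<in>S. F y)"
proof -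
  obtain f :: "'i \<Rightarrow> _" where f: "ran f = S" using assms(1) by (auto simp: small_def)
  have "\<forall>y. \<exists>g :: 'i \<Rightarrow> ('u,'i) nval option. y \<in> S \<longrightarrow> ran g = F y"
    using assms(2) by (auto simp: small_def)
  then obtain g :: "_ \<Rightarrow> 'i \<Rightarrow> ('u,'i) nval option" where g: "\<And>y. y \<in> S \<Longrightarrow> ran (g y) = F y" by metis
  obtain b :: "'i \<Rightarrow> 'i \<times> 'i" where "bij b"
    using card_of_Times_same_infinite[OF inf_i] card_of_ordIso
    by (metis UNIV_Times_UNIV bij_betw_inv)
  then have b: "surj b" by (simp add: bij_is_surj)
  let ?h = "\<lambda>i. case f (fst (b i)) of None \<Rightarrow> None | Some y \<Rightarrow> g y (snd (b i))"
  have "ran ?h = (\<Union>y\<in>S. F y)"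
  proof
    show "ran ?h \<subseteq> (\<Union>y\<in>S. F y)"
    proof
      fix x assume "x \<in> ran ?h"
      then obtain i where "?h i = Some x" by (auto simp: ran_def)
      then obtain y where "f (fst (b i)) = Some y" "g y (snd (b i)) = Some x" by (auto split: option.splits)
      then show "x \<in> (\<Union>y\<in>S. F y)" using f g by (auto simp: ran_def)
    qed
    show "(\<Union>y\<in>S. F y) \<subseteq> ran ?h"
    proof
      fix x assume "x \<in> (\<Union>y\<in>S. F y)"
      then obtain y where y: "y \<in> S" "x \<in> F y" by blast
      from y(1) f obtain i where "f i = Some y" unfolding ran_def by blast
      moreover from y g[OF y(1)] obtain j where "g y j = Some x" unfolding ran_def by blast
      moreover obtain k where "b k = (i, j)" using b by (metis surjD)
      ultimately have "?h k = Some x" by simp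
      then show "x \<in> ran ?h" unfolding ran_def by blast
    qed
  qed
  then show ?thesis unfolding small_def by blast
qed

lemma small_Un:
  fixes S :: "('u,'i) nval set"
  assumes "small S" "small T" shows "small (S \<union> T)"
proof -
  \<comment> \<open>Any two distinct values can serve as indices that turn the binary union into an
    indexed one.\<close>
  have "small {UnitV, PairV UnitV UnitV :: ('u,'i) nval}"
    by (rule small_countable[of _ "\<lambda>n. if n = 0 then UnitV else PairV UnitV UnitV"])
      (auto simp: image_iff)
  then have "small (\<Union>y\<in>{UnitV, PairV UnitV UnitV :: ('u,'i) nval}. if y = UnitV then S else T)"
    by (rule small_UN) (use assms in auto)
  then show ?thesis by (simp add: Un_commute)
qed

end

section \<open>Soundness of NRC typing and NRC-definable functions\<close>

instance ty :: countable by countable_datatype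
instance trm :: countable by countable_datatype
instance fml :: countable by countable_datatype

lemma etype_cong: "(\<And>x. x \<in> fve E \<Longrightarrow> \<Gamma> x = \<Gamma>' x) \<Longrightarrow> etype \<Gamma> E = etype \<Gamma>' E"
proof (induction E arbitrary: \<Gamma> \<Gamma>')
  case (EBigU x E1 E2)
  have "etype \<Gamma> E2 = etype \<Gamma>' E2" using EBigU.prems by (intro EBigU.IH(2)) auto
  moreover have "etype (\<Gamma>(x := T)) E1 = etype (\<Gamma>'(x := T)) E1" for T
    using EBigU.prems by (intro EBigU.IH(1)) auto
  ultimately show ?case by (simp cong: option.case_cong ty.case_cong)
next
  case (EPair E1 E2)
  have "etype \<Gamma> E1 = etype \<Gamma>' E1" "etype \<Gamma> E2 = etype \<Gamma>' E2"
    using EPair.prems by (auto intro!: EPair.IH)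
  then show ?case by simp
next
  case (EUn E1 E2)
  have "etype \<Gamma> E1 = etype \<Gamma>' E1" "etype \<Gamma> E2 = etype \<Gamma>' E2"
    using EUn.prems by (auto intro!: EUn.IH)
  then show ?case by simp
next
  case (EDiff E1 E2)
  have "etype \<Gamma> E1 = etype \<Gamma>' E1" "etype \<Gamma> E2 = etype \<Gamma>' E2"
    using EDiff.prems by (auto intro!: EDiff.IH)
  then show ?case by simp
next
  case (EPi1 E)
  have "etype \<Gamma> E = etype \<Gamma>' E" using EPi1.prems by (intro EPi1.IH) auto
  then show ?case by simp
next
  case (EPi2 E)
  have "etype \<Gamma> E = etype \<Gamma>' E" using EPi2.prems by (intro EPi2.IH) auto
  then show ?case by simp
next
  case (ESng E)
  have "etype \<Gamma> E = etype \<Gamma>' E" using ESng.prems by (intro ESng.IH) auto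
  then show ?case by simp
next
  case (EGet T E)
  have "etype \<Gamma> E = etype \<Gamma>' E" using EGet.prems by (intro EGet.IH) auto
  then show ?case by simp
qed auto

lemma eval_cong: "(\<And>x. x \<in> fve E \<Longrightarrow> \<rho> x = \<rho>' x) \<Longrightarrow> eval E \<rho> = eval E \<rho>'"
proof (induction E arbitrary: \<rho> \<rho>')
  case (EBigU x E1 E2)
  have "eval E2 \<rho> = eval E2 \<rho>'" using EBigU.prems by (intro EBigU.IH(2)) auto
  moreover have "eval E1 (\<rho>(x := y)) = eval E1 (\<rho>'(x := y))" for y
    using EBigU.prems by (intro EBigU.IH(1)) auto
  ultimately show ?case by simp
next
  case (EPair E1 E2)
  have "eval E1 \<rho> = eval E1 \<rho>'" "eval E2 \<rho> = eval E2 \<rho>'"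
    using EPair.prems by (auto intro!: EPair.IH)
  then show ?case by simp
next
  case (EUn E1 E2)
  have "eval E1 \<rho> = eval E1 \<rho>'" "eval E2 \<rho> = eval E2 \<rho>'"
    using EUn.prems by (auto intro!: EUn.IH)
  then show ?case by simp
next
  case (EDiff E1 E2)
  have "eval E1 \<rho> = eval E1 \<rho>'" "eval E2 \<rho> = eval E2 \<rho>'"
    using EDiff.prems by (auto intro!: EDiff.IH)
  then show ?case by simp
next
  case (EPi1 E)
  have "eval E \<rho> = eval E \<rho>'" using EPi1.prems by (intro EPi1.IH) auto
  then show ?case by simp
next
  case (EPi2 E)
  have "eval E \<rho> = eval E \<rho>'" using EPi2.prems by (intro EPi2.IH) auto
  then show ?case by simp
next
  case (ESng E)
  have "eval E \<rho> = eval E \<rho>'" using ESng.prems by (intro ESng.IH) auto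
  then show ?case by simp
next
  case (EGet T E)
  have "eval E \<rho> = eval E \<rho>'" using EGet.prems by (intro EGet.IH) auto
  then show ?case by simp
qed auto

lemma hastype_dflt [simp]: "hastype (dflt T) T" and canon_dflt [simp]: "canon (dflt T) = dflt T"
  using cano_dflt cano_def by blast+

text \<open>If all members are equal up to \<open>veq\<close>, every choice made by
  \<open>SOME\<close> has the same normal form; otherwise the default is returned, which is its own
  normal form. Hence \<open>get\<close> respects extensional equality.\<close>

lemma canon_get:
  fixes S :: "('u, 'i) nval set"
  shows "canon (if \<exists>v\<in>S. \<forall>w\<in>S. veq v w then SOME v. v \<in> S else dflt T) =
         (if \<exists>v\<in>canon ` S. \<forall>w\<in>canon ` S. veq v w then SOME v. v \<in> canon ` S else dflt T)"
proof (cases "\<exists>v\<in>S. \<forall>w\<in>S. veq v w")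
  case True
  then obtain v where v: "v \<in> S" "\<And>w. w \<in> S \<Longrightarrow> canon w = canon v" by (auto simp: veq_iff)
  have c: "canon ` S = {canon v}" using v(1) by (auto intro: v(2))
  have "(SOME v. v \<in> S) \<in> S" using v(1) by (metis someI)
  then have "canon (SOME v. v \<in> S) = canon v" by (rule v(2))
  then show ?thesis unfolding if_P[OF True] c by (simp add: veq_iff)
next
  case False
  then have F: "\<not> (\<exists>v\<in>canon ` S. \<forall>w\<in>canon ` S. veq v w)" by (auto simp: veq_iff)
  show ?thesis unfolding if_not_P[OF False] if_not_P[OF F] by (rule canon_dflt)
qed

lemma etype_PairD: "etype \<Gamma> (EPair a b) = Some T \<Longrightarrow>
    \<exists>A B. T = TProd A B \<and> etype \<Gamma> a = Some A \<and> etype \<Gamma> b = Some B"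
  by (auto split: option.splits)

lemma etype_PiD: "etype \<Gamma> (EPi1 a) = Some T \<Longrightarrow> \<exists>B. etype \<Gamma> a = Some (TProd T B)"
   "etype \<Gamma> (EPi2 a) = Some T \<Longrightarrow> \<exists>A. etype \<Gamma> a = Some (TProd A T)"
  by (auto split: option.splits ty.splits)

lemma etype_UnD: "etype \<Gamma> (EUn a b) = Some T \<Longrightarrow>
    \<exists>A. T = TSet A \<and> etype \<Gamma> a = Some T \<and> etype \<Gamma> b = Some T"
  "etype \<Gamma> (EDiff a b) = Some T \<Longrightarrow>
    \<exists>A. T = TSet A \<and> etype \<Gamma> a = Some T \<and> etype \<Gamma> b = Some T"
  by (auto split: option.splits ty.splits if_splits)

lemma etype_BigUD: "etype \<Gamma> (EBigU x a b) = Some U \<Longrightarrow>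
    \<exists>T V. U = TSet V \<and> etype \<Gamma> b = Some (TSet T) \<and> etype (\<Gamma>(x := T)) a = Some U"
  by (auto split: option.splits ty.splits)

context inf_types begin

text \<open>Typing and invariance under normalisation go through one induction, because the binder
  case must know that the members being bound are well typed before it can apply the invariance.
  Closure of small sets under unions guarantees that \<open>mkset\<close> is never applied to a set
  without a code.\<close>

lemma eval_sound:
  fixes \<rho> :: "nat \<Rightarrow> ('u, 'i) nval"
  assumes "etype \<Gamma> E = Some T" "\<And>x. x \<in> fve E \<Longrightarrow> hastype (\<rho> x) (\<Gamma> x)"
  shows "hastype (eval E \<rho>) T \<and> canon (eval E \<rho>) = eval E (\<lambda>x. canon (\<rho> x))"
  using assms
proof (induction E arbitrary: \<Gamma> \<rho> T)
  case (EPair a b)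
  from etype_PairD[OF EPair.prems(1)] obtain A B where
    A: "T = TProd A B" "etype \<Gamma> a = Some A" "etype \<Gamma> b = Some B" by blast
  have "hastype (eval a \<rho>) A \<and> canon (eval a \<rho>) = eval a (\<lambda>x. canon (\<rho> x))"
    by (rule EPair.IH(1)[OF A(2)]) (use EPair.prems(2) in auto)
  moreover have "hastype (eval b \<rho>) B \<and> canon (eval b \<rho>) = eval b (\<lambda>x. canon (\<rho> x))"
    by (rule EPair.IH(2)[OF A(3)]) (use EPair.prems(2) in auto)
  ultimately show ?case by (simp add: A(1))
next
  case (EPi1 a)
  from etype_PiD(1)[OF EPi1.prems(1)] obtain B where B: "etype \<Gamma> a = Some (TProd T B)" ..
  have *: "hastype (eval a \<rho>) (TProd T B) \<and> canon (eval a \<rho>) = eval a (\<lambda>x. canon (\<rho> x))"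
    by (rule EPi1.IH[OF B]) (use EPi1.prems(2) in auto)
  then obtain v w where "eval a \<rho> = PairV v w" "hastype v T" by auto
  with * show ?case by (metis canon.simps(3) eval.simps(4) vfst.simps(1))
next
  case (EPi2 a)
  from etype_PiD(2)[OF EPi2.prems(1)] obtain B where B: "etype \<Gamma> a = Some (TProd B T)" ..
  have *: "hastype (eval a \<rho>) (TProd B T) \<and> canon (eval a \<rho>) = eval a (\<lambda>x. canon (\<rho> x))"
    by (rule EPi2.IH[OF B]) (use EPi2.prems(2) in auto)
  then obtain v w where "eval a \<rho> = PairV v w" "hastype w T" by auto
  with * show ?case by (metis canon.simps(3) eval.simps(5) vsnd.simps(1))
next
  case (EEmpty U)
  then show ?case by (auto simp: hastype_mkset canon_mkset simp del: hastype.simps)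
next
  case (ESng a)
  then obtain A where "etype \<Gamma> a = Some A" "T = TSet A" by (auto split: option.splits)
  with ESng.IH[of \<Gamma> A \<rho>] ESng.prems(2) show ?case
    by (auto simp: hastype_mkset canon_mkset simp del: hastype.simps)
next
  case (EUn a b)
  from etype_UnD(1)[OF EUn.prems(1)] obtain A where A: "T = TSet A" "etype \<Gamma> a = Some T" "etype \<Gamma> b = Some T" by blast
  have 1: "hastype (eval a \<rho>) T \<and> canon (eval a \<rho>) = eval a (\<lambda>x. canon (\<rho> x))"
    by (rule EUn.IH(1)[OF A(2)]) (use EUn.prems(2) in auto)
  have 2: "hastype (eval b \<rho>) T \<and> canon (eval b \<rho>) = eval b (\<lambda>x. canon (\<rho> x))"
    by (rule EUn.IH(2)[OF A(3)]) (use EUn.prems(2) in auto)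
  have "hastype w A" if "w \<in> elems (eval a \<rho>) \<union> elems (eval b \<rho>)" for w
    using that 1 2 unfolding A(1) by (metis UnE hastype_elems)
  moreover have "canon (eval (EUn a b) \<rho>) = eval (EUn a b) (\<lambda>x. canon (\<rho> x))"
    using 1 2 by (simp add: canon_mkset small_Un image_Un elems_canon[symmetric])
  ultimately show ?case unfolding A(1) by (simp add: hastype_mkset small_Un del: hastype.simps)
next
  case (EDiff a b)
  from etype_UnD(2)[OF EDiff.prems(1)] obtain A where A: "T = TSet A" "etype \<Gamma> a = Some T" "etype \<Gamma> b = Some T" by blast
  have 1: "hastype (eval a \<rho>) T \<and> canon (eval a \<rho>) = eval a (\<lambda>x. canon (\<rho> x))"
    by (rule EDiff.IH(1)[OF A(2)]) (use EDiff.prems(2) in auto)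
  have 2: "hastype (eval b \<rho>) T \<and> canon (eval b \<rho>) = eval b (\<lambda>x. canon (\<rho> x))"
    by (rule EDiff.IH(2)[OF A(3)]) (use EDiff.prems(2) in auto)
  have s: "small {v \<in> elems (eval a \<rho>). \<not> (\<exists>w\<in>elems (eval b \<rho>). veq v w)}"
    by (rule small_subset[OF small_elems]) blast
  have e: "canon ` {v \<in> elems (eval a \<rho>). \<not> (\<exists>w\<in>elems (eval b \<rho>). veq v w)} =
    {v \<in> elems (canon (eval a \<rho>)). \<not> (\<exists>w\<in>elems (canon (eval b \<rho>)). veq v w)}"
    by (auto simp: elems_canon veq_iff)
  have "hastype w A" if "w \<in> elems (eval a \<rho>)" for w
    using that 1 unfolding A(1) by (metis hastype_elems)
  moreover have "canon (eval (EDiff a b) \<rho>) = eval (EDiff a b) (\<lambda>x. canon (\<rho> x))"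
    using 1 2 unfolding eval.simps canon_mkset[OF s] e by simp
  ultimately show ?case unfolding A(1) using s by (simp add: hastype_mkset del: hastype.simps)
next
  case (EBigU x a b)
  from etype_BigUD[OF EBigU.prems(1)] obtain U V where
    A: "T = TSet V" "etype \<Gamma> b = Some (TSet U)" "etype (\<Gamma>(x := U)) a = Some T" by blast
  have 2: "hastype (eval b \<rho>) (TSet U) \<and> canon (eval b \<rho>) = eval b (\<lambda>x. canon (\<rho> x))"
    by (rule EBigU.IH(2)[OF A(2)]) (use EBigU.prems(2) in auto)
  have 1: "hastype (eval a (\<rho>(x := y))) T \<and>
      canon (eval a (\<rho>(x := y))) = eval a ((\<lambda>x. canon (\<rho> x))(x := canon y))" if "y \<in> elems (eval b \<rho>)" for y
  proof -
    have "hastype y U" using 2 that by (metis hastype_elems)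
    then have "hastype (eval a (\<rho>(x := y))) T \<and>
        canon (eval a (\<rho>(x := y))) = eval a (\<lambda>z. canon ((\<rho>(x := y)) z))"
      by (intro EBigU.IH(1)[OF A(3)]) (use EBigU.prems(2) in auto)
    moreover have "(\<lambda>z. canon ((\<rho>(x := y)) z)) = (\<lambda>x. canon (\<rho> x))(x := canon y)" by auto
    ultimately show ?thesis by simp
  qed
  have s: "small (\<Union>y\<in>elems (eval b \<rho>). elems (eval a (\<rho>(x := y))))"
    by (rule small_UN) auto
  have "canon ` (\<Union>y\<in>elems (eval b \<rho>). elems (eval a (\<rho>(x := y)))) =
      (\<Union>y\<in>elems (eval b \<rho>). elems (canon (eval a (\<rho>(x := y)))))"
    by (auto simp: elems_canon)
  also have "\<dots> = (\<Union>y\<in>elems (eval b (\<lambda>x. canon (\<rho> x))). elems (eval a ((\<lambda>x. canon (\<rho> x))(x := y))))"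
    unfolding 2[THEN conjunct2, symmetric] elems_canon[of "eval b \<rho>"] UN_simps using 1 by (intro SUP_cong) auto
  finally have e: "canon ` (\<Union>y\<in>elems (eval b \<rho>). elems (eval a (\<rho>(x := y)))) = \<dots>" .
  have "hastype w V" if "y \<in> elems (eval b \<rho>)" "w \<in> elems (eval a (\<rho>(x := y)))" for y w
    using 1[OF that(1)] that(2) A(1) by (metis hastype_elems)
  then have "hastype (eval (EBigU x a b) \<rho>) T"
    unfolding A(1) eval.simps hastype_mkset[OF s] by blast
  then show ?case unfolding eval.simps canon_mkset[OF s] e by blast
next
  case (EGet U a)
  then have A: "U = T" "etype \<Gamma> a = Some (TSet T)" by (auto split: if_splits)
  have 1: "hastype (eval a \<rho>) (TSet T) \<and> canon (eval a \<rho>) = eval a (\<lambda>x. canon (\<rho> x))"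
    by (rule EGet.IH[OF A(2)]) (use EGet.prems(2) in auto)
  have h: "hastype w T" if "w \<in> elems (eval a \<rho>)" for w using 1 that by (metis hastype_elems)
  have "hastype (eval (EGet U a) \<rho>) T"
  proof (cases "\<exists>v\<in>elems (eval a \<rho>). \<forall>w\<in>elems (eval a \<rho>). veq v w")
    case True
    then have "\<exists>v. v \<in> elems (eval a \<rho>)" by blast
    then have "(SOME v. v \<in> elems (eval a \<rho>)) \<in> elems (eval a \<rho>)" by (rule someI_ex)
    then show ?thesis using True h by (simp add: Let_def)
  next
    case False
    then have "eval (EGet U a) \<rho> = dflt T" unfolding A(1) eval.simps Let_def by (rule if_not_P)
    then show ?thesis by simp
  qed
  moreover have "canon (eval (EGet U a) \<rho>) = eval (EGet U a) (\<lambda>x. canon (\<rho> x))"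
    unfolding eval.simps Let_def A(1) canon_get elems_canon[symmetric] 1[THEN conjunct2] ..
  ultimately show ?case ..
qed auto

end

section \<open>Names, symbolic values and pattern matching\<close>

text \<open>
  Semantic variables. The first component tells which copy of the formula a variable belongs to:
  \<open>None\<close> for the variables shared by both copies, \<open>Some True\<close> for those private to the left copy,
  \<open>Some False\<close> for those private to the right copy.
\<close>

type_synonym key = "bool option \<times> ty \<times> nat"

type_synonym ('u, 'i) valn = "key \<Rightarrow> ('u, 'i) nval"

abbreviation kty :: "key \<Rightarrow> ty" where
  "kty k \<equiv> fst (snd k)"

definition val :: "('u, 'i) valn \<Rightarrow> bool" where
  "val \<mu> \<longleftrightarrow> (\<forall>k. cano (\<mu> k) (kty k))"

lemma val_upd: "val \<mu> \<Longrightarrow> cano v (kty k) \<Longrightarrow> val (\<mu>(k := v))"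
  unfolding val_def fun_upd_apply by (metis (full_types))

lemma val_cano: "val \<mu> \<Longrightarrow> cano (\<mu> k) (kty k)"
  unfolding val_def by blast

lemma val_dflt: "val (\<lambda>k. dflt (kty k))"
  by (simp add: val_def cano_dflt)

text \<open>
  Symbolic values. Names only have type \<open>TUr\<close> (tag \<open>None\<close>) or a set type (tag \<open>Some T\<close> for
  \<open>TSet T\<close>), so that symbolic values of product type are always explicit pairs.
\<close>

datatype sv = Nm "bool option" "ty option" nat | SU | SP sv sv

instance sv :: countable by countable_datatype

fun keyof :: "bool option \<Rightarrow> ty option \<Rightarrow> nat \<Rightarrow> key" where
  "keyof s None n = (s, TUr, n)"
| "keyof s (Some T) n = (s, TSet T, n)"

lemma keyof_inject [simp]: "keyof s t n = keyof s' t' n' \<longleftrightarrow> s = s' \<and> t = t' \<and> n = n'"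
  by (cases t; cases t') auto

lemma fst_keyof [simp]: "fst (keyof s t n) = s"
  by (cases t) auto

fun stype :: "sv \<Rightarrow> ty" where
  "stype (Nm s t n) = kty (keyof s t n)"
| "stype SU = TUnit"
| "stype (SP a b) = TProd (stype a) (stype b)"

fun keys :: "sv \<Rightarrow> key set" where
  "keys (Nm s t n) = {keyof s t n}"
| "keys SU = {}"
| "keys (SP a b) = keys a \<union> keys b"

fun ev :: "('u, 'i) valn \<Rightarrow> sv \<Rightarrow> ('u, 'i) nval" where
  "ev \<mu> (Nm s t n) = \<mu> (keyof s t n)"
| "ev \<mu> SU = UnitV"
| "ev \<mu> (SP a b) = PairV (ev \<mu> a) (ev \<mu> b)"

text \<open>Linear symbolic values act as patterns: since no name repeats, the components of a value
  can be assigned to the names independently, and \<open>bnd\<close> matches any value of the right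
  type.\<close>

fun linear :: "sv \<Rightarrow> bool" where
  "linear (Nm s t n) = True"
| "linear SU = True"
| "linear (SP a b) = (linear a \<and> linear b \<and> keys a \<inter> keys b = {})"

fun bnd :: "sv \<Rightarrow> ('u, 'i) nval \<Rightarrow> ('u, 'i) valn \<Rightarrow> ('u, 'i) valn" where
  "bnd (Nm s t n) v \<mu> = \<mu>(keyof s t n := v)"
| "bnd SU v \<mu> = \<mu>"
| "bnd (SP a b) v \<mu> = bnd b (vsnd v) (bnd a (vfst v) \<mu>)"

lemma finite_keys [simp]: "finite (keys p)"
  by (induction p) auto

lemma ev_cano: "val \<mu> \<Longrightarrow> cano (ev \<mu> p) (stype p)"
proof (induction p)
  case (Nm s t n)
  then show ?case unfolding ev.simps stype.simps by (rule val_cano)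
qed auto

lemma ev_cong: "(\<And>k. k \<in> keys p \<Longrightarrow> \<mu> k = \<mu>' k) \<Longrightarrow> ev \<mu> p = ev \<mu>' p"
proof (induction p)
  case (SP a b)
  have "ev \<mu> a = ev \<mu>' a" by (rule SP.IH(1), rule SP.prems) simp
  moreover have "ev \<mu> b = ev \<mu>' b" by (rule SP.IH(2), rule SP.prems) simp
  ultimately show ?case by simp
qed simp_all

lemma bnd_other: "k \<notin> keys p \<Longrightarrow> bnd p v \<mu> k = \<mu> k"
  by (induction p arbitrary: v \<mu>) auto

lemma bnd_cong_at: "\<mu> k = \<mu>' k \<Longrightarrow> bnd p v \<mu> k = bnd p v \<mu>' k"
proof (induction p arbitrary: v \<mu> \<mu>')
  case (SP a b)
  show ?case unfolding bnd.simps by (intro SP.IH SP.prems)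
qed simp_all

lemma val_bnd: "val \<mu> \<Longrightarrow> cano v (stype p) \<Longrightarrow> val (bnd p v \<mu>)"
  by (induction p arbitrary: v \<mu>) (auto intro: val_upd)

lemma ev_bnd: "linear p \<Longrightarrow> cano v (stype p) \<Longrightarrow> ev (bnd p v \<mu>) p = v"
proof (induction p arbitrary: v \<mu>)
  case (SP a b)
  then obtain v1 v2 where v: "v = PairV v1 v2" "cano v1 (stype a)" "cano v2 (stype b)" by auto
  have "ev (bnd b v2 (bnd a v1 \<mu>)) a = ev (bnd a v1 \<mu>) a"
    using SP.prems(1) by (intro ev_cong bnd_other) auto
  then show ?case using SP v by simp
qed auto

lemma ev_bnd_other: "keys q \<inter> keys p = {} \<Longrightarrow> ev (bnd p v \<mu>) q = ev \<mu> q"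
  by (intro ev_cong bnd_other) auto

text \<open>This replaces the choice of a fresh variable of type \<open>T\<close>: as names have
  only atom or set type, a variable of product type becomes a tree of fresh names.\<close>

lemma fresh_sv:
  assumes "finite A"
  shows "\<exists>p. stype p = T \<and> linear p \<and> keys p \<inter> A = {} \<and> fst ` keys p \<subseteq> {s}"
  using assms
proof (induction T arbitrary: A)
  case (TProd T1 T2)
  then obtain a where a: "stype a = T1" "linear a" "keys a \<inter> A = {}" "fst ` keys a \<subseteq> {s}" by meson
  have "finite (A \<union> keys a)" using TProd by simp
  then obtain b where "stype b = T2" "linear b" "keys b \<inter> (A \<union> keys a) = {}" "fst ` keys b \<subseteq> {s}"
    using TProd.IH(2) by meson
  with a show ?case by (intro exI[of _ "SP a b"]) auto
next
  case TUnit
  show ?case by (intro exI[of _ SU]) auto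
next
  case TUr
  have "finite (snd ` snd ` A)" using TUr by simp
  then obtain n where "n \<notin> snd ` snd ` A" using ex_new_if_finite infinite_UNIV_nat by blast
  then have "(s, TUr, n) \<notin> A" by force
  then show ?case by (intro exI[of _ "Nm s None n"]) auto
next
  case (TSet T)
  have "finite (snd ` snd ` A)" using TSet by simp
  then obtain n where "n \<notin> snd ` snd ` A" using ex_new_if_finite infinite_UNIV_nat by blast
  then have "(s, TSet T, n) \<notin> A" by force
  then show ?case by (intro exI[of _ "Nm s (Some T) n"]) auto
qed

section \<open>Functions and conditions definable by NRC expressions\<close>

definition venv :: "('u, 'i) valn \<Rightarrow> nat \<Rightarrow> ('u, 'i) nval" where
  "venv \<mu> = (\<lambda>x. \<mu> (from_nat x))"

abbreviation tenv :: "nat \<Rightarrow> ty" where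
  "tenv \<equiv> \<lambda>x. kty (from_nat x)"

text \<open>Definability is kept extensional: only the names that an expression may mention and its
  values at canonical valuations are recorded. Expressions can then be combined without syntactic
  substitution.\<close>

definition D :: "key set \<Rightarrow> ty \<Rightarrow> (('u, 'i) valn \<Rightarrow> ('u, 'i) nval) \<Rightarrow> bool" where
  "D X T f \<longleftrightarrow> (\<exists>E. etype tenv E = Some T \<and> fve E \<subseteq> to_nat ` X \<and>
     (\<forall>\<mu>. val \<mu> \<longrightarrow> eval E (venv \<mu>) = f \<mu>))"

lemma DI: "etype tenv E = Some T \<Longrightarrow> fve E \<subseteq> to_nat ` X \<Longrightarrow>
    (\<And>\<mu>. val \<mu> \<Longrightarrow> eval E (venv \<mu>) = f \<mu>) \<Longrightarrow> D X T f"
  unfolding D_def by blast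

lemma DE: assumes "D X T f"
  obtains E where "etype tenv E = Some T" "fve E \<subseteq> to_nat ` X"
    "\<And>\<mu>. val \<mu> \<Longrightarrow> eval E (venv \<mu>) = f \<mu>"
  using assms unfolding D_def by blast

lemma D_mono: "D X T f \<Longrightarrow> X \<subseteq> Y \<Longrightarrow> D Y T f"
  unfolding D_def by (meson image_mono order_trans)

lemma D_ext: "D X T f \<Longrightarrow> (\<And>\<mu>. val \<mu> \<Longrightarrow> f \<mu> = g \<mu>) \<Longrightarrow> D X T g"
  unfolding D_def by fastforce

text \<open>Turns the bound \<open>X\<close> on free variables into a semantic fact; this is what
  allows fresh names to be rebound without changing a separator.\<close>

lemma D_dep: assumes "D X T f" "val \<mu>" "val \<mu>'" "\<And>k. k \<in> X \<Longrightarrow> \<mu> k = \<mu>' k" shows "f \<mu> = f \<mu>'"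
proof -
  obtain E where E: "etype tenv E = Some T" "fve E \<subseteq> to_nat ` X" "\<And>\<mu>. val \<mu> \<Longrightarrow> eval E (venv \<mu>) = f \<mu>"
    using DE[OF assms(1)] by blast
  have "eval E (venv \<mu>) = eval E (venv \<mu>')"
    using E(2) assms(4) by (intro eval_cong) (auto simp: venv_def)
  then show ?thesis using E(3) assms(2,3) by simp
qed

context inf_types begin

lemma D_cano:
  fixes f :: "_ \<Rightarrow> ('u, 'i) nval"
  assumes "D X T f" "val \<mu>" shows "cano (f \<mu>) T"
proof -
  obtain E where E: "etype tenv E = Some T" "fve E \<subseteq> to_nat ` X" "\<And>\<mu>. val \<mu> \<Longrightarrow> eval E (venv \<mu>) = f \<mu>"
    using DE[OF assms(1)] by blast
  have "hastype (venv \<mu> x) (tenv x)" "canon (venv \<mu> x) = venv \<mu> x" for x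
    using val_cano[OF assms(2), of "from_nat x"] unfolding venv_def cano_def by blast+
  then show ?thesis using eval_sound[OF E(1), of "venv \<mu>"] E(3)[OF assms(2)] by (simp add: cano_def)
qed

lemma D_var: "k \<in> X \<Longrightarrow> D X (kty k) (\<lambda>\<mu>. \<mu> k)"
  by (rule DI[of "EVar (to_nat k)"]) (auto simp: venv_def)

lemma D_unit: "D X TUnit (\<lambda>\<mu>. UnitV)"
  by (rule DI[of EUnit]) auto

lemma D_pair:
  assumes "D X A f" "D X B g" shows "D X (TProd A B) (\<lambda>\<mu>. PairV (f \<mu>) (g \<mu>))"
proof -
  obtain E where E: "etype tenv E = Some A" "fve E \<subseteq> to_nat ` X" "\<And>\<mu>. val \<mu> \<Longrightarrow> eval E (venv \<mu>) = f \<mu>"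
    using DE[OF assms(1)] by blast
  obtain F where F: "etype tenv F = Some B" "fve F \<subseteq> to_nat ` X" "\<And>\<mu>. val \<mu> \<Longrightarrow> eval F (venv \<mu>) = g \<mu>"
    using DE[OF assms(2)] by blast
  show ?thesis by (rule DI[of "EPair E F"]) (use E F in auto)
qed

lemma D_proj:
  assumes "D X (TProd A B) f" shows "D X A (\<lambda>\<mu>. vfst (f \<mu>))" "D X B (\<lambda>\<mu>. vsnd (f \<mu>))"
proof -
  obtain E where E: "etype tenv E = Some (TProd A B)" "fve E \<subseteq> to_nat ` X" "\<And>\<mu>. val \<mu> \<Longrightarrow> eval E (venv \<mu>) = f \<mu>"
    using DE[OF assms(1)] by blast
  show "D X A (\<lambda>\<mu>. vfst (f \<mu>))" by (rule DI[of "EPi1 E"]) (use E in auto)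
  show "D X B (\<lambda>\<mu>. vsnd (f \<mu>))" by (rule DI[of "EPi2 E"]) (use E in auto)
qed

lemma D_empty: "D X (TSet T) (\<lambda>\<mu>. mkset {})"
  by (rule DI[of "EEmpty T"]) auto

lemma D_sng:
  assumes "D X A f" shows "D X (TSet A) (\<lambda>\<mu>. mkset {f \<mu>})"
proof -
  obtain E where E: "etype tenv E = Some A" "fve E \<subseteq> to_nat ` X" "\<And>\<mu>. val \<mu> \<Longrightarrow> eval E (venv \<mu>) = f \<mu>"
    using DE[OF assms(1)] by blast
  show ?thesis by (rule DI[of "ESng E"]) (use E in auto)
qed

lemma D_un:
  assumes "D X (TSet A) f" "D X (TSet A) g"
  shows "D X (TSet A) (\<lambda>\<mu>. mkset (elems (f \<mu>) \<union> elems (g \<mu>)))"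
proof -
  obtain E where E: "etype tenv E = Some (TSet A)" "fve E \<subseteq> to_nat ` X" "\<And>\<mu>. val \<mu> \<Longrightarrow> eval E (venv \<mu>) = f \<mu>"
    using DE[OF assms(1)] by blast
  obtain F where F: "etype tenv F = Some (TSet A)" "fve F \<subseteq> to_nat ` X" "\<And>\<mu>. val \<mu> \<Longrightarrow> eval F (venv \<mu>) = g \<mu>"
    using DE[OF assms(2)] by blast
  show ?thesis by (rule DI[of "EUn E F"]) (use E F in auto)
qed

lemma D_diff:
  fixes f g :: "_ \<Rightarrow> ('u, 'i) nval"
  assumes "D X (TSet A) f" "D X (TSet A) g"
  shows "D X (TSet A) (\<lambda>\<mu>. mkset (elems (f \<mu>) - elems (g \<mu>)))"
proof -
  obtain E where E: "etype tenv E = Some (TSet A)" "fve E \<subseteq> to_nat ` X" "\<And>\<mu>. val \<mu> \<Longrightarrow> eval E (venv \<mu>) = f \<mu>"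
    using DE[OF assms(1)] by blast
  obtain F where F: "etype tenv F = Some (TSet A)" "fve F \<subseteq> to_nat ` X" "\<And>\<mu>. val \<mu> \<Longrightarrow> eval F (venv \<mu>) = g \<mu>"
    using DE[OF assms(2)] by blast
  have "{v \<in> elems (f \<mu>). \<not> (\<exists>w\<in>elems (g \<mu>). veq v w)} = elems (f \<mu>) - elems (g \<mu>)" if "val \<mu>" for \<mu>
  proof -
    have "veq v w \<longleftrightarrow> v = w" if "v \<in> elems (f \<mu>)" "w \<in> elems (g \<mu>)" for v w
      using that \<open>val \<mu>\<close> assms by (meson D_cano cano_elems cano_veq)
    then show ?thesis by auto
  qed
  then show ?thesis by (intro DI[of "EDiff E F"]) (use E F in auto)
qed

lemma D_big_key:
  fixes f g :: "_ \<Rightarrow> ('u, 'i) nval"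
  assumes f: "D (insert k X) (TSet U) f" and g: "D X (TSet (kty k)) g"
  shows "D X (TSet U) (\<lambda>\<mu>. mkset (\<Union>y\<in>elems (g \<mu>). elems (f (\<mu>(k := y)))))"
proof -
  obtain E where E: "etype tenv E = Some (TSet U)" "fve E \<subseteq> to_nat ` insert k X"
    "\<And>\<mu>. val \<mu> \<Longrightarrow> eval E (venv \<mu>) = f \<mu>" using DE[OF f] by blast
  obtain G where G: "etype tenv G = Some (TSet (kty k))" "fve G \<subseteq> to_nat ` X"
    "\<And>\<mu>. val \<mu> \<Longrightarrow> eval G (venv \<mu>) = g \<mu>" using DE[OF g] by blast
  let ?E = "EBigU (to_nat k) E G"
  have "etype (tenv(to_nat k := kty k)) E = etype tenv E" by (rule etype_cong) auto
  then have 1: "etype tenv ?E = Some (TSet U)" using E(1) G(1) by simp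
  have 2: "fve ?E \<subseteq> to_nat ` X" using E(2) G(2) by auto
  show ?thesis
  proof (rule DI[OF 1 2])
    fix \<mu> :: "('u, 'i) valn" assume v: "val \<mu>"
    have "eval E ((venv \<mu>)(to_nat k := y)) = f (\<mu>(k := y))" if "y \<in> elems (g \<mu>)" for y
    proof -
      have "cano y (kty k)" using that D_cano[OF g v] cano_elems by blast
      then have "val (\<mu>(k := y))" using v val_upd by blast
      then have "eval E (venv (\<mu>(k := y))) = f (\<mu>(k := y))" by (rule E(3))
      moreover have "eval E ((venv \<mu>)(to_nat k := y)) = eval E (venv (\<mu>(k := y)))"
        using E(2) by (intro eval_cong) (auto simp: venv_def)
      ultimately show ?thesis by simp
    qed
    then show "eval ?E (venv \<mu>) = mkset (\<Union>y\<in>elems (g \<mu>). elems (f (\<mu>(k := y))))"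
      using G(3)[OF v] by (simp cong: SUP_cong)
  qed
qed

text \<open>A local binding is expressed as the big union over a singleton, which is why the result
  must have a set type.\<close>

lemma D_let_key:
  fixes f g :: "_ \<Rightarrow> ('u, 'i) nval"
  assumes f: "D (insert k X) (TSet U) f" and g: "D X (kty k) g"
  shows "D X (TSet U) (\<lambda>\<mu>. f (\<mu>(k := g \<mu>)))"
proof (rule D_ext[OF D_big_key[OF f D_sng[OF g]]])
  fix \<mu> :: "('u, 'i) valn" assume v: "val \<mu>"
  then have "cano (f (\<mu>(k := g \<mu>))) (TSet U)" using D_cano[OF f] val_upd D_cano[OF g] by blast
  then show "mkset (\<Union>y\<in>elems (mkset {g \<mu>}). elems (f (\<mu>(k := y)))) = f (\<mu>(k := g \<mu>))"
    by (simp add: mkset_elems)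
qed

text \<open>The pattern is bound name by name, its parts receiving the projections of
  \<open>g\<close>; linearity keeps the names of the second part apart from those bound by the
  first.\<close>

lemma D_bnd:
  fixes f g :: "_ \<Rightarrow> ('u, 'i) nval"
  assumes "linear p" "keys p \<inter> X = {}" "D (X \<union> keys p) (TSet U) f" "D X (stype p) g"
  shows "D X (TSet U) (\<lambda>\<mu>. f (bnd p (g \<mu>) \<mu>))"
  using assms
proof (induction p arbitrary: X f g)
  case (Nm s t n)
  show ?case unfolding bnd.simps by (rule D_let_key) (use Nm in simp_all)
next
  case SU
  then show ?case by simp
next
  case (SP a b)
  have ab: "D (X \<union> keys a) (stype b) (\<lambda>\<mu>. vsnd (g \<mu>))"
    using D_proj(2) SP.prems(4) D_mono by (metis Un_upper1 stype.simps(3))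
  have 1: "D (X \<union> keys a) (TSet U) (\<lambda>\<mu>. f (bnd b (vsnd (g \<mu>)) \<mu>))"
    using SP.prems ab by (intro SP.IH(2)) (auto simp: Un_assoc)
  have 2: "D X (TSet U) (\<lambda>\<mu>. f (bnd b (vsnd (g (bnd a (vfst (g \<mu>)) \<mu>))) (bnd a (vfst (g \<mu>)) \<mu>)))"
    using SP.prems 1 D_proj(1) by (intro SP.IH(1)) auto
  show ?case
  proof (rule D_ext[OF 2])
    fix \<mu> :: "('u, 'i) valn" assume v: "val \<mu>"
    have "cano (vfst (g \<mu>)) (stype a)" using D_cano[OF SP.prems(4) v] by auto
    then have "val (bnd a (vfst (g \<mu>)) \<mu>)" using v val_bnd by blast
    \<comment> \<open>\<open>g\<close> mentions only names from \<open>X\<close>, which the pattern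
      avoids, so it may be evaluated again after the first part has been bound.\<close>
    then have "g (bnd a (vfst (g \<mu>)) \<mu>) = g \<mu>"
      using SP.prems(2) v by (intro D_dep[OF SP.prems(4)] bnd_other) auto
    then show "f (bnd b (vsnd (g (bnd a (vfst (g \<mu>)) \<mu>))) (bnd a (vfst (g \<mu>)) \<mu>)) = f (bnd (SP a b) (g \<mu>) \<mu>)"
      by simp
  qed
qed

text \<open>\<open>EBigU\<close> binds a single variable, so a fresh key of the whole type
  \<open>stype p\<close> is bound first and then decomposed along the pattern. Keys, unlike the
  names of symbolic values, may have product type.\<close>

lemma D_big:
  fixes f g :: "_ \<Rightarrow> ('u, 'i) nval"
  assumes X: "finite X" and p: "linear p" "keys p \<inter> X = {}"
    and f: "D (X \<union> keys p) (TSet U) f" and g: "D X (TSet (stype p)) g"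
  shows "D X (TSet U) (\<lambda>\<mu>. mkset (\<Union>y\<in>elems (g \<mu>). elems (f (bnd p y \<mu>))))"
proof -
  have "finite (snd ` snd ` (X \<union> keys p))" using X by simp
  then obtain n where "n \<notin> snd ` snd ` (X \<union> keys p)" using ex_new_if_finite infinite_UNIV_nat by blast
  then have k: "(None, stype p, n) \<notin> X \<union> keys p" by force
  define k where "k = (None :: bool option, stype p, n)"
  have "D (insert k X \<union> keys p) (TSet U) f" using f D_mono by (metis Un_mono order_refl subset_insertI)
  moreover have "D (insert k X) (stype p) (\<lambda>\<mu>. \<mu> k)" using D_var[of k "insert k X"] by (simp add: k_def)
  ultimately have "D (insert k X) (TSet U) (\<lambda>\<mu>. f (bnd p (\<mu> k) \<mu>))"
    using p k by (intro D_bnd) (auto simp: k_def)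
  moreover have "D X (TSet (kty k)) g" using g by (simp add: k_def)
  ultimately have *: "D X (TSet U) (\<lambda>\<mu>. mkset (\<Union>y\<in>elems (g \<mu>). elems (f (bnd p ((\<mu>(k := y)) k) (\<mu>(k := y))))))"
    by (rule D_big_key)
  show ?thesis
  proof (rule D_ext[OF *])
    fix \<mu> :: "('u, 'i) valn" assume v: "val \<mu>"
    have "f (bnd p y (\<mu>(k := y))) = f (bnd p y \<mu>)" if "y \<in> elems (g \<mu>)" for y
    proof (rule D_dep[OF f])
      have y: "cano y (stype p)" using that D_cano[OF g v] cano_elems by blast
      then show "val (bnd p y (\<mu>(k := y)))" "val (bnd p y \<mu>)"
        using v by (auto intro!: val_bnd val_upd simp: k_def)
      fix j assume "j \<in> X \<union> keys p"
      then have "j \<noteq> k" using k k_def by auto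
      then show "bnd p y (\<mu>(k := y)) j = bnd p y \<mu> j" by (intro bnd_cong_at) simp
    qed
    then show "mkset (\<Union>y\<in>elems (g \<mu>). elems (f (bnd p ((\<mu>(k := y)) k) (\<mu>(k := y))))) =
      mkset (\<Union>y\<in>elems (g \<mu>). elems (f (bnd p y \<mu>)))" by (simp cong: SUP_cong)
  qed
qed

lemma D_ev: "keys p \<subseteq> X \<Longrightarrow> D X (stype p) (\<lambda>\<mu>. ev \<mu> p)"
  by (induction p) (auto intro: D_unit D_pair D_var)

definition DB :: "key set \<Rightarrow> (('u, 'i) valn \<Rightarrow> bool) \<Rightarrow> bool" where
  "DB X P \<longleftrightarrow> D X (TSet TUnit) (\<lambda>\<mu>. if P \<mu> then mkset {UnitV} else mkset {})"

lemma DB_ext: "DB X P \<Longrightarrow> (\<And>\<mu>. val \<mu> \<Longrightarrow> P \<mu> = Q \<mu>) \<Longrightarrow> DB X Q"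
  unfolding DB_def by (erule D_ext) simp

lemma DB_mono: "DB X P \<Longrightarrow> X \<subseteq> Y \<Longrightarrow> DB Y P"
  unfolding DB_def by (rule D_mono)

lemma DB_dep: assumes "DB X P" "val \<mu>" "val \<mu>'" "\<And>k. k \<in> X \<Longrightarrow> \<mu> k = \<mu>' k" shows "P \<mu> = P \<mu>'"
  using D_dep[OF assms(1)[unfolded DB_def] assms(2-4)] by (auto simp: mkset_inject split: if_splits)

lemma DB_True: "DB X (\<lambda>_. True)"
  unfolding DB_def by (simp add: D_sng[OF D_unit])

lemma DB_False: "DB X (\<lambda>_. False)"
  unfolding DB_def by (simp add: D_empty)

lemma DB_not: "DB X P \<Longrightarrow> DB X (\<lambda>\<mu>. \<not> P \<mu>)"
  unfolding DB_def by (rule D_ext[OF D_diff[OF D_sng[OF D_unit]]]) auto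

lemma DB_or: "DB X P \<Longrightarrow> DB X Q \<Longrightarrow> DB X (\<lambda>\<mu>. P \<mu> \<or> Q \<mu>)"
  unfolding DB_def by (rule D_ext, rule D_un, assumption, assumption) auto

lemma DB_and: "DB X P \<Longrightarrow> DB X Q \<Longrightarrow> DB X (\<lambda>\<mu>. P \<mu> \<and> Q \<mu>)"
  using DB_not[OF DB_or[OF DB_not DB_not], of X P Q] by simp

text \<open>With Booleans coded as subsets of the unit set, a union of truth values is their
  disjunction.\<close>

lemma DB_ex:
  fixes g :: "_ \<Rightarrow> ('u, 'i) nval"
  assumes X: "finite X" and p: "linear p" "keys p \<inter> X = {}"
    and P: "DB (X \<union> keys p) P" and g: "D X (TSet (stype p)) g"
  shows "DB X (\<lambda>\<mu>. \<exists>y\<in>elems (g \<mu>). P (bnd p y \<mu>))"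
proof -
  have *: "(\<Union>y\<in>elems (g \<mu>). elems (if P (bnd p y \<mu>) then mkset {UnitV} else mkset {})) =
    (if \<exists>y\<in>elems (g \<mu>). P (bnd p y \<mu>) then {UnitV} else {})" for \<mu> :: "('u, 'i) valn"
    by (auto split: if_splits)
  show ?thesis unfolding DB_def
    by (rule D_ext[OF D_big[OF X p P[unfolded DB_def] g]], unfold *) simp
qed

text \<open>The Boolean is itself a set with at most one member, so a union over it contributes
  \<open>f\<close> exactly if \<open>P\<close> holds; the pattern \<open>SU\<close> binds
  nothing.\<close>

lemma D_if:
  fixes f :: "_ \<Rightarrow> ('u, 'i) nval"
  assumes X: "finite X" and P: "DB X P" and f: "D X (TSet T) f"
  shows "D X (TSet T) (\<lambda>\<mu>. if P \<mu> then f \<mu> else mkset {})"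
proof -
  have f': "D (X \<union> keys SU) (TSet T) f" and P': "D X (TSet (stype SU)) (\<lambda>\<mu>. if P \<mu> then mkset {UnitV} else mkset {})"
    using f P by (simp_all add: DB_def)
  show ?thesis
  proof (rule D_ext[OF D_big[OF X _ _ f' P']])
    fix \<mu> :: "('u, 'i) valn" assume "val \<mu>"
    then show "mkset (\<Union>y\<in>elems (if P \<mu> then mkset {UnitV} else mkset {}). elems (f (bnd SU y \<mu>))) =
         (if P \<mu> then f \<mu> else mkset {})"
      using D_cano[OF f] mkset_elems by auto
  qed auto
qed

text \<open>Equality at an arbitrary type is obtained from difference: two values differ iff
  removing the one from the singleton of the other leaves a member.\<close>

lemma DB_eq:
  fixes f g :: "_ \<Rightarrow> ('u, 'i) nval"
  assumes X: "finite X" and f: "D X T f" and g: "D X T g"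
  shows "DB X (\<lambda>\<mu>. f \<mu> = g \<mu>)"
proof -
  obtain p where p: "stype p = T" "linear p" "keys p \<inter> X = {}" using fresh_sv[OF X] by metis
  have "D X (TSet (stype p)) (\<lambda>\<mu>. mkset (elems (mkset {f \<mu>}) - elems (mkset {g \<mu>})))"
    unfolding p(1) by (intro D_diff D_sng f g)
  from DB_ex[OF X p(2,3) DB_True this]
  have "DB X (\<lambda>\<mu>. \<exists>y\<in>elems (mkset (elems (mkset {f \<mu>}) - elems (mkset {g \<mu>}))). True)" .
  then have "DB X (\<lambda>\<mu>. f \<mu> \<noteq> g \<mu>)"
  proof (rule DB_ext)
    fix \<mu> :: "('u, 'i) valn"
    have "small ({f \<mu>} - {g \<mu>})" by (rule small_subset[OF small_sing]) auto
    then show "(\<exists>y\<in>elems (mkset (elems (mkset {f \<mu>}) - elems (mkset {g \<mu>}))). True) = (f \<mu> \<noteq> g \<mu>)"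
      by auto
  qed
  from DB_not[OF this] show ?thesis by simp
qed

lemma D_sep:
  fixes g :: "_ \<Rightarrow> ('u, 'i) nval"
  assumes X: "finite X" and p: "linear p" "keys p \<inter> X = {}"
    and P: "DB (X \<union> keys p) P" and g: "D X (TSet (stype p)) g"
  shows "D X (TSet (stype p)) (\<lambda>\<mu>. mkset {y \<in> elems (g \<mu>). P (bnd p y \<mu>)})"
proof -
  have "D (X \<union> keys p) (TSet (stype p)) (\<lambda>\<mu>. if P \<mu> then mkset {ev \<mu> p} else mkset {})"
    using X by (intro D_if P D_sng D_ev) auto
  from D_big[OF X p this g] show ?thesis
  proof (rule D_ext)
    fix \<mu> :: "('u, 'i) valn" assume v: "val \<mu>"
    have "ev (bnd p y \<mu>) p = y" if "y \<in> elems (g \<mu>)" for y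
      using that ev_bnd[OF p(1)] D_cano[OF g v] cano_elems by blast
    then have "(\<Union>y\<in>elems (g \<mu>). elems (if P (bnd p y \<mu>) then mkset {ev (bnd p y \<mu>) p} else mkset {})) =
         {y \<in> elems (g \<mu>). P (bnd p y \<mu>)}"
      by (auto split: if_splits)
    then show "mkset (\<Union>y\<in>elems (g \<mu>). elems (if P (bnd p y \<mu>) then mkset {ev (bnd p y \<mu>) p} else mkset {})) =
         mkset {y \<in> elems (g \<mu>). P (bnd p y \<mu>)}" by simp
  qed
qed

end

section \<open>Facts and separation\<close>

text \<open>
  A formula with its free variables interpreted symbolically is kept as a closure; association lists
  (default \<open>SU\<close>) are used as environments to make facts countable.
\<close>

fun lk :: "(nat \<times> sv) list \<Rightarrow> nat \<Rightarrow> sv" where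
  "lk [] k = SU"
| "lk ((n, p) # es) k = (if k = n then p else lk es k)"

definition ekeys :: "(nat \<times> sv) list \<Rightarrow> key set" where
  "ekeys es = (\<Union>e\<in>set es. keys (snd e))"

lemma ekeys_Cons [simp]: "ekeys ((n, p) # es) = keys p \<union> ekeys es"
  by (simp add: ekeys_def)

lemma ekeys_Nil [simp]: "ekeys [] = {}"
  by (simp add: ekeys_def)

lemma keys_lk: "keys (lk es k) \<subseteq> ekeys es"
  by (induction es k rule: lk.induct) auto

lemma stype_lk_Cons: "(\<lambda>k. stype (lk ((x, w) # es) k)) = (\<lambda>k. stype (lk es k))(x := stype w)"
  by auto

lemma ev_lk_Cons: "(\<lambda>k. ev \<mu> (lk ((x, w) # es) k)) = (\<lambda>k. ev \<mu> (lk es k))(x := ev \<mu> w)"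
  by auto

lemma stype_cases:
  "stype p = TUr \<longleftrightarrow> (\<exists>s n. p = Nm s None n)"
  "stype p = TUnit \<longleftrightarrow> p = SU"
  "stype p = TProd A B \<longleftrightarrow> (\<exists>a b. p = SP a b \<and> stype a = A \<and> stype b = B)"
  "stype p = TSet T \<longleftrightarrow> (\<exists>s n. p = Nm s (Some T) n)"
proof -
  have "kty (keyof s t n) = (case t of None \<Rightarrow> TUr | Some T \<Rightarrow> TSet T)" for s t n by (cases t) auto
  then show "stype p = TUr \<longleftrightarrow> (\<exists>s n. p = Nm s None n)"
    "stype p = TUnit \<longleftrightarrow> p = SU"
    "stype p = TProd A B \<longleftrightarrow> (\<exists>a b. p = SP a b \<and> stype a = A \<and> stype b = B)"
    "stype p = TSet T \<longleftrightarrow> (\<exists>s n. p = Nm s (Some T) n)"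
    by (cases p; auto split: option.splits)+
qed

fun sfst :: "sv \<Rightarrow> sv" where "sfst (SP a b) = a" | "sfst _ = SU"
fun ssnd :: "sv \<Rightarrow> sv" where "ssnd (SP a b) = b" | "ssnd _ = SU"

text \<open>Since no name has product type, a projection in a well-typed term always meets an
  explicit pair, so every term evaluates symbolically to a name, a unit or a pair.\<close>

fun steval :: "(nat \<times> sv) list \<Rightarrow> trm \<Rightarrow> sv" where
  "steval es (TVar x) = lk es x"
| "steval es TUnitT = SU"
| "steval es (TPair t u) = SP (steval es t) (steval es u)"
| "steval es (TPi1 t) = sfst (steval es t)"
| "steval es (TPi2 t) = ssnd (steval es t)"

lemma steval_sound:
  assumes "ttype (\<lambda>k. stype (lk es k)) t = Some T"
  shows "stype (steval es t) = T \<and> teval (\<lambda>k. ev \<mu> (lk es k)) t = ev \<mu> (steval es t) \<and>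
    keys (steval es t) \<subseteq> ekeys es"
  using assms
proof (induction t arbitrary: T)
  case (TVar x)
  then show ?case using keys_lk by auto
next
  case (TPi1 t)
  then obtain B where "ttype (\<lambda>k. stype (lk es k)) t = Some (TProd T B)" by (auto split: option.splits ty.splits)
  from TPi1.IH[OF this] show ?case by (auto simp: stype_cases)
next
  case (TPi2 t)
  then obtain B where "ttype (\<lambda>k. stype (lk es k)) t = Some (TProd B T)" by (auto split: option.splits ty.splits)
  from TPi2.IH[OF this] show ?case by (auto simp: stype_cases)
next
  case (TPair t u)
  then obtain A B where "ttype (\<lambda>k. stype (lk es k)) t = Some A" "ttype (\<lambda>k. stype (lk es k)) u = Some B"
     "T = TProd A B" by (auto split: option.splits)
  with TPair.IH show ?case by auto
qed auto

section \<open>Negation and equality at all types as derived formulas\<close>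

fun neg :: "fml \<Rightarrow> fml" where
  "neg (FEqU t u) = FNeqU t u"
| "neg (FNeqU t u) = FEqU t u"
| "neg FTop = FBot"
| "neg FBot = FTop"
| "neg (FOr p q) = FAnd (neg p) (neg q)"
| "neg (FAnd p q) = FOr (neg p) (neg q)"
| "neg (FAll x t p) = FEx x t (neg p)"
| "neg (FEx x t p) = FAll x t (neg p)"

lemma sat_neg [simp]: "sat \<sigma> (neg p) \<longleftrightarrow> \<not> sat \<sigma> p"
  by (induction p arbitrary: \<sigma>) auto

lemma wtf_neg [simp]: "wtf \<Gamma> (neg p) = wtf \<Gamma> p"
  by (induction p arbitrary: \<Gamma>) auto

text \<open>Only atoms have a primitive equality, so equality of sets is unfolded into mutual
  inclusion up to equality of members. The number \<open>n\<close> bounds the variables of both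
  terms; \<open>n\<close> and \<open>Suc n\<close> are thus fresh, and the recursive call starts
  above them.\<close>

fun eqf :: "ty \<Rightarrow> trm \<Rightarrow> trm \<Rightarrow> nat \<Rightarrow> fml" where
  "eqf TUr t u n = FEqU t u"
| "eqf TUnit t u n = FTop"
| "eqf (TProd A B) t u n = FAnd (eqf A (TPi1 t) (TPi1 u) n) (eqf B (TPi2 t) (TPi2 u) n)"
| "eqf (TSet A) t u n = FAnd
     (FAll n t (FEx (Suc n) u (eqf A (TVar n) (TVar (Suc n)) (Suc (Suc n)))))
     (FAll n u (FEx (Suc n) t (eqf A (TVar n) (TVar (Suc n)) (Suc (Suc n)))))"

lemma teval_cong: "(\<And>x. x \<in> fvt t \<Longrightarrow> \<sigma> x = \<sigma>' x) \<Longrightarrow> teval \<sigma> t = teval \<sigma>' t"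
proof (induction t)
  case (TPair t u)
  have "teval \<sigma> t = teval \<sigma>' t" by (rule TPair.IH(1), rule TPair.prems) simp
  moreover have "teval \<sigma> u = teval \<sigma>' u" by (rule TPair.IH(2), rule TPair.prems) simp
  ultimately show ?case by simp
qed simp_all

lemma ttype_cong: "(\<And>x. x \<in> fvt t \<Longrightarrow> \<Gamma> x = \<Gamma>' x) \<Longrightarrow> ttype \<Gamma> t = ttype \<Gamma>' t"
proof (induction t)
  case (TPair t u)
  have "ttype \<Gamma> t = ttype \<Gamma>' t" by (rule TPair.IH(1), rule TPair.prems) simp
  moreover have "ttype \<Gamma> u = ttype \<Gamma>' u" by (rule TPair.IH(2), rule TPair.prems) simp
  ultimately show ?case by simp
qed simp_all

lemma teval_upd: "n \<notin> fvt t \<Longrightarrow> teval (\<sigma>(n := v)) t = teval \<sigma> t"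
  by (intro teval_cong) auto

lemma ttype_upd: "n \<notin> fvt t \<Longrightarrow> ttype (\<Gamma>(n := v)) t = ttype \<Gamma> t"
  by (intro ttype_cong) auto

lemma wtf_eqf:
  assumes "ttype \<Gamma> t = Some T" "ttype \<Gamma> u = Some T" "fvt t \<subseteq> {..<n}" "fvt u \<subseteq> {..<n}"
  shows "wtf \<Gamma> (eqf T t u n)"
  using assms
proof (induction T arbitrary: \<Gamma> t u n)
  case (TSet A)
  have "n \<notin> fvt t" "n \<notin> fvt u" using TSet.prems(3,4) by auto
  then show ?case using TSet.prems(1,2) by (auto simp: ttype_upd intro!: TSet.IH)
qed auto

lemma sat_eqf:
  assumes "cano (teval \<sigma> t) T" "cano (teval \<sigma> u) T" "fvt t \<subseteq> {..<n}" "fvt u \<subseteq> {..<n}"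
  shows "sat \<sigma> (eqf T t u n) \<longleftrightarrow> teval \<sigma> t = teval \<sigma> u"
  using assms
proof (induction T arbitrary: \<sigma> t u n)
  case (TProd A B)
  then obtain a b a' b' where e: "teval \<sigma> t = PairV a b" "teval \<sigma> u = PairV a' b'"
    "cano a A" "cano b B" "cano a' A" "cano b' B" by auto
  have "sat \<sigma> (eqf A (TPi1 t) (TPi1 u) n) \<longleftrightarrow> a = a'"
    using TProd.IH(1)[of \<sigma> "TPi1 t" "TPi1 u" n] TProd.prems e by simp
  moreover have "sat \<sigma> (eqf B (TPi2 t) (TPi2 u) n) \<longleftrightarrow> b = b'"
    using TProd.IH(2)[of \<sigma> "TPi2 t" "TPi2 u" n] TProd.prems e by simp
  ultimately show ?case using e by simp
next
  case (TSet A)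
  have n: "n \<notin> fvt t" "n \<notin> fvt u" using TSet.prems(3,4) by auto
  have *: "sat (\<sigma>(n := v, Suc n := w)) (eqf A (TVar n) (TVar (Suc n)) (Suc (Suc n))) \<longleftrightarrow> v = w"
    if "cano v A" "cano w A" for v w
  proof -
    let ?\<sigma> = "\<sigma>(n := v, Suc n := w)"
    have e: "teval ?\<sigma> (TVar n) = v" "teval ?\<sigma> (TVar (Suc n)) = w" by simp_all
    have "sat ?\<sigma> (eqf A (TVar n) (TVar (Suc n)) (Suc (Suc n))) \<longleftrightarrow> teval ?\<sigma> (TVar n) = teval ?\<sigma> (TVar (Suc n))"
      by (rule TSet.IH) (unfold e, use that in auto)
    then show ?thesis unfolding e .
  qed
  have c: "cano v A" if "v \<in> elems (teval \<sigma> t) \<union> elems (teval \<sigma> u)" for v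
    using that TSet.prems(1,2) cano_elems by blast
  have "sat \<sigma> (eqf (TSet A) t u n) \<longleftrightarrow>
    (\<forall>v\<in>elems (teval \<sigma> t). \<exists>w\<in>elems (teval \<sigma> u). v = w) \<and> (\<forall>v\<in>elems (teval \<sigma> u). \<exists>w\<in>elems (teval \<sigma> t). v = w)"
    using n * c by (simp add: teval_upd)
  also have "\<dots> \<longleftrightarrow> elems (teval \<sigma> t) = elems (teval \<sigma> u)" by auto
  also have "\<dots> \<longleftrightarrow> teval \<sigma> t = teval \<sigma> u" using cano_set_eq[OF TSet.prems(1,2)] by simp
  finally show ?case .
qed auto

text \<open>The formulas have no membership atom. \<open>Mem\<close> supplies one: in the model
  built later, the members of a set are exactly those named by \<open>Mem\<close> facts.\<close>

datatype fact = Mem sv sv | Fm fml "(nat \<times> sv) list"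

instance fact :: countable by countable_datatype

fun holds :: "('u, 'i) valn \<Rightarrow> fact \<Rightarrow> bool" where
  "holds \<mu> (Mem p s) = (ev \<mu> p \<in> elems (ev \<mu> s))"
| "holds \<mu> (Fm \<psi> es) = sat (\<lambda>k. ev \<mu> (lk es k)) \<psi>"

fun fkeys :: "fact \<Rightarrow> key set" where
  "fkeys (Mem p s) = keys p \<union> keys s"
| "fkeys (Fm \<psi> es) = ekeys es"

fun wff :: "fact \<Rightarrow> bool" where
  "wff (Mem p s) = (stype s = TSet (stype p))"
| "wff (Fm \<psi> es) = wtf (\<lambda>k. stype (lk es k)) \<psi>"

lemma finite_fkeys [simp]: "finite (fkeys f)"
  by (cases f) (auto simp: ekeys_def)

lemma holds_cong: assumes "\<And>k. k \<in> fkeys f \<Longrightarrow> \<mu> k = \<mu>' k" shows "holds \<mu> f = holds \<mu>' f"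
proof (cases f)
  case (Mem p s)
  have "ev \<mu> p = ev \<mu>' p" "ev \<mu> s = ev \<mu>' s" by (rule ev_cong, rule assms, simp add: Mem)+
  then show ?thesis using Mem by simp
next
  case (Fm \<psi> es)
  have "ev \<mu> (lk es k) = ev \<mu>' (lk es k)" for k
    by (rule ev_cong, rule assms) (use keys_lk Fm in auto)
  then show ?thesis using Fm by simp
qed

definition eqF :: "sv \<Rightarrow> sv \<Rightarrow> fact" where
  "eqF p q = Fm (eqf (stype p) (TVar 0) (TVar 1) 2) [(0, p), (1, q)]"
definition neF :: "sv \<Rightarrow> sv \<Rightarrow> fact" where
  "neF p q = Fm (neg (eqf (stype p) (TVar 0) (TVar 1) 2)) [(0, p), (1, q)]"
text \<open>Membership as a formula, in contrast to \<open>Mem\<close>: such a fact may be added to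
  one copy only, even if \<open>s\<close> is a shared set. Saturation turns it into a
  \<open>Mem\<close> fact for some equal object.\<close>

definition inF :: "sv \<Rightarrow> sv \<Rightarrow> fact" where
  "inF p s = Fm (FEx 2 (TVar 1) (eqf (stype p) (TVar 0) (TVar 2) 3)) [(0, p), (1, s)]"
definition ninF :: "sv \<Rightarrow> sv \<Rightarrow> fact" where
  "ninF p s = Fm (neg (FEx 2 (TVar 1) (eqf (stype p) (TVar 0) (TVar 2) 3))) [(0, p), (1, s)]"

lemma fkeys_macros [simp]:
  "fkeys (eqF p q) = keys p \<union> keys q" "fkeys (neF p q) = keys p \<union> keys q"
  "fkeys (inF p q) = keys p \<union> keys q" "fkeys (ninF p q) = keys p \<union> keys q"
  by (auto simp: eqF_def neF_def inF_def ninF_def)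

lemma not_Mem [simp]: "eqF p q \<noteq> Mem a b" "neF p q \<noteq> Mem a b" "inF p q \<noteq> Mem a b" "ninF p q \<noteq> Mem a b"
  "Mem a b \<noteq> eqF p q" "Mem a b \<noteq> neF p q" "Mem a b \<noteq> inF p q" "Mem a b \<noteq> ninF p q"
  by (auto simp: eqF_def neF_def inF_def ninF_def)

lemma wff_eqF [simp]: "stype q = stype p \<Longrightarrow> wff (eqF p q)" "stype q = stype p \<Longrightarrow> wff (neF p q)"
  by (auto simp: eqF_def neF_def intro!: wtf_eqf)

lemma wff_inF [simp]: "stype q = TSet (stype p) \<Longrightarrow> wff (inF p q)" "stype q = TSet (stype p) \<Longrightarrow> wff (ninF p q)"
  by (auto simp: inF_def ninF_def intro!: wtf_eqf)

lemma holds_eqF: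
  assumes "val \<mu>" "stype q = stype p"
  shows "holds \<mu> (eqF p q) \<longleftrightarrow> ev \<mu> p = ev \<mu> q" "holds \<mu> (neF p q) \<longleftrightarrow> ev \<mu> p \<noteq> ev \<mu> q"
  using sat_eqf[of "\<lambda>k. ev \<mu> (lk [(0, p), (1, q)] k)" "TVar 0" "stype p" "TVar 1" 2]
    ev_cano[OF assms(1), of p] ev_cano[OF assms(1), of q] assms(2)
  by (auto simp: eqF_def neF_def)

lemma holds_inF:
  assumes "val \<mu>" "stype s = TSet (stype p)"
  shows "holds \<mu> (inF p s) \<longleftrightarrow> ev \<mu> p \<in> elems (ev \<mu> s)" "holds \<mu> (ninF p s) \<longleftrightarrow> ev \<mu> p \<notin> elems (ev \<mu> s)"
proof -
  have *: "sat ((\<lambda>k. ev \<mu> (lk [(0, p), (1, s)] k))(2 := v)) (eqf (stype p) (TVar 0) (TVar 2) 3) \<longleftrightarrow> ev \<mu> p = v"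
    if "v \<in> elems (ev \<mu> s)" for v
  proof -
    have "cano v (stype p)" using that ev_cano[OF assms(1), of s] assms(2) cano_elems by metis
    then show ?thesis
      using sat_eqf[of "(\<lambda>k. ev \<mu> (lk [(0, p), (1, s)] k))(2 := v)" "TVar 0" "stype p" "TVar 2" 3]
        ev_cano[OF assms(1), of p] by simp
  qed
  show 1: "holds \<mu> (inF p s) \<longleftrightarrow> ev \<mu> p \<in> elems (ev \<mu> s)"
    using * by (auto simp: inF_def)
  have "holds \<mu> (ninF p s) \<longleftrightarrow> \<not> holds \<mu> (inF p s)" by (simp only: ninF_def inF_def holds.simps sat_neg)
  with 1 show "holds \<mu> (ninF p s) \<longleftrightarrow> ev \<mu> p \<notin> elems (ev \<mu> s)" by simp
qed

abbreviation models :: "('u, 'i) valn \<Rightarrow> fact set \<Rightarrow> bool" where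
  "models \<mu> F \<equiv> val \<mu> \<and> (\<forall>f\<in>F. holds \<mu> f)"

text \<open>
  A state consists of the shared names in use and of the facts of the two copies. Membership facts
  about shared sets are common to both copies, since both may instantiate universal quantifiers
  over such sets.
\<close>

type_synonym state = "key set \<times> (bool \<Rightarrow> fact set)"

definition wf_state :: "state \<Rightarrow> bool" where
  "wf_state S \<longleftrightarrow> finite (fst S) \<and> fst ` fst S \<subseteq> {None} \<and> (\<forall>b. finite (snd S b)) \<and>
     (\<forall>b. \<forall>f\<in>snd S b. wff f \<and> fkeys f \<subseteq> fst S \<union> {k. fst k = Some b}) \<and>
     (\<forall>b p t n. Mem p (Nm None t n) \<in> snd S b \<longrightarrow> Mem p (Nm None t n) \<in> snd S (\<not> b))"

text \<open>The goal \<open>None\<close> stands for separation without a distinguished object, that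
  is, for plain interpolation. \<open>TUnit\<close> is then an arbitrary element type for an
  expression that \<open>gsat\<close> ignores.\<close>

definition gty :: "sv option \<Rightarrow> ty" where
  "gty g = (case g of None \<Rightarrow> TUnit | Some r \<Rightarrow> stype r)"

definition gsat :: "sv option \<Rightarrow> bool \<Rightarrow> ('u, 'i) valn \<Rightarrow> ('u, 'i) nval \<Rightarrow> bool" where
  "gsat g b \<mu> v \<longleftrightarrow> b \<and> (\<exists>r. g = Some r \<and> ev \<mu> r \<in> elems v)"

lemma gsat_mono: "gsat g b \<mu> v \<Longrightarrow> elems v \<subseteq> elems w \<Longrightarrow> gsat g b \<mu> w"
  by (auto simp: gsat_def)

lemma gsat_bnd: "(\<And>r. g = Some r \<Longrightarrow> keys r \<inter> keys p = {}) \<Longrightarrow> gsat g b (bnd p y \<mu>) v = gsat g b \<mu> v"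
  by (auto simp: gsat_def ev_bnd_other)

definition add :: "bool \<Rightarrow> fact set \<Rightarrow> (bool \<Rightarrow> fact set) \<Rightarrow> bool \<Rightarrow> fact set" where
  "add b F \<Theta> = (\<lambda>b'. if b' = b then F \<union> \<Theta> b' else \<Theta> b')"

context inf_types begin

text \<open>The semantic counterpart of derivability of a two-sided sequent together with its
  interpolant; the lemmas that follow are its inference rules.\<close>

definition Sep :: "sv option \<Rightarrow> key set \<Rightarrow> (bool \<Rightarrow> fact set) \<Rightarrow> bool" where
  "Sep g X \<Theta> \<longleftrightarrow> (\<exists>E \<theta>. D X (TSet (gty g)) E \<and> DB X \<theta> \<and>
     (\<forall>b (\<mu> :: ('u, 'i) valn). models \<mu> (\<Theta> b) \<longrightarrow> \<theta> \<mu> = b \<or> gsat g b \<mu> (E \<mu>)))"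

lemma SepE:
  assumes "Sep g X \<Theta>"
  obtains E \<theta> where "D X (TSet (gty g)) E" "DB X \<theta>"
    "\<And>b \<mu> :: ('u, 'i) valn. models \<mu> (\<Theta> b) \<Longrightarrow> \<theta> \<mu> = b \<or> gsat g b \<mu> (E \<mu>)"
  using assms unfolding Sep_def by blast

lemma SepI:
  assumes "D X (TSet (gty g)) E" "DB X \<theta>"
    "\<And>b \<mu> :: ('u, 'i) valn. models \<mu> (\<Theta> b) \<Longrightarrow> \<theta> \<mu> = b \<or> gsat g b \<mu> (E \<mu>)"
  shows "Sep g X \<Theta>"
  using assms unfolding Sep_def by blast

lemma Sep_implied:
  assumes "\<And>b \<mu> :: ('u, 'i) valn. models \<mu> (\<Theta> b) \<Longrightarrow> models \<mu> (\<Theta>' b)" "Sep g X \<Theta>'"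
  shows "Sep g X \<Theta>"
proof -
  obtain E \<theta> where "D X (TSet (gty g)) E" "DB X \<theta>"
    "\<And>b \<mu> :: ('u, 'i) valn. models \<mu> (\<Theta>' b) \<Longrightarrow> \<theta> \<mu> = b \<or> gsat g b \<mu> (E \<mu>)"
    using SepE[OF assms(2)] by blast
  then show ?thesis using assms(1) by (intro SepI) blast+
qed

lemma Sep_incons:
  assumes "\<And>\<mu> :: ('u, 'i) valn. \<not> models \<mu> (\<Theta> b)" shows "Sep g X \<Theta>"
proof (rule SepI[OF D_empty])
  show "DB X (\<lambda>_. \<not> b)" by (cases b) (auto intro: DB_True DB_False)
  fix b' and \<mu> :: "('u, 'i) valn" assume "models \<mu> (\<Theta> b')"
  with assms[of \<mu>] have "b' \<noteq> b" by blast
  then show "(\<not> b) = b' \<or> gsat g b' \<mu> (mkset {})" by blast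
qed

text \<open>In copy \<open>b\<close> only one of the two separators is known to apply, while in the
  other copy both do. Hence the conditions are joined by disjunction for a split on the left and by
  conjunction on the right; the expressions are united in either case.\<close>

lemma Sep_cut:
  assumes c: "\<And>\<mu> :: ('u, 'i) valn. models \<mu> (\<Theta> b) \<Longrightarrow> holds \<mu> f1 \<or> holds \<mu> f2"
    and "Sep g X (add b {f1} \<Theta>)" "Sep g X (add b {f2} \<Theta>)"
  shows "Sep g X \<Theta>"
proof -
  obtain E1 \<theta>1 where 1: "D X (TSet (gty g)) E1" "DB X \<theta>1"
    "\<And>b' \<mu> :: ('u, 'i) valn. models \<mu> (add b {f1} \<Theta> b') \<Longrightarrow> \<theta>1 \<mu> = b' \<or> gsat g b' \<mu> (E1 \<mu>)"
    using SepE[OF assms(2)] by blast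
  obtain E2 \<theta>2 where 2: "D X (TSet (gty g)) E2" "DB X \<theta>2"
    "\<And>b' \<mu> :: ('u, 'i) valn. models \<mu> (add b {f2} \<Theta> b') \<Longrightarrow> \<theta>2 \<mu> = b' \<or> gsat g b' \<mu> (E2 \<mu>)"
    using SepE[OF assms(3)] by blast
  let ?\<theta> = "\<lambda>\<mu>. if b then \<theta>1 \<mu> \<or> \<theta>2 \<mu> else \<theta>1 \<mu> \<and> \<theta>2 \<mu>"
  let ?E = "\<lambda>\<mu>. mkset (elems (E1 \<mu>) \<union> elems (E2 \<mu>))"
  have s: "gsat g b' \<mu> (?E \<mu>)" if "gsat g b' \<mu> (E1 \<mu>) \<or> gsat g b' \<mu> (E2 \<mu>)" for b' \<mu>
    using that by (auto elim!: gsat_mono simp: small_Un)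
  show ?thesis
  proof (rule SepI[OF D_un[OF 1(1) 2(1)]])
    show "DB X ?\<theta>" using 1(2) 2(2) by (cases b) (auto intro: DB_or DB_and)
    fix b' and \<mu> :: "('u, 'i) valn" assume m: "models \<mu> (\<Theta> b')"
    show "?\<theta> \<mu> = b' \<or> gsat g b' \<mu> (?E \<mu>)"
    proof (cases "b' = b")
      case True
      then have "models \<mu> (add b {f1} \<Theta> b') \<or> models \<mu> (add b {f2} \<Theta> b')"
        using c[of \<mu>] m by (auto simp: add_def)
      then have "(\<theta>1 \<mu> = b' \<or> \<theta>2 \<mu> = b') \<or> gsat g b' \<mu> (?E \<mu>)" using 1(3) 2(3) s by blast
      then show ?thesis using True by auto
    next
      case False
      then have "models \<mu> (add b {f1} \<Theta> b')" "models \<mu> (add b {f2} \<Theta> b')" using m by (auto simp: add_def)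
      then have "(\<theta>1 \<mu> = b' \<and> \<theta>2 \<mu> = b') \<or> gsat g b' \<mu> (?E \<mu>)" using 1(3) 2(3) s by blast
      then show ?thesis using False by auto
    qed
  qed
qed

text \<open>Both copies split along the same definable condition \<open>P\<close> on shared names,
  so the combined condition can consult \<open>P\<close> to decide which separator to use.\<close>

lemma Sep_common_cut:
  assumes P: "DB X P"
    and c: "\<And>b \<mu> :: ('u, 'i) valn. models \<mu> (\<Theta> b) \<Longrightarrow> if P \<mu> then holds \<mu> f1 else holds \<mu> f2"
    and "Sep g X (\<lambda>b. {f1} \<union> \<Theta> b)" "Sep g X (\<lambda>b. {f2} \<union> \<Theta> b)"
  shows "Sep g X \<Theta>"
proof -
  obtain E1 \<theta>1 where 1: "D X (TSet (gty g)) E1" "DB X \<theta>1"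
    "\<And>b \<mu> :: ('u, 'i) valn. models \<mu> ({f1} \<union> \<Theta> b) \<Longrightarrow> \<theta>1 \<mu> = b \<or> gsat g b \<mu> (E1 \<mu>)"
    using SepE[OF assms(3)] by blast
  obtain E2 \<theta>2 where 2: "D X (TSet (gty g)) E2" "DB X \<theta>2"
    "\<And>b \<mu> :: ('u, 'i) valn. models \<mu> ({f2} \<union> \<Theta> b) \<Longrightarrow> \<theta>2 \<mu> = b \<or> gsat g b \<mu> (E2 \<mu>)"
    using SepE[OF assms(4)] by blast
  let ?\<theta> = "\<lambda>\<mu>. P \<mu> \<and> \<theta>1 \<mu> \<or> \<not> P \<mu> \<and> \<theta>2 \<mu>"
  let ?E = "\<lambda>\<mu>. mkset (elems (E1 \<mu>) \<union> elems (E2 \<mu>))"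
  have s: "gsat g b' \<mu> (?E \<mu>)" if "gsat g b' \<mu> (E1 \<mu>) \<or> gsat g b' \<mu> (E2 \<mu>)" for b' \<mu>
    using that by (auto elim!: gsat_mono simp: small_Un)
  show ?thesis
  proof (rule SepI[OF D_un[OF 1(1) 2(1)]])
    show "DB X ?\<theta>" by (intro DB_or DB_and DB_not P 1 2)
    fix b and \<mu> :: "('u, 'i) valn" assume m: "models \<mu> (\<Theta> b)"
    show "?\<theta> \<mu> = b \<or> gsat g b \<mu> (?E \<mu>)"
    proof (cases "P \<mu>")
      case True
      then have "models \<mu> ({f1} \<union> \<Theta> b)" using c[OF m] m by auto
      then show ?thesis using 1(3) s True by blast
    next
      case False
      then have "models \<mu> ({f2} \<union> \<Theta> b)" using c[OF m] m by auto
      then show ?thesis using 2(3) s False by blast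
    qed
  qed
qed

text \<open>A fresh private name occurs in neither component of the separator, so rebinding it to a
  witness changes neither the expression nor the condition.\<close>

lemma Sep_local_ex:
  assumes c: "\<And>\<mu> :: ('u, 'i) valn. models \<mu> (\<Theta> b) \<Longrightarrow>
      \<exists>y. cano y (stype p) \<and> (\<forall>f\<in>F. holds (bnd p y \<mu>) f)"
    and p: "keys p \<inter> X = {}" "\<And>f. f \<in> \<Theta> b \<Longrightarrow> keys p \<inter> fkeys f = {}" "\<And>r. g = Some r \<Longrightarrow> keys r \<inter> keys p = {}"
    and S: "Sep g X (add b F \<Theta>)"
  shows "Sep g X \<Theta>"
proof -
  obtain E \<theta> where 1: "D X (TSet (gty g)) E" "DB X \<theta>"
    "\<And>b' \<mu> :: ('u, 'i) valn. models \<mu> (add b F \<Theta> b') \<Longrightarrow> \<theta> \<mu> = b' \<or> gsat g b' \<mu> (E \<mu>)"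
    using SepE[OF S] by blast
  show ?thesis
  proof (rule SepI[OF 1(1,2)])
    fix b' and \<mu> :: "('u, 'i) valn" assume m: "models \<mu> (\<Theta> b')"
    show "\<theta> \<mu> = b' \<or> gsat g b' \<mu> (E \<mu>)"
    proof (cases "b' = b")
      case True
      then obtain y where y: "cano y (stype p)" "\<forall>f\<in>F. holds (bnd p y \<mu>) f" using c m by blast
      let ?\<mu> = "bnd p y \<mu>"
      have v: "val ?\<mu>" using m y(1) val_bnd by blast
      have "holds ?\<mu> f" if "f \<in> \<Theta> b" for f
      proof -
        have "holds ?\<mu> f = holds \<mu> f" using p(2)[OF that] by (intro holds_cong bnd_other) auto
        then show ?thesis using m that True by blast
      qed
      then have *: "\<theta> ?\<mu> = b' \<or> gsat g b' ?\<mu> (E ?\<mu>)" using v y(2) True by (intro 1(3)) (auto simp: add_def)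
      have X: "?\<mu> k = \<mu> k" if "k \<in> X" for k using that p(1) by (intro bnd_other) auto
      have "\<theta> ?\<mu> = \<theta> \<mu>" using DB_dep[OF 1(2) v _ X] m by blast
      moreover have "E ?\<mu> = E \<mu>" using D_dep[OF 1(1) v _ X] m by blast
      moreover have "gsat g b' ?\<mu> (E \<mu>) = gsat g b' \<mu> (E \<mu>)" using p(3) by (rule gsat_bnd)
      ultimately show ?thesis using * by simp
    next
      case False
      then show ?thesis using m by (intro 1(3)) (auto simp: add_def)
    qed
  qed
qed

text \<open>
  A shared witness \<open>p\<close> drawn from a definable set \<open>A\<close> is eliminated from the separators by a union over
  \<open>A\<close> and a quantifier over \<open>A\<close>, existential if the witness stems from the left copy.
\<close>

lemma Sep_common_ex:
  assumes X: "finite X" and p: "linear p" "keys p \<inter> X = {}" "\<And>b f. f \<in> \<Theta> b \<Longrightarrow> keys p \<inter> fkeys f = {}"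
      "\<And>r. g = Some r \<Longrightarrow> keys r \<inter> keys p = {}"
    and A: "D X (TSet (stype p)) A"
    and c: "\<And>\<mu> :: ('u, 'i) valn. models \<mu> (\<Theta> b0) \<Longrightarrow> \<exists>y\<in>elems (A \<mu>). \<forall>f\<in>F b0. holds (bnd p y \<mu>) f"
    and c': "\<And>(\<mu> :: ('u, 'i) valn) y f. models \<mu> (\<Theta> (\<not> b0)) \<Longrightarrow> y \<in> elems (A \<mu>) \<Longrightarrow>
       f \<in> F (\<not> b0) \<Longrightarrow> holds (bnd p y \<mu>) f"
    and S: "Sep g (X \<union> keys p) (\<lambda>b. F b \<union> \<Theta> b)"
  shows "Sep g X \<Theta>"
proof -
  obtain E \<theta> where 1: "D (X \<union> keys p) (TSet (gty g)) E" "DB (X \<union> keys p) \<theta>"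
    "\<And>b \<mu> :: ('u, 'i) valn. models \<mu> (F b \<union> \<Theta> b) \<Longrightarrow> \<theta> \<mu> = b \<or> gsat g b \<mu> (E \<mu>)"
    using SepE[OF S] by blast
  let ?E = "\<lambda>\<mu>. mkset (\<Union>y\<in>elems (A \<mu>). elems (E (bnd p y \<mu>)))"
  let ?\<theta> = "\<lambda>\<mu>. if b0 then \<exists>y\<in>elems (A \<mu>). \<theta> (bnd p y \<mu>) else \<not> (\<exists>y\<in>elems (A \<mu>). \<not> \<theta> (bnd p y \<mu>))"
  have s: "elems (?E \<mu>) = (\<Union>y\<in>elems (A \<mu>). elems (E (bnd p y \<mu>)))" for \<mu> :: "('u, 'i) valn"
    by (simp add: small_UN)
  have step: "\<theta> (bnd p y \<mu>) = b \<or> gsat g b \<mu> (?E \<mu>)"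
    if m: "models \<mu> (\<Theta> b)" and y: "y \<in> elems (A \<mu>)" and F: "\<forall>f\<in>F b. holds (bnd p y \<mu>) f" for b y \<mu>
  proof -
    have v: "val (bnd p y \<mu>)" using D_cano[OF A] m y cano_elems val_bnd by metis
    have "holds (bnd p y \<mu>) f" if "f \<in> \<Theta> b" for f
    proof -
      have "holds (bnd p y \<mu>) f = holds \<mu> f" using p(3)[OF that] by (intro holds_cong bnd_other) auto
      then show ?thesis using m that by blast
    qed
    then have "\<theta> (bnd p y \<mu>) = b \<or> gsat g b (bnd p y \<mu>) (E (bnd p y \<mu>))" using v F by (intro 1(3)) auto
    moreover have "gsat g b (bnd p y \<mu>) (E (bnd p y \<mu>)) = gsat g b \<mu> (E (bnd p y \<mu>))" using p(4) by (rule gsat_bnd)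
    ultimately show ?thesis using s y gsat_mono[of g b \<mu> "E (bnd p y \<mu>)" "?E \<mu>"] by blast
  qed
  show ?thesis
  proof (rule SepI[OF D_big[OF X p(1,2) 1(1) A]])
    show "DB X ?\<theta>"
      using DB_ex[OF X p(1,2) 1(2) A] DB_not[OF DB_ex[OF X p(1,2) DB_not[OF 1(2)] A]] by (cases b0) auto
    fix b and \<mu> :: "('u, 'i) valn" assume m: "models \<mu> (\<Theta> b)"
    show "?\<theta> \<mu> = b \<or> gsat g b \<mu> (?E \<mu>)"
    proof (cases "b = b0")
      case True
      then obtain y where y: "y \<in> elems (A \<mu>)" "\<forall>f\<in>F b. holds (bnd p y \<mu>) f" using c m by blast
      from step[OF m y] show ?thesis using y(1) True by auto
    next
      case False
      then have b: "b = (\<not> b0)" by blast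
      have "\<theta> (bnd p y \<mu>) = b \<or> gsat g b \<mu> (?E \<mu>)" if "y \<in> elems (A \<mu>)" for y
        using c'[of \<mu> y] m that b by (intro step) auto
      then show ?thesis using b by auto
    qed
  qed
qed

end

section \<open>Saturating an inseparable pair\<close>

definition le :: "state \<Rightarrow> state \<Rightarrow> bool" where
  "le S S' \<longleftrightarrow> fst S \<subseteq> fst S' \<and> (\<forall>b. snd S b \<subseteq> snd S' b)"

lemma le_refl [simp]: "le S S"
  by (simp add: le_def)

lemma le_trans: "le S S' \<Longrightarrow> le S' S'' \<Longrightarrow> le S S''"
  unfolding le_def by blast

text \<open>
  \<open>RF b f m\<close> asks to decompose the fact \<open>f\<close> of copy \<open>b\<close>, instantiating it with the membership fact
  \<open>m\<close> when it is universal; \<open>RE a c\<close> asks to decide whether two atoms are equal.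
\<close>

datatype req = RF bool fact fact | RE sv sv

instance req :: countable by countable_datatype

text \<open>The universal clause looks for the membership fact at the earlier stage
  \<open>S\<close>; a fact that arrives later is caught when the request recurs. The other clauses
  leave their result at the later stage \<open>S'\<close>.\<close>

fun metF :: "bool \<Rightarrow> fact \<Rightarrow> fact \<Rightarrow> state \<Rightarrow> state \<Rightarrow> bool" where
  "metF b (Fm (FOr p q) es) m S S' \<longleftrightarrow> Fm p es \<in> snd S' b \<or> Fm q es \<in> snd S' b"
| "metF b (Fm (FAnd p q) es) m S S' \<longleftrightarrow> Fm p es \<in> snd S' b \<and> Fm q es \<in> snd S' b"
| "metF b (Fm (FAll x t p) es) m S S' \<longleftrightarrow>
     (\<forall>w. m = Mem w (steval es t) \<and> m \<in> snd S b \<longrightarrow> Fm p ((x, w) # es) \<in> snd S' b)"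
| "metF b (Fm (FEx x t p) es) m S S' \<longleftrightarrow>
     (\<exists>w. Mem w (steval es t) \<in> snd S' b \<and> Fm p ((x, w) # es) \<in> snd S' b)"
| "metF b _ m S S' \<longleftrightarrow> True"

definition loc :: "bool \<Rightarrow> key set" where
  "loc b = {k. fst k = Some b}"

text \<open>Equality of two shared atoms has to be decided in the same way in both copies, since
  they must agree on the shared part of the joint model.\<close>

fun met :: "req \<Rightarrow> state \<Rightarrow> state \<Rightarrow> bool" where
  "met (RF b f m) S S' \<longleftrightarrow> (f \<in> snd S b \<longrightarrow> metF b f m S S')"
| "met (RE a c) S S' \<longleftrightarrow> (stype a = TUr \<and> stype c = TUr \<longrightarrow>
     (\<forall>b. keys a \<union> keys c \<subseteq> fst S \<union> loc b \<longrightarrow> eqF a c \<in> snd S' b \<or> neF a c \<in> snd S' b) \<and>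
     (keys a \<union> keys c \<subseteq> fst S \<longrightarrow> (\<forall>b. eqF a c \<in> snd S' b) \<or> (\<forall>b. neF a c \<in> snd S' b)))"

lemma wf_stateD:
  assumes "wf_state (X, \<Theta>)"
  shows "finite X" "k \<in> X \<Longrightarrow> fst k = None" "finite (\<Theta> b)" "f \<in> \<Theta> b \<Longrightarrow> wff f"
    "f \<in> \<Theta> b \<Longrightarrow> fkeys f \<subseteq> X \<union> loc b"
    "Mem p (Nm None t n) \<in> \<Theta> b \<Longrightarrow> Mem p (Nm None t n) \<in> \<Theta> b'"
proof -
  show "finite X" "finite (\<Theta> b)" using assms by (auto simp: wf_state_def)
  show "k \<in> X \<Longrightarrow> fst k = None" using assms by (fastforce simp: wf_state_def)
  show "f \<in> \<Theta> b \<Longrightarrow> wff f" using assms by (simp add: wf_state_def)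
  show "f \<in> \<Theta> b \<Longrightarrow> fkeys f \<subseteq> X \<union> loc b" using assms by (simp add: wf_state_def loc_def)
  assume m: "Mem p (Nm None t n) \<in> \<Theta> b"
  then have "Mem p (Nm None t n) \<in> \<Theta> (\<not> b)"
    using assms unfolding wf_state_def fst_conv snd_conv by blast
  moreover have "b' = b \<or> b' = (\<not> b)" by blast
  ultimately show "Mem p (Nm None t n) \<in> \<Theta> b'" using m by blast
qed

lemma wf_state_add:
  assumes "wf_state (X, \<Theta>)" "finite F" "\<And>f. f \<in> F \<Longrightarrow> wff f \<and> fkeys f \<subseteq> X \<union> loc b"
    "\<And>p t n. Mem p (Nm None t n) \<notin> F"
  shows "wf_state (X, add b F \<Theta>)"
  unfolding wf_state_def fst_conv snd_conv
proof (intro conjI allI ballI impI)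
  show "finite X" "finite (add b F \<Theta> b')" "fst ` X \<subseteq> {None}" for b'
    using assms(1,2) by (auto simp: wf_state_def add_def)
  fix b' f assume f: "f \<in> add b F \<Theta> b'"
  then have f': "f \<in> F \<and> b' = b \<or> f \<in> \<Theta> b'" by (auto simp: add_def split: if_splits)
  show "wff f" using f' assms(3) wf_stateD(4)[OF assms(1)] by blast
  show "fkeys f \<subseteq> X \<union> {k. fst k = Some b'}"
    using f' assms(3) wf_stateD(5)[OF assms(1)] unfolding loc_def by blast
next
  fix b' q t n assume "Mem q (Nm None t n) \<in> add b F \<Theta> b'"
  then have "Mem q (Nm None t n) \<in> \<Theta> b'" using assms(4) by (auto simp: add_def split: if_splits)
  then have "Mem q (Nm None t n) \<in> \<Theta> (\<not> b')" using wf_stateD(6)[OF assms(1)] by blast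
  then show "Mem q (Nm None t n) \<in> add b F \<Theta> (\<not> b')" by (auto simp: add_def)
qed

lemma wf_state_common:
  assumes "wf_state (X, \<Theta>)" "fst ` keys p \<subseteq> {None}" "\<And>b. finite (F b)"
    "\<And>b f. f \<in> F b \<Longrightarrow> wff f \<and> fkeys f \<subseteq> X \<union> keys p \<union> loc b"
    "\<And>b q t n. Mem q (Nm None t n) \<in> F b \<Longrightarrow> Mem q (Nm None t n) \<in> F (\<not> b)"
  shows "wf_state (X \<union> keys p, \<lambda>b. F b \<union> \<Theta> b)"
  unfolding wf_state_def fst_conv snd_conv
proof (intro conjI allI ballI impI)
  show "finite (X \<union> keys p)" "finite (F b \<union> \<Theta> b)" for b using assms(1,3) by (auto simp: wf_state_def)
  show "fst ` (X \<union> keys p) \<subseteq> {None}" using assms(1,2) by (auto simp: wf_state_def)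
  fix b f assume f: "f \<in> F b \<union> \<Theta> b"
  show "wff f" using f assms(4) wf_stateD(4)[OF assms(1)] by blast
  show "fkeys f \<subseteq> X \<union> keys p \<union> {k. fst k = Some b}"
    using f assms(4) wf_stateD(5)[OF assms(1)] unfolding loc_def by blast
next
  fix b q t n assume f: "Mem q (Nm None t n) \<in> F b \<union> \<Theta> b"
  then show "Mem q (Nm None t n) \<in> F (\<not> b) \<union> \<Theta> (\<not> b)"
    using assms(5) wf_stateD(6)[OF assms(1)] by blast
qed

lemma holds_ex_inst:
  assumes "linear p" "cano y (stype p)" "keys p \<inter> ekeys es = {}"
  shows "holds (bnd p y \<mu>) (Fm \<psi> ((x, p) # es)) \<longleftrightarrow> sat ((\<lambda>k. ev \<mu> (lk es k))(x := y)) \<psi>"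
proof -
  have "ev (bnd p y \<mu>) (lk es k) = ev \<mu> (lk es k)" for k
    using keys_lk[of es k] assms(3) by (intro ev_bnd_other) auto
  then show ?thesis using ev_bnd[OF assms(1,2)] by (simp only: holds.simps ev_lk_Cons)
qed

context inf_types begin

definition good :: "sv option \<Rightarrow> state \<Rightarrow> bool" where
  "good g S \<longleftrightarrow> wf_state S \<and> \<not> Sep g (fst S) (snd S)"

text \<open>Excluding \<open>Mem\<close> facts keeps the state well formed, as a membership fact
  about a shared set would have to enter both copies.\<close>

lemma good_cut:
  assumes "good g (X, \<Theta>)"
    and "\<And>\<mu> :: ('u, 'i) valn. models \<mu> (\<Theta> b) \<Longrightarrow> holds \<mu> f1 \<or> holds \<mu> f2"
    and "wff f1" "fkeys f1 \<subseteq> X \<union> loc b" "\<And>p s. f1 \<noteq> Mem p s"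
    and "wff f2" "fkeys f2 \<subseteq> X \<union> loc b" "\<And>p s. f2 \<noteq> Mem p s"
  shows "good g (X, add b {f1} \<Theta>) \<or> good g (X, add b {f2} \<Theta>)"
proof -
  have i: "wf_state (X, \<Theta>)" using assms(1) by (simp add: good_def)
  have "wf_state (X, add b {f1} \<Theta>)" using assms(3-5) by (intro wf_state_add[OF i]) auto
  moreover have "wf_state (X, add b {f2} \<Theta>)" using assms(6-8) by (intro wf_state_add[OF i]) auto
  moreover have "\<not> Sep g X (add b {f1} \<Theta>) \<or> \<not> Sep g X (add b {f2} \<Theta>)"
    using Sep_cut[of \<Theta> b f1 f2 g X] assms(1,2) unfolding good_def fst_conv snd_conv by blast
  ultimately show ?thesis by (auto simp: good_def)
qed

lemma good_implied:
  assumes "good g (X, \<Theta>)" "finite F"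
    and "\<And>(\<mu> :: ('u, 'i) valn) f. models \<mu> (\<Theta> b) \<Longrightarrow> f \<in> F \<Longrightarrow> holds \<mu> f"
    and "\<And>f. f \<in> F \<Longrightarrow> wff f \<and> fkeys f \<subseteq> X \<union> loc b"
    and "\<And>p t n. Mem p (Nm None t n) \<notin> F"
  shows "good g (X, add b F \<Theta>)"
proof -
  have "wf_state (X, add b F \<Theta>)" using assms by (intro wf_state_add) (auto simp: good_def)
  moreover have "\<not> Sep g X (add b F \<Theta>)"
  proof
    assume S: "Sep g X (add b F \<Theta>)"
    have "Sep g X \<Theta>"
      by (rule Sep_implied[OF _ S]) (use assms(3) in \<open>auto simp: add_def split: if_splits\<close>)
    then show False using assms(1) by (simp add: good_def)
  qed
  ultimately show ?thesis by (simp add: good_def)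
qed

lemma le_add: "le (X, \<Theta>) (X, add b F \<Theta>)"
  by (auto simp: le_def add_def)

lemma in_add: "f \<in> F \<Longrightarrow> f \<in> add b F \<Theta> b"
  by (auto simp: add_def)

definition gkeys :: "sv option \<Rightarrow> key set" where
  "gkeys g = (case g of None \<Rightarrow> {} | Some r \<Rightarrow> keys r)"

lemma fresh_for:
  assumes "good g (X, \<Theta>)"
  obtains p where "stype p = T" "linear p" "keys p \<inter> X = {}" "\<And>b f. f \<in> \<Theta> b \<Longrightarrow> keys p \<inter> fkeys f = {}"
    "\<And>r. g = Some r \<Longrightarrow> keys r \<inter> keys p = {}" "fst ` keys p \<subseteq> {s}"
proof -
  let ?A = "X \<union> (\<Union>b. \<Union>f\<in>\<Theta> b. fkeys f) \<union> gkeys g"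
  have "finite ?A" using assms wf_stateD[of X \<Theta>] by (auto simp: good_def gkeys_def split: option.splits)
  then obtain p where p: "stype p = T" "linear p" "keys p \<inter> ?A = {}" "fst ` keys p \<subseteq> {s}"
    using fresh_sv by meson
  have "keys p \<inter> fkeys f = {}" if "f \<in> \<Theta> b" for b f using p(3) that by blast
  moreover have "keys r \<inter> keys p = {}" if "g = Some r" for r using p(3) that by (auto simp: gkeys_def)
  ultimately show ?thesis using that p by blast
qed

text \<open>The witness is named according to the set it is taken from. A shared set demands a
  shared witness, because its membership facts belong to both copies; the set itself then serves as
  the bounding expression in \<open>Sep_common_ex\<close>. A private set gets a private
  witness.\<close>

lemma step_ex:
  assumes "good g (X, \<Theta>)" and f: "Fm (FEx x t \<phi>) es \<in> \<Theta> b"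
  shows "\<exists>S'. good g S' \<and> le (X, \<Theta>) S' \<and> metF b (Fm (FEx x t \<phi>) es) m (X, \<Theta>) S'"
proof -
  have i: "wf_state (X, \<Theta>)" and nS: "\<not> Sep g X \<Theta>" using assms(1) by (auto simp: good_def)
  let ?\<Gamma> = "\<lambda>k. stype (lk es k)"
  obtain T where T: "ttype ?\<Gamma> t = Some (TSet T)" "wtf (?\<Gamma>(x := T)) \<phi>"
    using wf_stateD(4)[OF i f] by auto
  define s where "s = steval es t"
  have ek: "ekeys es \<subseteq> X \<union> loc b" using wf_stateD(5)[OF i f] by simp
  have s: "stype s = TSet T" "keys s \<subseteq> ekeys es"
    "\<And>\<mu> :: ('u, 'i) valn. teval (\<lambda>k. ev \<mu> (lk es k)) t = ev \<mu> s"
    using steval_sound[OF T(1)] by (auto simp: s_def)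
  obtain sd n where sn: "s = Nm sd (Some T) n" using s(1) unfolding stype_cases by blast
  have wf: "wff (Mem p s)" "wff (Fm \<phi> ((x, p) # es))" if "stype p = T" for p
    using that s(1) T(2) by (auto simp: stype_lk_Cons simp del: lk.simps)
  show ?thesis
  proof (cases sd)
    case None
    have sX: "keys s \<subseteq> X" using s(2) ek sn None by (auto simp: loc_def)
    obtain p where p: "stype p = T" "linear p" "keys p \<inter> X = {}" "\<And>b f. f \<in> \<Theta> b \<Longrightarrow> keys p \<inter> fkeys f = {}"
      "\<And>r. g = Some r \<Longrightarrow> keys r \<inter> keys p = {}" "fst ` keys p \<subseteq> {None}"
      using fresh_for[OF assms(1)] by metis
    \<comment> \<open>The other copy learns only that the witness is a member, which holds for every
      value drawn from \<open>s\<close>.\<close>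
    let ?F = "\<lambda>b'. if b' = b then {Mem p s, Fm \<phi> ((x, p) # es)} else {Mem p s}"
    have pes: "keys p \<inter> ekeys es = {}" using p(4)[OF f] by simp
    have ps: "keys s \<inter> keys p = {}" using pes s(2) by blast
    have A: "D X (TSet (stype p)) (\<lambda>\<mu>. ev \<mu> s)" using D_ev[OF sX] s(1) p(1) by simp
    have cy: "cano y (stype p)" if "val \<mu>" "y \<in> elems (ev \<mu> s)" for \<mu> :: "('u, 'i) valn" and y
      using that ev_cano[of \<mu> s] s(1) p(1) cano_elems by metis
    have hM: "holds (bnd p y \<mu>) (Mem p s)" if "val \<mu>" "y \<in> elems (ev \<mu> s)" for \<mu> :: "('u, 'i) valn" and y
      using that by (simp add: ev_bnd[OF p(2) cy] ev_bnd_other[OF ps])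
    have "\<not> Sep g (X \<union> keys p) (\<lambda>b. ?F b \<union> \<Theta> b)"
    proof
      assume S: "Sep g (X \<union> keys p) (\<lambda>b. ?F b \<union> \<Theta> b)"
      have "Sep g X \<Theta>"
      proof (rule Sep_common_ex[OF wf_stateD(1)[OF i] p(2,3) _ _ A _ _ S, of b])
        fix \<mu> :: "('u, 'i) valn" assume m: "models \<mu> (\<Theta> b)"
        then have "holds \<mu> (Fm (FEx x t \<phi>) es)" using f by blast
        then obtain y where y: "y \<in> elems (ev \<mu> s)" "sat ((\<lambda>k. ev \<mu> (lk es k))(x := y)) \<phi>"
          unfolding holds.simps sat.simps s(3) by blast
        then have "holds (bnd p y \<mu>) (Fm \<phi> ((x, p) # es))"
          using m cy pes p(2) by (subst holds_ex_inst) auto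
        then show "\<exists>y\<in>elems (ev \<mu> s). \<forall>f\<in>?F b. holds (bnd p y \<mu>) f" using y(1) hM m by auto
      next
        fix \<mu> :: "('u, 'i) valn" and y f'
        assume "models \<mu> (\<Theta> (\<not> b))" "y \<in> elems (ev \<mu> s)" "f' \<in> ?F (\<not> b)"
        then show "holds (bnd p y \<mu>) f'" using hM[of \<mu> y] by auto
      qed (use p in auto)
      then show False using nS by blast
    qed
    moreover have "wf_state (X \<union> keys p, \<lambda>b. ?F b \<union> \<Theta> b)"
      using wf[OF p(1)] sX ek p(6) by (intro wf_state_common[OF i]) (auto split: if_splits)
    ultimately have "good g (X \<union> keys p, \<lambda>b. ?F b \<union> \<Theta> b)" by (simp add: good_def)
    moreover have "le (X, \<Theta>) (X \<union> keys p, \<lambda>b. ?F b \<union> \<Theta> b)" by (auto simp: le_def)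
    moreover have "metF b (Fm (FEx x t \<phi>) es) m (X, \<Theta>) (X \<union> keys p, \<lambda>b. ?F b \<union> \<Theta> b)"
      using s_def by auto
    ultimately show ?thesis by blast
  next
    case (Some b')
    obtain p where p: "stype p = T" "linear p" "keys p \<inter> X = {}" "\<And>b f. f \<in> \<Theta> b \<Longrightarrow> keys p \<inter> fkeys f = {}"
      "\<And>r. g = Some r \<Longrightarrow> keys r \<inter> keys p = {}" "fst ` keys p \<subseteq> {Some b}"
      using fresh_for[OF assms(1)] by metis
    let ?F = "{Mem p s, Fm \<phi> ((x, p) # es)}"
    have pes: "keys p \<inter> ekeys es = {}" using p(4)[OF f] by simp
    have ps: "keys s \<inter> keys p = {}" using pes s(2) by blast
    have cy: "cano y (stype p)" if "val \<mu>" "y \<in> elems (ev \<mu> s)" for \<mu> :: "('u, 'i) valn" and y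
      using that ev_cano[of \<mu> s] s(1) p(1) cano_elems by metis
    have "\<not> Sep g X (add b ?F \<Theta>)"
    proof
      assume S: "Sep g X (add b ?F \<Theta>)"
      have "Sep g X \<Theta>"
      proof (rule Sep_local_ex[OF _ p(3) _ _ S])
        fix \<mu> :: "('u, 'i) valn" assume m: "models \<mu> (\<Theta> b)"
        then have "holds \<mu> (Fm (FEx x t \<phi>) es)" using f by blast
        then obtain y where y: "y \<in> elems (ev \<mu> s)" "sat ((\<lambda>k. ev \<mu> (lk es k))(x := y)) \<phi>"
          unfolding holds.simps sat.simps s(3) by blast
        have c: "cano y (stype p)" using cy m y(1) by blast
        then have "holds (bnd p y \<mu>) (Fm \<phi> ((x, p) # es))"
          using y(2) pes p(2) by (subst holds_ex_inst) auto
        moreover have "holds (bnd p y \<mu>) (Mem p s)"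
          using y(1) by (simp add: ev_bnd[OF p(2) c] ev_bnd_other[OF ps])
        ultimately show "\<exists>y. cano y (stype p) \<and> (\<forall>f\<in>?F. holds (bnd p y \<mu>) f)" using c by blast
      qed (use p in auto)
      then show False using nS by blast
    qed
    moreover have "wf_state (X, add b ?F \<Theta>)"
    proof (rule wf_state_add[OF i])
      have "keys p \<subseteq> loc b" using p(6) unfolding loc_def by blast
      moreover have "fkeys f \<subseteq> keys p \<union> keys s \<union> ekeys es" "wff f" if "f \<in> ?F" for f
        using that wf[OF p(1)] by auto
      ultimately show "wff f \<and> fkeys f \<subseteq> X \<union> loc b" if "f \<in> ?F" for f
        using that s(2) ek by blast
    qed (use sn Some in auto)
    ultimately have "good g (X, add b ?F \<Theta>)" by (simp add: good_def)
    moreover have "metF b (Fm (FEx x t \<phi>) es) m (X, \<Theta>) (X, add b ?F \<Theta>)"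
      using s_def by (auto simp: add_def)
    ultimately show ?thesis using le_add by blast
  qed
qed

lemma step_F:
  assumes "good g (X, \<Theta>)" and f: "f \<in> \<Theta> b"
  shows "\<exists>S'. good g S' \<and> le (X, \<Theta>) S' \<and> metF b f m (X, \<Theta>) S'"
proof -
  have i: "wf_state (X, \<Theta>)" using assms(1) by (auto simp: good_def)
  have wk: "wff f" "fkeys f \<subseteq> X \<union> loc b" using wf_stateD(4,5)[OF i f] by auto
  show ?thesis
  proof (cases f)
    case (Mem p s)
    then show ?thesis using assms(1) by (intro exI[of _ "(X, \<Theta>)"]) simp
  next
    case (Fm \<psi> es)
    have triv: ?thesis if "metF b f m (X, \<Theta>) (X, \<Theta>)"
      using that assms(1) by (intro exI[of _ "(X, \<Theta>)"]) simp
    show ?thesis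
    proof (cases \<psi>)
      case (FOr p q)
      have "good g (X, add b {Fm p es} \<Theta>) \<or> good g (X, add b {Fm q es} \<Theta>)"
      proof (rule good_cut[OF assms(1)])
        fix \<mu> :: "('u, 'i) valn" assume "models \<mu> (\<Theta> b)"
        then have "holds \<mu> f" using f by blast
        then show "holds \<mu> (Fm p es) \<or> holds \<mu> (Fm q es)" by (simp add: Fm FOr)
      qed (use wk Fm FOr in auto)
      then show ?thesis
      proof
        assume "good g (X, add b {Fm p es} \<Theta>)"
        then show ?thesis by (intro exI[of _ "(X, add b {Fm p es} \<Theta>)"]) (simp add: le_add in_add Fm FOr)
      next
        assume "good g (X, add b {Fm q es} \<Theta>)"
        then show ?thesis by (intro exI[of _ "(X, add b {Fm q es} \<Theta>)"]) (simp add: le_add in_add Fm FOr)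
      qed
    next
      case (FAnd p q)
      have "good g (X, add b {Fm p es, Fm q es} \<Theta>)"
      proof (rule good_implied[OF assms(1)])
        fix \<mu> :: "('u, 'i) valn" and f' assume "models \<mu> (\<Theta> b)" "f' \<in> {Fm p es, Fm q es}"
        moreover from this have "holds \<mu> f" using f by blast
        ultimately show "holds \<mu> f'" by (auto simp: Fm FAnd)
      qed (use wk Fm FAnd in auto)
      then show ?thesis
        by (intro exI[of _ "(X, add b {Fm p es, Fm q es} \<Theta>)"]) (simp add: le_add in_add Fm FAnd)
    next
      case (FAll x t p)
      show ?thesis
      proof (cases "\<exists>w. m = Mem w (steval es t) \<and> m \<in> \<Theta> b")
        case False
        then show ?thesis using assms(1) by (intro exI[of _ "(X, \<Theta>)"]) (auto simp: Fm FAll)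
      next
        case True
        then obtain w where w: "m = Mem w (steval es t)" "m \<in> \<Theta> b" by blast
        let ?\<Gamma> = "\<lambda>k. stype (lk es k)"
        obtain T where T: "ttype ?\<Gamma> t = Some (TSet T)" "wtf (?\<Gamma>(x := T)) p"
          using wk(1) Fm FAll by auto
        have s: "stype (steval es t) = TSet T"
          "\<And>\<mu> :: ('u, 'i) valn. teval (\<lambda>k. ev \<mu> (lk es k)) t = ev \<mu> (steval es t)"
          using steval_sound[OF T(1)] by auto
        have mk: "wff m" "fkeys m \<subseteq> X \<union> loc b" using wf_stateD(4,5)[OF i w(2)] by auto
        then have wT: "stype w = T" using w(1) s(1) by simp
        have "good g (X, add b {Fm p ((x, w) # es)} \<Theta>)"
        proof (rule good_implied[OF assms(1)])
          fix \<mu> :: "('u, 'i) valn" and f' assume "models \<mu> (\<Theta> b)" and f': "f' \<in> {Fm p ((x, w) # es)}"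
          then have "holds \<mu> f" "holds \<mu> m" using f w(2) by blast+
          then show "holds \<mu> f'" using f' s(2) unfolding w(1) Fm FAll
            by (auto simp: ev_lk_Cons simp del: lk.simps)
        next
          fix f' assume "f' \<in> {Fm p ((x, w) # es)}"
          then show "wff f' \<and> fkeys f' \<subseteq> X \<union> loc b"
            using T(2) wT wk(2) mk(2) w(1) Fm by (auto simp: stype_lk_Cons simp del: lk.simps)
        qed auto
        moreover have "metF b f m (X, \<Theta>) (X, add b {Fm p ((x, w) # es)} \<Theta>)"
          using w by (auto simp: Fm FAll add_def)
        ultimately show ?thesis using le_add by blast
      qed
    next
      case (FEx x t p)
      then show ?thesis using step_ex[OF assms(1)] f Fm by simp
    qed (use triv Fm in auto)
  qed
qed

lemma step_E_side:
  assumes "good g (X, \<Theta>)" "stype a = TUr" "stype c = TUr"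
  shows "\<exists>S'. good g S' \<and> le (X, \<Theta>) S' \<and> fst S' = X \<and>
    (keys a \<union> keys c \<subseteq> X \<union> loc b \<longrightarrow> eqF a c \<in> snd S' b \<or> neF a c \<in> snd S' b)"
proof (cases "keys a \<union> keys c \<subseteq> X \<union> loc b")
  case True
  have "good g (X, add b {eqF a c} \<Theta>) \<or> good g (X, add b {neF a c} \<Theta>)"
    by (rule good_cut[OF assms(1)]) (use True assms(2,3) holds_eqF[of _ c a] in auto)
  then show ?thesis
  proof
    assume "good g (X, add b {eqF a c} \<Theta>)"
    then show ?thesis by (intro exI[of _ "(X, add b {eqF a c} \<Theta>)"]) (simp add: le_add in_add)
  next
    assume "good g (X, add b {neF a c} \<Theta>)"
    then show ?thesis by (intro exI[of _ "(X, add b {neF a c} \<Theta>)"]) (simp add: le_add in_add)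
  qed
next
  case False
  then show ?thesis using assms(1) by (intro exI[of _ "(X, \<Theta>)"]) auto
qed

text \<open>Equality of shared atoms is itself an NRC-definable condition on shared names, so the
  case split is one that both copies can make together.\<close>

lemma step_E_common:
  assumes "good g (X, \<Theta>)" "stype a = TUr" "stype c = TUr" "keys a \<union> keys c \<subseteq> X"
  shows "\<exists>S'. good g S' \<and> le (X, \<Theta>) S' \<and> ((\<forall>b. eqF a c \<in> snd S' b) \<or> (\<forall>b. neF a c \<in> snd S' b))"
proof -
  have i: "wf_state (X, \<Theta>)" and nS: "\<not> Sep g X \<Theta>" using assms(1) by (auto simp: good_def)
  have "D X TUr (\<lambda>\<mu> :: ('u, 'i) valn. ev \<mu> a)" "D X TUr (\<lambda>\<mu> :: ('u, 'i) valn. ev \<mu> c)"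
    using D_ev[of a X] D_ev[of c X] assms by auto
  then have P: "DB X (\<lambda>\<mu>. ev \<mu> a = ev \<mu> c)" by (rule DB_eq[OF wf_stateD(1)[OF i]])
  have "\<not> Sep g X (\<lambda>b. {eqF a c} \<union> \<Theta> b) \<or> \<not> Sep g X (\<lambda>b. {neF a c} \<union> \<Theta> b)"
  proof (rule ccontr)
    assume "\<not> ?thesis"
    then have S: "Sep g X (\<lambda>b. {eqF a c} \<union> \<Theta> b)" "Sep g X (\<lambda>b. {neF a c} \<union> \<Theta> b)" by blast+
    have "if ev \<mu> a = ev \<mu> c then holds \<mu> (eqF a c) else holds \<mu> (neF a c)"
      if "models \<mu> (\<Theta> b)" for b and \<mu> :: "('u, 'i) valn"
      using that assms(2,3) holds_eqF[of \<mu> c a] by simp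
    then have "Sep g X \<Theta>" by (rule Sep_common_cut[OF P _ S])
    then show False using nS by blast
  qed
  \<comment> \<open>\<open>SU\<close> carries no names, so the set of shared names stays the
    same.\<close>
  moreover have "wf_state (X \<union> keys SU, \<lambda>b. {eqF a c} \<union> \<Theta> b)" "wf_state (X \<union> keys SU, \<lambda>b. {neF a c} \<union> \<Theta> b)"
    using assms(2-4) by (intro wf_state_common[OF i]; auto)+
  ultimately have "good g (X, \<lambda>b. {eqF a c} \<union> \<Theta> b) \<or> good g (X, \<lambda>b. {neF a c} \<union> \<Theta> b)"
    by (auto simp: good_def)
  moreover have le: "le (X, \<Theta>) (X, \<lambda>b. {f} \<union> \<Theta> b)" for f by (auto simp: le_def)
  ultimately show ?thesis
  proof (elim disjE)
    assume "good g (X, \<lambda>b. {eqF a c} \<union> \<Theta> b)"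
    with le show ?thesis by (intro exI[of _ "(X, \<lambda>b. {eqF a c} \<union> \<Theta> b)"]) simp
  next
    assume "good g (X, \<lambda>b. {neF a c} \<union> \<Theta> b)"
    with le show ?thesis by (intro exI[of _ "(X, \<lambda>b. {neF a c} \<union> \<Theta> b)"]) simp
  qed
qed

lemma step:
  assumes "good g S"
  shows "\<exists>S'. good g S' \<and> le S S' \<and> met q S S'"
proof -
  obtain X \<Theta> where S: "S = (X, \<Theta>)" by (cases S)
  have g: "good g (X, \<Theta>)" using assms S by simp
  show ?thesis
  proof (cases q)
    case (RF b f m)
    show ?thesis
    proof (cases "f \<in> \<Theta> b")
      case True
      then show ?thesis using step_F[OF g True, of m] RF S by auto
    next
      case False
      then show ?thesis using g RF S by (intro exI[of _ S]) simp
    qed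
  next
    case (RE a c)
    show ?thesis
    proof (cases "stype a = TUr \<and> stype c = TUr")
      case False
      then show ?thesis using g RE S by (intro exI[of _ S]) auto
    next
      case t: True
      show ?thesis
      proof (cases "keys a \<union> keys c \<subseteq> X")
        case True
        obtain S' where "good g S'" "le (X, \<Theta>) S'" "(\<forall>b. eqF a c \<in> snd S' b) \<or> (\<forall>b. neF a c \<in> snd S' b)"
          using step_E_common[OF g _ _ True] t by blast
        then show ?thesis using RE S by (intro exI[of _ S']) auto
      next
        case False
        obtain S1 where 1: "good g S1" "le S S1" "fst S1 = X"
          "keys a \<union> keys c \<subseteq> X \<union> loc True \<longrightarrow> eqF a c \<in> snd S1 True \<or> neF a c \<in> snd S1 True"
          using step_E_side[OF g, of a c True] t S by blast
        then have "good g (X, snd S1)" by (metis prod.collapse)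
        then obtain S2 where 2: "good g S2" "le S1 S2"
          "keys a \<union> keys c \<subseteq> X \<union> loc False \<longrightarrow> eqF a c \<in> snd S2 False \<or> neF a c \<in> snd S2 False"
          using step_E_side[of g X "snd S1" a c False] t 1(3) by (metis prod.collapse)
        have "eqF a c \<in> snd S2 b \<or> neF a c \<in> snd S2 b" if "keys a \<union> keys c \<subseteq> X \<union> loc b" for b
          using 1(4) 2(2,3) that by (cases b) (auto simp: le_def)
        then have "met q S S2" using RE S False t by auto
        then show ?thesis using 1 2 le_trans by blast
      qed
    qed
  qed
qed

text \<open>The relation \<open>gm\<close> adds requests peculiar to one application, indexed by
  symbolic values, to the general ones. Stage \<open>n\<close> serves the first component of the
  pair coded by \<open>n\<close>, so each request is served infinitely often.\<close>

lemma chain: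
  fixes gm :: "sv \<Rightarrow> state \<Rightarrow> state \<Rightarrow> bool"
  assumes S0: "good g S0"
    and gstep: "\<And>S y. good g S \<Longrightarrow> le S0 S \<Longrightarrow> \<exists>S'. good g S' \<and> le S S' \<and> gm y S S'"
  obtains Sq :: "nat \<Rightarrow> state" where "Sq 0 = S0" "\<And>n. good g (Sq n)" "\<And>n. le (Sq n) (Sq (Suc n))"
    "\<And>q n. \<exists>m\<ge>n. met q (Sq m) (Sq (Suc m))" "\<And>y n. \<exists>m\<ge>n. gm y (Sq m) (Sq (Suc m))"
proof -
  let ?M = "\<lambda>q S S'. case q of Inl r \<Rightarrow> met r S S' | Inr y \<Rightarrow> gm y S S'"
  define nx where "nx = (\<lambda>S (q :: req + sv). SOME S'. good g S' \<and> le S S' \<and> ?M q S S')"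
  have nx: "good g (nx S q) \<and> le S (nx S q) \<and> ?M q S (nx S q)" if "good g S" "le S0 S" for S q
  proof -
    have "\<exists>S'. good g S' \<and> le S S' \<and> ?M q S S'"
      using step[OF that(1)] gstep[OF that] by (cases q) auto
    then show ?thesis unfolding nx_def by (rule someI_ex)
  qed
  define Sq where "Sq = rec_nat S0 (\<lambda>n S. nx S (from_nat (fst (prod_decode n))))"
  have Sq: "Sq 0 = S0" "Sq (Suc n) = nx (Sq n) (from_nat (fst (prod_decode n)))" for n
    by (simp_all add: Sq_def)
  have gl: "good g (Sq n) \<and> le S0 (Sq n)" for n
  proof (induction n)
    case 0 then show ?case using S0 Sq(1) by simp
  next
    case (Suc n) then show ?case using nx Sq(2) le_trans by metis
  qed
  have fair: "\<exists>m\<ge>n. ?M q (Sq m) (Sq (Suc m))" for q n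
  proof (intro exI conjI)
    \<comment> \<open>The second component only pushes the stage to \<open>n\<close> or
      beyond.\<close>
    let ?m = "prod_encode (to_nat q, n)"
    show "?m \<ge> n" by (rule le_prod_encode_2)
    show "?M q (Sq ?m) (Sq (Suc ?m))" using nx[of "Sq ?m" q] gl
      unfolding Sq(2)[of ?m] prod_encode_inverse fst_conv from_nat_to_nat by blast
  qed
  show ?thesis
  proof (rule that[of Sq])
    show "le (Sq n) (Sq (Suc n))" for n using nx gl Sq(2) by metis
    show "\<exists>m\<ge>n. met q (Sq m) (Sq (Suc m))" for q n using fair[of n "Inl q"] by simp
    show "\<exists>m\<ge>n. gm y (Sq m) (Sq (Suc m))" for y n using fair[of n "Inr y"] by simp
  qed (use gl Sq(1) in auto)
qed

end

section \<open>The joint model of a saturated chain\<close>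

locale hintikka = inf_types UT IT for UT :: "'u itself" and IT :: "'i itself" +
  fixes g :: "sv option" and Sq :: "nat \<Rightarrow> state"
  assumes good: "\<And>n. good g (Sq n)" and le: "\<And>n. le (Sq n) (Sq (Suc n))"
    and fair: "\<And>q n. \<exists>m\<ge>n. met q (Sq m) (Sq (Suc m))"
begin

definition XX :: "key set" where "XX = (\<Union>n. fst (Sq n))"
definition H :: "bool \<Rightarrow> fact set" where "H b = (\<Union>n. snd (Sq n) b)"
definition K :: "bool \<Rightarrow> key set" where "K b = XX \<union> loc b"

lemma mono: "n \<le> m \<Longrightarrow> le (Sq n) (Sq m)"
  by (induction rule: dec_induct) (auto intro: le_trans le)

lemma wf: "wf_state (fst (Sq n), snd (Sq n))"
  using good[of n] by (simp add: good_def)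

lemma in_H: "f \<in> snd (Sq n) b \<Longrightarrow> f \<in> H b"
  by (auto simp: H_def)

lemma H_stage: assumes "f \<in> H b" shows "\<exists>n. \<forall>m\<ge>n. f \<in> snd (Sq m) b"
proof -
  obtain n where "f \<in> snd (Sq n) b" using assms by (auto simp: H_def)
  then have "f \<in> snd (Sq m) b" if "m \<ge> n" for m using mono[OF that] by (auto simp: le_def)
  then show ?thesis by blast
qed

lemma XX_stage: assumes "finite A" "A \<subseteq> XX" shows "\<exists>n. \<forall>m\<ge>n. A \<subseteq> fst (Sq m)"
  using assms
proof (induction A)
  case (insert k A)
  then obtain n where n: "\<forall>m\<ge>n. A \<subseteq> fst (Sq m)" by blast
  obtain n' where "k \<in> fst (Sq n')" using insert.prems by (auto simp: XX_def)
  then have "k \<in> fst (Sq m)" if "m \<ge> n'" for m using mono[OF that] by (auto simp: le_def)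
  then have "\<forall>m\<ge>max n n'. insert k A \<subseteq> fst (Sq m)" using n by auto
  then show ?case by blast
qed simp

lemma K_stage: assumes "finite A" "A \<subseteq> K b" shows "\<exists>n. \<forall>m\<ge>n. A \<subseteq> fst (Sq m) \<union> loc b"
proof -
  have "finite (A - loc b)" "A - loc b \<subseteq> XX" using assms unfolding K_def by blast+
  from XX_stage[OF this] obtain n where n: "\<forall>m\<ge>n. A - loc b \<subseteq> fst (Sq m)" by blast
  have "A \<subseteq> fst (Sq m) \<union> loc b" if "m \<ge> n" for m using n that by blast
  then show ?thesis by blast
qed

lemma XX_None: "k \<in> XX \<Longrightarrow> fst k = None"
  unfolding XX_def using wf_stateD(2)[OF wf] by blast

lemma XX_K: "XX \<subseteq> K b"
  by (auto simp: K_def)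

lemma K_K: "k \<in> K b \<Longrightarrow> k \<in> K (\<not> b) \<Longrightarrow> k \<in> XX"
  by (auto simp: K_def loc_def)

lemma H_wff: "f \<in> H b \<Longrightarrow> wff f"
  using wf_stateD(4)[OF wf] by (auto simp: H_def)

lemma H_keys: "f \<in> H b \<Longrightarrow> fkeys f \<subseteq> K b"
proof -
  assume "f \<in> H b"
  then obtain n where "f \<in> snd (Sq n) b" by (auto simp: H_def)
  then have "fkeys f \<subseteq> fst (Sq n) \<union> loc b" by (rule wf_stateD(5)[OF wf])
  then show ?thesis unfolding K_def XX_def by blast
qed

lemma H_mem_common: "Mem p (Nm None t n) \<in> H b \<Longrightarrow> Mem p (Nm None t n) \<in> H b'"
proof -
  assume "Mem p (Nm None t n) \<in> H b"
  then obtain m where "Mem p (Nm None t n) \<in> snd (Sq m) b" by (auto simp: H_def)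
  then have "Mem p (Nm None t n) \<in> snd (Sq m) b'" by (rule wf_stateD(6)[OF wf])
  then show ?thesis by (rule in_H)
qed

text \<open>A finite part already lies in one stage, and inseparability gives each side of a stage a
  model. Consistency and the laws of equality therefore transfer from actual models to
  \<open>H b\<close> without requests of their own.\<close>

lemma H_fin_sat:
  assumes "finite F" "F \<subseteq> H b"
  shows "\<exists>\<mu> :: ('u, 'i) valn. models \<mu> F"
proof -
  have "\<exists>n. \<forall>m\<ge>n. F \<subseteq> snd (Sq m) b" using assms
  proof (induction F)
    case (insert f F)
    then obtain n where n: "\<forall>m\<ge>n. F \<subseteq> snd (Sq m) b" by blast
    obtain n' where n': "\<forall>m\<ge>n'. f \<in> snd (Sq m) b" using H_stage insert.prems by blast
    then have "\<forall>m\<ge>max n n'. insert f F \<subseteq> snd (Sq m) b" using n by auto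
    then show ?case by blast
  qed simp
  then obtain n where n: "F \<subseteq> snd (Sq n) b" by blast
  have "\<not> Sep g (fst (Sq n)) (snd (Sq n))" using good[of n] by (simp add: good_def)
  then obtain \<mu> :: "('u, 'i) valn" where "models \<mu> (snd (Sq n) b)" using Sep_incons by blast
  then show ?thesis using n by blast
qed

lemma H_met: assumes "f \<in> H b" shows "\<exists>n. metF b f m (Sq n) (Sq (Suc n)) \<and> (m \<in> H b \<longrightarrow> m \<in> snd (Sq n) b)"
proof -
  obtain n where n: "\<forall>m\<ge>n. f \<in> snd (Sq m) b" using H_stage[OF assms] by blast
  obtain n' where n': "m \<in> H b \<longrightarrow> (\<forall>k\<ge>n'. m \<in> snd (Sq k) b)" using H_stage by blast
  obtain k where k: "k \<ge> max n n'" "met (RF b f m) (Sq k) (Sq (Suc k))" using fair by blast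
  then have "metF b f m (Sq k) (Sq (Suc k))" using n by simp
  then show ?thesis using n' k(1) by auto
qed

lemma H_or: "Fm (FOr p q) es \<in> H b \<Longrightarrow> Fm p es \<in> H b \<or> Fm q es \<in> H b"
  using H_met[of "Fm (FOr p q) es" b] in_H by (metis metF.simps(1))

lemma H_and: "Fm (FAnd p q) es \<in> H b \<Longrightarrow> Fm p es \<in> H b \<and> Fm q es \<in> H b"
  using H_met[of "Fm (FAnd p q) es" b] in_H by (metis metF.simps(2))

lemma H_all: "Fm (FAll x t p) es \<in> H b \<Longrightarrow> Mem w (steval es t) \<in> H b \<Longrightarrow> Fm p ((x, w) # es) \<in> H b"
  using H_met[of "Fm (FAll x t p) es" b "Mem w (steval es t)"] in_H by (metis metF.simps(3))

lemma H_ex: "Fm (FEx x t p) es \<in> H b \<Longrightarrow> \<exists>w. Mem w (steval es t) \<in> H b \<and> Fm p ((x, w) # es) \<in> H b"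
  using H_met[of "Fm (FEx x t p) es" b] in_H by (metis metF.simps(4))

lemma H_decide:
  assumes "stype a = TUr" "stype c = TUr" "keys a \<subseteq> K b" "keys c \<subseteq> K b"
  shows "eqF a c \<in> H b \<or> neF a c \<in> H b"
proof -
  obtain n where n: "\<forall>m\<ge>n. keys a \<union> keys c \<subseteq> fst (Sq m) \<union> loc b"
    using K_stage[of "keys a \<union> keys c" b] assms by auto
  obtain m where m: "m \<ge> n" "met (RE a c) (Sq m) (Sq (Suc m))" using fair by blast
  then have "eqF a c \<in> snd (Sq (Suc m)) b \<or> neF a c \<in> snd (Sq (Suc m)) b" using n assms by simp
  then show ?thesis using in_H by blast
qed

lemma H_eq_ne: assumes "eqF a c \<in> H b" "neF a c \<in> H b" "stype c = stype a" shows False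
proof -
  obtain \<mu> :: "('u, 'i) valn" where "models \<mu> {eqF a c, neF a c}"
    using H_fin_sat[of "{eqF a c, neF a c}" b] assms by auto
  then show False using holds_eqF[of \<mu> c a] assms(3) by simp
qed

lemma H_share:
  assumes "stype a = TUr" "stype c = TUr" "keys a \<subseteq> XX" "keys c \<subseteq> XX" "eqF a c \<in> H b"
  shows "eqF a c \<in> H b'"
proof -
  obtain n where n: "\<forall>m\<ge>n. keys a \<union> keys c \<subseteq> fst (Sq m)"
    using XX_stage[of "keys a \<union> keys c"] assms by auto
  obtain m where m: "m \<ge> n" "met (RE a c) (Sq m) (Sq (Suc m))" using fair by blast
  then have "(\<forall>b. eqF a c \<in> snd (Sq (Suc m)) b) \<or> (\<forall>b. neF a c \<in> snd (Sq (Suc m)) b)" using n assms by simp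
  then have "eqF a c \<in> H b' \<or> neF a c \<in> H b" using in_H by blast
  then show ?thesis using H_eq_ne[of a c b] assms by auto
qed

definition atoms :: "bool \<Rightarrow> sv set" where
  "atoms b = {a. stype a = TUr \<and> keys a \<subseteq> K b}"

lemma H_eq_refl: "a \<in> atoms b \<Longrightarrow> eqF a a \<in> H b"
proof (rule ccontr)
  assume a: "a \<in> atoms b" and "eqF a a \<notin> H b"
  then have "neF a a \<in> H b" using H_decide[of a a b] by (auto simp: atoms_def)
  then obtain \<mu> :: "('u, 'i) valn" where "models \<mu> {neF a a}" using H_fin_sat[of "{neF a a}" b] by auto
  then show False using holds_eqF[of \<mu> a a] by simp
qed

text \<open>Euclidean form: with reflexivity it yields both symmetry and transitivity.\<close>

lemma H_eq_trans:
  assumes "a \<in> atoms b" "c \<in> atoms b" "d \<in> atoms b" "eqF a c \<in> H b" "eqF a d \<in> H b"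
  shows "eqF c d \<in> H b"
proof (rule ccontr)
  have t: "stype a = TUr" "stype c = TUr" "stype d = TUr" using assms by (auto simp: atoms_def)
  assume "eqF c d \<notin> H b"
  then have "neF c d \<in> H b" using H_decide[of c d b] assms by (auto simp: atoms_def)
  then obtain \<mu> :: "('u, 'i) valn" where "models \<mu> {eqF a c, eqF a d, neF c d}"
    using H_fin_sat[of "{eqF a c, eqF a d, neF c d}" b] assms by auto
  then show False using holds_eqF[of \<mu> c a] holds_eqF[of \<mu> d a] holds_eqF[of \<mu> d c] t by simp
qed

text \<open>
  Atom names are interpreted by the code of a representative of their equality class, a shared one
  if possible: an atom of one copy then coincides with an atom of the other copy only through a
  shared atom.
\<close>

definition cc :: "bool \<Rightarrow> sv \<Rightarrow> sv set" where
  "cc b a = {c. stype c = TUr \<and> keys c \<subseteq> XX \<and> eqF a c \<in> H b}"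
definition lo :: "bool \<Rightarrow> sv \<Rightarrow> sv set" where
  "lo b a = {c \<in> atoms b. eqF a c \<in> H b}"
definition rp :: "bool \<Rightarrow> sv \<Rightarrow> nat" where
  "rp b a = (LEAST n. n \<in> to_nat ` (if cc b a \<noteq> {} then cc b a else lo b a))"

lemma cc_lo: "cc b a \<subseteq> lo b a"
  using XX_K by (fastforce simp: cc_def lo_def atoms_def)

lemma lo_refl: "a \<in> atoms b \<Longrightarrow> a \<in> lo b a"
  using H_eq_refl by (simp add: lo_def)

lemma rp_in: assumes "a \<in> atoms b" shows "\<exists>c. to_nat c = rp b a \<and> c \<in> (if cc b a \<noteq> {} then cc b a else lo b a)"
proof -
  have "\<exists>n. n \<in> to_nat ` (if cc b a \<noteq> {} then cc b a else lo b a)" using lo_refl[OF assms] by auto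
  then have "rp b a \<in> to_nat ` (if cc b a \<noteq> {} then cc b a else lo b a)" unfolding rp_def by (rule LeastI_ex)
  then obtain c where "rp b a = to_nat c" "c \<in> (if cc b a \<noteq> {} then cc b a else lo b a)"
    by (rule imageE)
  then show ?thesis by (intro exI[of _ c] conjI) simp
qed

lemma rp_lo: assumes "a \<in> atoms b" shows "\<exists>c. to_nat c = rp b a \<and> c \<in> lo b a"
proof -
  obtain c where "to_nat c = rp b a" "c \<in> (if cc b a \<noteq> {} then cc b a else lo b a)"
    using rp_in[OF assms] by blast
  then show ?thesis using cc_lo[of b a] by (intro exI[of _ c]) (auto split: if_splits)
qed

lemma rp_eq:
  assumes "a \<in> atoms b" "c \<in> atoms b"
  shows "rp b a = rp b c \<longleftrightarrow> eqF a c \<in> H b"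
proof
  assume "rp b a = rp b c"
  then obtain d where d: "d \<in> lo b a" "d \<in> lo b c" using rp_lo[OF assms(1)] rp_lo[OF assms(2)]
    by (metis injD inj_to_nat)
  then have "eqF a d \<in> H b" "eqF c d \<in> H b" "d \<in> atoms b" by (auto simp: lo_def)
  then have "eqF d a \<in> H b" "eqF d c \<in> H b" using H_eq_trans H_eq_refl assms by blast+
  then show "eqF a c \<in> H b" using H_eq_trans assms \<open>d \<in> atoms b\<close> by blast
next
  assume e: "eqF a c \<in> H b"
  have e': "eqF c a \<in> H b" using H_eq_trans[OF assms(1,2,1) e] H_eq_refl assms by blast
  have "eqF a d \<in> H b \<longleftrightarrow> eqF c d \<in> H b" if "d \<in> atoms b" for d
    using H_eq_trans[OF assms(1,2) that e] H_eq_trans[OF assms(2,1) that e'] by blast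
  moreover have "stype d = TUr \<and> keys d \<subseteq> XX \<Longrightarrow> d \<in> atoms b" for d using XX_K by (auto simp: atoms_def)
  ultimately have "cc b a = cc b c" "lo b a = lo b c" unfolding cc_def lo_def by blast+
  then show "rp b a = rp b c" by (simp add: rp_def)
qed

text \<open>A shared atom lies in its own \<open>cc\<close>, so its representative is taken from
  there, and \<open>H_share\<close> makes this set the same for both copies.\<close>

lemma rp_common:
  assumes "stype a = TUr" "keys a \<subseteq> XX" shows "rp b a = rp b' a"
proof -
  have "cc b a = cc b' a" unfolding cc_def using H_share[OF assms(1) _ assms(2)] by blast
  moreover have c: "a \<in> cc b a" for b
  proof -
    have "a \<in> atoms b" using assms XX_K by (auto simp: atoms_def)
    then show ?thesis using assms H_eq_refl by (simp add: cc_def)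
  qed
  ultimately show ?thesis unfolding rp_def using c[of b] c[of b'] by auto
qed

text \<open>Equal codes come from one representative known to both copies; its names lie in
  \<open>K b\<close> and in \<open>K (\<not> b)\<close>, so they are shared.\<close>

lemma rp_cross:
  assumes "a \<in> atoms b" "c \<in> atoms (\<not> b)" "rp b a = rp (\<not> b) c"
  shows "\<exists>d. stype d = TUr \<and> keys d \<subseteq> XX \<and> eqF a d \<in> H b"
proof -
  obtain d where "d \<in> lo b a" "d \<in> lo (\<not> b) c" using rp_lo[OF assms(1)] rp_lo[OF assms(2)] assms(3)
    by (metis injD inj_to_nat)
  then have "stype d = TUr" "keys d \<subseteq> K b" "keys d \<subseteq> K (\<not> b)" "eqF a d \<in> H b"
    by (auto simp: lo_def atoms_def)
  then show ?thesis using K_K by blast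
qed

text \<open>Here infinity of \<open>'u\<close> enters: countably many atom classes need pairwise
  distinct atoms.\<close>

definition emb :: "nat \<Rightarrow> 'u" where "emb = (SOME f. inj f)"

lemma inj_emb: "inj emb"
proof -
  have "\<exists>f :: nat \<Rightarrow> 'u. inj f" using inf_u infinite_countable_subset by blast
  then show ?thesis unfolding emb_def by (rule someI_ex)
qed

text \<open>A term model: a set name gets exactly the members listed by \<open>Mem\<close> facts,
  and these have smaller type, so the recursion ends. Shared atoms are read in the left copy, which
  by \<open>rp_common\<close> makes no difference. Facts of either copy may contribute members,
  because they agree on shared sets and only one copy speaks about a private set.\<close>

function sval :: "sv \<Rightarrow> ('u, 'i) nval" where
  "sval (Nm s None n) = Atom (emb (rp (s = None \<or> s = Some True) (Nm s None n)))"
| "sval (Nm s (Some T) n) =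
     mkset (sval ` {p. stype p = T \<and> (\<exists>b. Mem p (Nm s (Some T) n) \<in> H b)})"
| "sval SU = UnitV"
| "sval (SP a b) = PairV (sval a) (sval b)"
  by pat_completeness auto
termination by (relation "measure (\<lambda>p. size (stype p))") auto

lemma small_sval: "small (sval ` A)"
  by (rule small_countable[of _ "\<lambda>n. sval (from_nat n)"]) (auto, metis from_nat_to_nat rangeI)

lemma cano_sval: "cano (sval p) (stype p)"
  by (induction p rule: sval.induct) (auto simp: cano_mkset small_sval)

text \<open>Keys of unit or product type never occur in a symbolic value; the default merely makes
  the valuation total.\<close>

definition \<nu> :: "('u, 'i) valn" where
  "\<nu> = (\<lambda>(s, T, n). case T of TUr \<Rightarrow> sval (Nm s None n) | TSet U \<Rightarrow> sval (Nm s (Some U) n) | _ \<Rightarrow> dflt T)"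

lemma val_\<nu>: "val \<nu>"
proof -
  have "cano (\<nu> (s, T, n)) T" for s T n
    using cano_sval[of "Nm s None n"] cano_sval[of "Nm s (Some U) n" for U] cano_dflt
    by (cases T) (auto simp: \<nu>_def simp del: sval.simps)
  then show ?thesis by (simp add: val_def)
qed

lemma ev_\<nu>: "ev \<nu> p = sval p"
proof (induction p)
  case (Nm s t n)
  then show ?case by (cases t) (auto simp: \<nu>_def)
qed auto

lemma sval_atom: assumes "a \<in> atoms b" shows "sval a = Atom (emb (rp b a))"
proof -
  obtain s n where a: "a = Nm s None n" "(s, TUr, n) \<in> K b" using assms stype_cases(1) by (auto simp: atoms_def)
  show ?thesis
  proof (cases s)
    case None
    then have "keys a \<subseteq> XX" using a by (auto simp: K_def loc_def)
    then have "rp b a = rp True a" using rp_common assms by (simp add: atoms_def)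
    then show ?thesis using a None by simp
  next
    case (Some b')
    then have "b' = b" using a(2) XX_None[of "(s, TUr, n)"] by (auto simp: K_def loc_def)
    then show ?thesis using a Some by (cases b) auto
  qed
qed

lemma sval_atom_eq:
  assumes "a \<in> atoms b" "c \<in> atoms b" shows "sval a = sval c \<longleftrightarrow> eqF a c \<in> H b"
  using rp_eq[OF assms] inj_emb by (simp add: sval_atom[OF assms(1)] sval_atom[OF assms(2)] inj_eq)

lemma sval_cross:
  assumes "a \<in> atoms b" "c \<in> atoms (\<not> b)" "sval a = sval c"
  shows "\<exists>d. stype d = TUr \<and> keys d \<subseteq> XX \<and> eqF a d \<in> H b"
  using rp_cross[OF assms(1,2)] assms(3) inj_emb
  by (simp add: sval_atom[OF assms(1)] sval_atom[OF assms(2)] inj_eq)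

lemma elems_sval:
  assumes "stype s = TSet T" "keys s \<subseteq> K b"
  shows "elems (sval s) = sval ` {p. Mem p s \<in> H b}"
proof -
  obtain sd n where s: "s = Nm sd (Some T) n" using assms(1) unfolding stype_cases by blast
  have "Mem p s \<in> H b" if "Mem p s \<in> H b'" for p b'
  proof (cases sd)
    case None
    then show ?thesis using that H_mem_common s by blast
  next
    case (Some b'')
    have "keys s \<subseteq> K b'" using H_keys[OF that] by simp
    then have "b'' = b'" "b'' = b" 
      using s Some XX_None[of "(sd, TSet T, n)"] assms(2) by (auto simp: K_def loc_def)
    then show ?thesis using that by simp
  qed
  moreover have "stype p = T" if "Mem p s \<in> H b" for p using H_wff[OF that] assms(1) by simp
  ultimately have "{p. stype p = T \<and> (\<exists>b. Mem p s \<in> H b)} = {p. Mem p s \<in> H b}" by blast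
  then show ?thesis using s by (simp add: small_sval)
qed

text \<open>In the atomic cases the opposite decision about the two atoms would yield a two-element
  subset of \<open>H b\<close> without a model, so the decision recorded in \<open>H b\<close> is
  the right one, and \<open>sval_atom_eq\<close> transfers it to values.\<close>

lemma truth_lemma: "Fm \<psi> es \<in> H b \<Longrightarrow> sat (\<lambda>k. sval (lk es k)) \<psi>"
proof (induction \<psi> arbitrary: es)
  case (FEqU t u)
  let ?\<Gamma> = "\<lambda>k. stype (lk es k)"
  have ty: "ttype ?\<Gamma> t = Some TUr" "ttype ?\<Gamma> u = Some TUr" using H_wff[OF FEqU] by auto
  have k: "ekeys es \<subseteq> K b" using H_keys[OF FEqU] by simp
  note t = steval_sound[OF ty(1)] and u = steval_sound[OF ty(2)]
  have at: "steval es t \<in> atoms b" "steval es u \<in> atoms b" using t[of \<nu>] u[of \<nu>] k unfolding atoms_def by blast+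
  have "neF (steval es t) (steval es u) \<notin> H b"
  proof
    assume ne: "neF (steval es t) (steval es u) \<in> H b"
    let ?F = "{Fm (FEqU t u) es, neF (steval es t) (steval es u)}"
    obtain \<mu> :: "('u, 'i) valn" where m: "models \<mu> ?F"
      using H_fin_sat[of ?F b] FEqU ne by auto
    then show False using holds_eqF[of \<mu> "steval es u" "steval es t"] t[of \<mu>] u[of \<mu>] by simp
  qed
  then have "eqF (steval es t) (steval es u) \<in> H b" using H_decide at by (auto simp: atoms_def)
  then have "sval (steval es t) = sval (steval es u)" using sval_atom_eq at by blast
  then show ?case using t[of \<nu>] u[of \<nu>] by (simp add: ev_\<nu>)
next
  case (FNeqU t u)
  let ?\<Gamma> = "\<lambda>k. stype (lk es k)"
  have ty: "ttype ?\<Gamma> t = Some TUr" "ttype ?\<Gamma> u = Some TUr" using H_wff[OF FNeqU] by auto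
  have k: "ekeys es \<subseteq> K b" using H_keys[OF FNeqU] by simp
  note t = steval_sound[OF ty(1)] and u = steval_sound[OF ty(2)]
  have at: "steval es t \<in> atoms b" "steval es u \<in> atoms b" using t[of \<nu>] u[of \<nu>] k unfolding atoms_def by blast+
  have "eqF (steval es t) (steval es u) \<notin> H b"
  proof
    assume ne: "eqF (steval es t) (steval es u) \<in> H b"
    let ?F = "{Fm (FNeqU t u) es, eqF (steval es t) (steval es u)}"
    obtain \<mu> :: "('u, 'i) valn" where m: "models \<mu> ?F"
      using H_fin_sat[of ?F b] FNeqU ne by auto
    then show False using holds_eqF[of \<mu> "steval es u" "steval es t"] t[of \<mu>] u[of \<mu>] by simp
  qed
  then have "sval (steval es t) \<noteq> sval (steval es u)" using sval_atom_eq at by blast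
  then show ?case using t[of \<nu>] u[of \<nu>] by (simp add: ev_\<nu>)
next
  case FBot
  then show ?case using H_fin_sat[of "{Fm FBot es}" b] by auto
next
  case (FOr p q)
  from H_or[OF FOr.prems] show ?case using FOr.IH[of es] unfolding sat.simps by blast
next
  case (FAnd p q)
  from H_and[OF FAnd.prems] show ?case using FAnd.IH[of es] unfolding sat.simps by blast
next
  case (FAll x t p)
  let ?\<Gamma> = "\<lambda>k. stype (lk es k)"
  obtain T where ty: "ttype ?\<Gamma> t = Some (TSet T)" using H_wff[OF FAll.prems] by auto
  have k: "ekeys es \<subseteq> K b" using H_keys[OF FAll.prems] by simp
  note t = steval_sound[OF ty, of \<nu>]
  have e: "elems (sval (steval es t)) = sval ` {w. Mem w (steval es t) \<in> H b}"
    using t k by (intro elems_sval) auto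
  have "sat ((\<lambda>k. sval (lk es k))(x := sval w)) p" if "Mem w (steval es t) \<in> H b" for w
    using FAll.IH[OF H_all[OF FAll.prems that]] ev_lk_Cons[of \<nu>] by (simp only: ev_\<nu>)
  then show ?case using t e by (simp add: ev_\<nu>)
next
  case (FEx x t p)
  let ?\<Gamma> = "\<lambda>k. stype (lk es k)"
  obtain T where ty: "ttype ?\<Gamma> t = Some (TSet T)" using H_wff[OF FEx.prems] by auto
  have k: "ekeys es \<subseteq> K b" using H_keys[OF FEx.prems] by simp
  note t = steval_sound[OF ty, of \<nu>]
  have e: "elems (sval (steval es t)) = sval ` {w. Mem w (steval es t) \<in> H b}"
    using t k by (intro elems_sval) auto
  obtain w where w: "Mem w (steval es t) \<in> H b" "Fm p ((x, w) # es) \<in> H b" using H_ex[OF FEx.prems] by blast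
  have "sat ((\<lambda>k. sval (lk es k))(x := sval w)) p"
    using FEx.IH[OF w(2)] ev_lk_Cons[of \<nu>] by (simp only: ev_\<nu>)
  then show ?case using t e w(1) by (auto simp: ev_\<nu>)
qed auto

lemma holds_\<nu>: assumes "f \<in> H b" shows "holds \<nu> f"
proof (cases f)
  case (Mem p s)
  then have "stype s = TSet (stype p)" "keys s \<subseteq> K b" using H_wff[OF assms] H_keys[OF assms] by auto
  then show ?thesis using elems_sval assms Mem by (auto simp: ev_\<nu>)
next
  case (Fm \<psi> es)
  then show ?thesis using truth_lemma assms by (simp add: ev_\<nu>)
qed

end

section \<open>Collecting an object definable from the other copy\<close>

text \<open>
  Subobjects are recorded with their type because a value does not determine its type: the empty
  set has every set type.
\<close>

inductive_set Sub :: "('u, 'i) valn \<Rightarrow> sv set \<Rightarrow> (('u, 'i) nval \<times> ty) set"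
  for \<mu> :: "('u, 'i) valn" and B :: "sv set" where
  base: "q \<in> B \<Longrightarrow> (ev \<mu> q, stype q) \<in> Sub \<mu> B"
| left: "(PairV v w, TProd A C) \<in> Sub \<mu> B \<Longrightarrow> (v, A) \<in> Sub \<mu> B"
| right: "(PairV v w, TProd A C) \<in> Sub \<mu> B \<Longrightarrow> (w, C) \<in> Sub \<mu> B"
| elem: "(v, TSet T) \<in> Sub \<mu> B \<Longrightarrow> w \<in> elems v \<Longrightarrow> (w, T) \<in> Sub \<mu> B"

text \<open>Sets of the model have no unnamed members, so every subobject of a right-hand object is
  again named in the right copy.\<close>

lemma (in hintikka) Sub_sval:
  assumes "(v, T) \<in> Sub \<nu> B" "\<And>q. q \<in> B \<Longrightarrow> keys q \<subseteq> K b"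
  shows "\<exists>p. keys p \<subseteq> K b \<and> stype p = T \<and> v = sval p"
  using assms(1)
proof induction
  case (base q)
  then show ?case using assms(2) ev_\<nu> by blast
next
  case (left v w A C)
  then obtain p where "keys p \<subseteq> K b" "stype p = TProd A C" "PairV v w = sval p" by blast
  moreover from this obtain a c where "p = SP a c" "stype a = A" "stype c = C" using stype_cases(3) by blast
  ultimately have "keys a \<subseteq> K b" "stype a = A" "v = sval a" by auto
  then show ?case by blast
next
  case (right v w A C)
  then obtain p where "keys p \<subseteq> K b" "stype p = TProd A C" "PairV v w = sval p" by blast
  moreover from this obtain a c where "p = SP a c" "stype a = A" "stype c = C" using stype_cases(3) by blast
  ultimately have "keys c \<subseteq> K b" "stype c = C" "w = sval c" by auto
  then show ?case by blast
next
  case (elem v T w)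
  then obtain p where p: "keys p \<subseteq> K b" "stype p = TSet T" "v = sval p" by blast
  then obtain q where q: "w = sval q" "Mem q p \<in> H b" using elem.hyps(2) elems_sval[of p T b] by blast
  moreover have "stype q = T" "keys q \<subseteq> K b" using H_wff[OF q(2)] H_keys[OF q(2)] p(2) by auto
  ultimately show ?case by blast
qed

context inf_types begin

lemma small_insert: "small (S :: ('u, 'i) nval set) \<Longrightarrow> small (insert x S)"
  using small_Un[OF small_sing[of x]] by simp

lemma model_exists:
  fixes gm :: "sv \<Rightarrow> state \<Rightarrow> state \<Rightarrow> bool"
  assumes S0: "good g S0"
    and gstep: "\<And>S y. good g S \<Longrightarrow> le S0 S \<Longrightarrow> \<exists>S'. good g S' \<and> le S S' \<and> gm y S S'"
  obtains Sq where "hintikka TYPE('i) TYPE('u) g Sq" "Sq 0 = S0" "\<And>y n. \<exists>m\<ge>n. gm y (Sq m) (Sq (Suc m))"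
proof -
  show thesis
  proof (rule chain[OF S0 gstep])
    fix Sq assume Sq: "Sq 0 = S0" "\<And>n. good g (Sq n)" "\<And>n. le (Sq n) (Sq (Suc n))"
      "\<And>q n. \<exists>m\<ge>n. met q (Sq m) (Sq (Suc m))" "\<And>y n. \<exists>m\<ge>n. gm y (Sq m) (Sq (Suc m))"
    have "hintikka TYPE('i) TYPE('u) g Sq" by (intro hintikka.intro hintikka_axioms.intro inf_types_axioms Sq)
    then show thesis by (rule that[OF _ Sq(1,5)])
  qed
qed

text \<open>The cartesian product as a double union of singletons, over two patterns with disjoint
  fresh names.\<close>

lemma D_prod:
  fixes f h :: "_ \<Rightarrow> ('u, 'i) nval"
  assumes X: "finite X" and f: "D X (TSet A) f" and h: "D X (TSet C) h"
  shows "\<exists>e. D X (TSet (TProd A C)) e \<and>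
    (\<forall>\<mu> v w. val \<mu> \<longrightarrow> v \<in> elems (f \<mu>) \<longrightarrow> w \<in> elems (h \<mu>) \<longrightarrow> PairV v w \<in> elems (e \<mu>))"
proof -
  obtain p where p: "stype p = A" "linear p" "keys p \<inter> X = {}" using fresh_sv[OF X] by metis
  have Xp: "finite (X \<union> keys p)" using X by simp
  obtain q where q: "stype q = C" "linear q" "keys q \<inter> (X \<union> keys p) = {}" using fresh_sv[OF Xp] by metis
  have qp: "keys p \<inter> keys q = {}" using q(3) by blast
  have "D (X \<union> keys p \<union> keys q) (TSet (TProd (stype p) (stype q))) (\<lambda>\<mu>. mkset {PairV (ev \<mu> p) (ev \<mu> q)})"
    by (intro D_sng D_pair D_ev) auto
  moreover have "D (X \<union> keys p) (TSet (stype q)) h" unfolding q(1) by (rule D_mono[OF h]) auto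
  ultimately have "D (X \<union> keys p) (TSet (TProd (stype p) (stype q)))
      (\<lambda>\<mu>. mkset (\<Union>w\<in>elems (h \<mu>). elems (mkset {PairV (ev (bnd q w \<mu>) p) (ev (bnd q w \<mu>) q)})))"
    by (rule D_big[OF Xp q(2,3)])
  from D_big[OF X p(2,3) this, unfolded p(1) q(1), OF f]
  have e: "D X (TSet (TProd A C)) (\<lambda>\<mu>. mkset (\<Union>v\<in>elems (f \<mu>). elems (mkset (\<Union>w\<in>elems (h (bnd p v \<mu>)).
      elems (mkset {PairV (ev (bnd q w (bnd p v \<mu>)) p) (ev (bnd q w (bnd p v \<mu>)) q)})))))"
    (is "D X _ ?e") .
  moreover have "PairV v w \<in> elems (?e \<mu>)" if v: "val \<mu>" "v \<in> elems (f \<mu>)" "w \<in> elems (h \<mu>)" for \<mu> v w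
  proof -
    have cv: "cano v A" and cw: "cano w C" using D_cano[OF f v(1)] D_cano[OF h v(1)] v(2,3) cano_elems by blast+
    have "val (bnd p v \<mu>)" using v(1) cv p(1) val_bnd by blast
    then have "h (bnd p v \<mu>) = h \<mu>" using p(3) v(1) by (intro D_dep[OF h] bnd_other) auto
    moreover have "ev (bnd q w (bnd p v \<mu>)) p = v"
      using cv p(1) by (simp add: ev_bnd_other[OF qp] ev_bnd[OF p(2)])
    moreover have "ev (bnd q w (bnd p v \<mu>)) q = w" using cw q(1) by (simp add: ev_bnd[OF q(2)])
    ultimately show ?thesis using v(2,3)
      by (simp add: small_UN) (rule bexI[of _ v], rule bexI[of _ w], simp_all)
  qed
  ultimately show ?thesis by blast
qed

text \<open>The hypothesis asks for a subobject instead of an equal object because this passes from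
  \<open>r\<close> to its components and to its members, as the induction on the type requires.
  States are generalised since the set case adds a fresh member of \<open>r\<close> on the
  left.\<close>

lemma collect:
  assumes "wf_state (X, \<Theta>)" "fst ` keys r \<subseteq> {Some True}" "\<And>q. q \<in> B \<Longrightarrow> keys q \<subseteq> X \<union> loc False"
    and "\<And>\<mu> :: ('u, 'i) valn. (\<And>b. models \<mu> (\<Theta> b)) \<Longrightarrow> (ev \<mu> r, stype r) \<in> Sub \<mu> B"
  shows "Sep (Some r) X \<Theta>"
  using assms
proof (induction "stype r" arbitrary: r X \<Theta>)
  case TUnit
  then have r: "r = SU" using stype_cases(2) by metis
  show ?case
  proof (rule SepI)
    show "D X (TSet (gty (Some r))) (\<lambda>_. mkset {UnitV})" by (simp add: gty_def r D_sng D_unit)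
    show "DB X (\<lambda>_. False)" by (rule DB_False)
  qed (auto simp: gsat_def r)
next
  case (TProd A C)
  obtain a c where r: "r = SP a c" "A = stype a" "C = stype c" using TProd(3) stype_cases(3)[of r A C] by auto
  have "Sep (Some a) X \<Theta>"
  proof (rule TProd.hyps(1)[OF r(2) TProd.prems(1) _ TProd.prems(3)])
    show "(ev \<mu> a, stype a) \<in> Sub \<mu> B" if "\<And>b. models \<mu> (\<Theta> b)" for \<mu> :: "('u, 'i) valn"
      using TProd.prems(4)[OF that] by (auto simp: r(1) intro: Sub.left)
  qed (use TProd.prems(2) r(1) in auto)
  then obtain E1 \<theta>1 where 1: "D X (TSet (stype a)) E1" "DB X \<theta>1"
    "\<And>b \<mu> :: ('u, 'i) valn. models \<mu> (\<Theta> b) \<Longrightarrow> \<theta>1 \<mu> = b \<or> gsat (Some a) b \<mu> (E1 \<mu>)"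
    unfolding Sep_def gty_def option.case by blast
  have "Sep (Some c) X \<Theta>"
  proof (rule TProd.hyps(2)[OF r(3) TProd.prems(1) _ TProd.prems(3)])
    show "(ev \<mu> c, stype c) \<in> Sub \<mu> B" if "\<And>b. models \<mu> (\<Theta> b)" for \<mu> :: "('u, 'i) valn"
      using TProd.prems(4)[OF that] by (auto simp: r(1) intro: Sub.right)
  qed (use TProd.prems(2) r(1) in auto)
  then obtain E2 \<theta>2 where 2: "D X (TSet (stype c)) E2" "DB X \<theta>2"
    "\<And>b \<mu> :: ('u, 'i) valn. models \<mu> (\<Theta> b) \<Longrightarrow> \<theta>2 \<mu> = b \<or> gsat (Some c) b \<mu> (E2 \<mu>)"
    unfolding Sep_def gty_def option.case by blast
  obtain E where E: "D X (TSet (TProd (stype a) (stype c))) E"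
    "\<And>\<mu> v w. val \<mu> \<Longrightarrow> v \<in> elems (E1 \<mu>) \<Longrightarrow> w \<in> elems (E2 \<mu>) \<Longrightarrow> PairV v w \<in> elems (E \<mu>)"
    using D_prod[OF wf_stateD(1)[OF TProd.prems(1)] 1(1) 2(1)] by blast
  show ?case
  proof (rule SepI)
    show "D X (TSet (gty (Some r))) E" using E(1) by (simp add: gty_def r(1))
    \<comment> \<open>On the left, if both conditions fail then both components are collected, hence
      also the pair; on the right both conditions always fail.\<close>
    show "DB X (\<lambda>\<mu>. \<theta>1 \<mu> \<or> \<theta>2 \<mu>)" by (rule DB_or[OF 1(2) 2(2)])
    show "(\<theta>1 \<mu> \<or> \<theta>2 \<mu>) = b \<or> gsat (Some r) b \<mu> (E \<mu>)" if "models \<mu> (\<Theta> b)" for b and \<mu> :: "('u, 'i) valn"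
      using 1(3)[OF that] 2(3)[OF that] E(2)[of \<mu> "ev \<mu> a" "ev \<mu> c"] that by (auto simp: gsat_def r(1))
  qed
next
  case TUr
  show ?case
  proof (rule ccontr)
    assume "\<not> ?case"
    then have S0: "good (Some r) (X, \<Theta>)" using TUr.prems(1) by (simp add: good_def)
    have kr: "keys r \<subseteq> loc True" using TUr.prems(2) unfolding loc_def by blast
    \<comment> \<open>Avoiding the shared atoms is enough, since by \<open>sval_cross\<close> a left
      atom meets a right atom only through a shared one.\<close>
    let ?gm = "\<lambda>y S S'. stype y = TUr \<and> keys y \<subseteq> fst S \<longrightarrow> neF r y \<in> snd S' True"
    have gstep: "\<exists>S'. good (Some r) S' \<and> le S S' \<and> ?gm y S S'"
      if g: "good (Some r) S" and "le (X, \<Theta>) S" for S y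
    proof (cases "stype y = TUr \<and> keys y \<subseteq> fst S")
      case False
      then show ?thesis using g le_refl by blast
    next
      case True
      obtain X' \<Theta>' where S: "S = (X', \<Theta>')" by (cases S)
      \<comment> \<open>If \<open>r\<close> equals a shared atom \<open>y\<close>, then the
        singleton of \<open>y\<close> already collects it; an inseparable state can thus only be
        extended by the disequality.\<close>
      have "Sep (Some r) X' (add True {eqF r y} \<Theta>')"
      proof (rule SepI)
        show "D X' (TSet (gty (Some r))) (\<lambda>\<mu>. mkset {ev \<mu> y})"
          using D_sng[OF D_ev[of y X']] True S TUr(1) by (simp add: gty_def)
        show "DB X' (\<lambda>_. False)" by (rule DB_False)
        show "False = b \<or> gsat (Some r) b \<mu> (mkset {ev \<mu> y})" if m: "models \<mu> (add True {eqF r y} \<Theta>' b)"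
          for b and \<mu> :: "('u, 'i) valn"
        proof (cases b)
          case b: True
          then have "holds \<mu> (eqF r y)" using m by (simp add: add_def)
          then have "ev \<mu> r = ev \<mu> y" using holds_eqF[of \<mu> y r] m True TUr(1) by simp
          then show ?thesis using b by (simp add: gsat_def)
        qed simp
      qed
      moreover have "good (Some r) (X', add True {eqF r y} \<Theta>') \<or> good (Some r) (X', add True {neF r y} \<Theta>')"
      proof (rule good_cut)
        show "good (Some r) (X', \<Theta>')" using g S by simp
        show "holds \<mu> (eqF r y) \<or> holds \<mu> (neF r y)" if "models \<mu> (\<Theta>' True)" for \<mu> :: "('u, 'i) valn"
          using that holds_eqF[of \<mu> y r] True TUr(1) by auto
      qed (use True TUr(1) kr S in auto)
      ultimately have "good (Some r) (X', add True {neF r y} \<Theta>')" by (simp add: good_def)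
      then show ?thesis using S by (intro exI[of _ "(X', add True {neF r y} \<Theta>')"]) (simp add: le_add in_add)
    qed
    obtain Sq where Sq: "hintikka TYPE('i) TYPE('u) (Some r) Sq" "Sq 0 = (X, \<Theta>)" "\<And>y n. \<exists>m\<ge>n. ?gm y (Sq m) (Sq (Suc m))"
      using model_exists[where gm = ?gm, OF S0 gstep] by blast
    interpret hintikka UT IT "Some r" Sq by (rule Sq(1))
    have X: "X \<subseteq> XX" using Sq(2) unfolding XX_def by (metis UN_upper UNIV_I fst_conv)
    have "models \<nu> (\<Theta> b)" for b
      using val_\<nu> holds_\<nu> in_H[of _ 0 b] Sq(2) by auto
    then have "(ev \<nu> r, stype r) \<in> Sub \<nu> B" by (rule TUr.prems(4))
    moreover have "keys q \<subseteq> K False" if "q \<in> B" for q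
      using TUr.prems(3)[OF that] X unfolding K_def by blast
    ultimately obtain y where "keys y \<subseteq> K False" "stype y = stype r" "ev \<nu> r = sval y"
      using Sub_sval by blast
    then have y: "keys y \<subseteq> K False" "stype y = TUr" "sval r = sval y" using TUr(1) by (simp_all add: ev_\<nu>)
    have "r \<in> atoms True" using kr TUr(1) unfolding atoms_def K_def by auto
    moreover have "y \<in> atoms (\<not> True)" using y by (simp add: atoms_def)
    ultimately obtain d where d: "stype d = TUr" "keys d \<subseteq> XX" "eqF r d \<in> H True"
      using sval_cross y(3) by blast
    obtain n where "\<forall>m\<ge>n. keys d \<subseteq> fst (Sq m)" using XX_stage[OF finite_keys d(2)] by blast
    then obtain m where "neF r d \<in> snd (Sq (Suc m)) True" using Sq(3)[of n d] d(1) by blast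
    then show False using H_eq_ne[OF d(3) in_H] d(1) TUr(1) by simp
  qed
next
  case (TSet T)
  show ?case
  proof (rule ccontr)
    assume "\<not> ?case"
    then have S0: "good (Some r) (X, \<Theta>)" using TSet.prems(1) by (simp add: good_def)
    note tr = TSet.hyps(2)[symmetric]
    have kr: "keys r \<subseteq> loc True" using TSet.prems(2) unfolding loc_def by blast
    obtain z where z: "stype z = T" "linear z" "keys z \<inter> X = {}" "\<And>b f. f \<in> \<Theta> b \<Longrightarrow> keys z \<inter> fkeys f = {}"
      "\<And>r'. Some r = Some r' \<Longrightarrow> keys r' \<inter> keys z = {}" "fst ` keys z \<subseteq> {Some True}"
      using fresh_for[OF S0] by metis
    have kz: "keys z \<subseteq> loc True" using z(6) unfolding loc_def by blast
    have rz: "keys r \<inter> keys z = {}" using z(5) by blast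
    have nr: "r \<noteq> Nm None t n" for t n using TSet.prems(2) by auto
    \<comment> \<open>\<open>z\<close> stands for an arbitrary member of \<open>r\<close>; a member
      of a subobject is a subobject, so the induction hypothesis applies.\<close>
    have "Sep (Some z) X (add True {Mem z r} \<Theta>)"
    proof (rule TSet.hyps(1))
      show "wf_state (X, add True {Mem z r} \<Theta>)"
        using kz kr tr z(1) nr by (intro wf_state_add[OF TSet.prems(1)]) auto
      fix \<mu> :: "('u, 'i) valn" assume m: "\<And>b. models \<mu> (add True {Mem z r} \<Theta> b)"
      then have "models \<mu> (\<Theta> b)" for b using m[of b] by (cases b) (simp_all add: add_def)
      then have "(ev \<mu> r, stype r) \<in> Sub \<mu> B" by (rule TSet.prems(4))
      moreover have "ev \<mu> z \<in> elems (ev \<mu> r)" using m[of True] by (auto simp: add_def)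
      ultimately show "(ev \<mu> z, stype z) \<in> Sub \<mu> B" unfolding tr z(1) by (rule Sub.elem)
    qed (use z TSet.prems in auto)
    then obtain E0 \<theta>0 where 0: "D X (TSet T) E0" "DB X \<theta>0"
      "\<And>b \<mu> :: ('u, 'i) valn. models \<mu> (add True {Mem z r} \<Theta> b) \<Longrightarrow> \<theta>0 \<mu> = b \<or> gsat (Some z) b \<mu> (E0 \<mu>)"
      unfolding Sep_def gty_def option.case z(1) by blast
    \<comment> \<open>Since \<open>z\<close> is fresh, it can be rebound to each member of
      \<open>r\<close> in turn, while \<open>\<theta>0\<close> and \<open>E0\<close> keep their
      values: one expression bounds all members.\<close>
    have L0: "\<theta>0 \<mu> \<or> elems (ev \<mu> r) \<subseteq> elems (E0 \<mu>)" if m: "models \<mu> (\<Theta> True)" for \<mu> :: "('u, 'i) valn"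
    proof -
      have "\<theta>0 \<mu> \<or> y \<in> elems (E0 \<mu>)" if y: "y \<in> elems (ev \<mu> r)" for y
      proof -
        have c: "cano y (stype z)" using y m ev_cano[of \<mu> r] tr z(1) cano_elems by metis
        let ?\<mu> = "bnd z y \<mu>"
        have v: "val ?\<mu>" using m c val_bnd by blast
        have e: "ev ?\<mu> z = y" "ev ?\<mu> r = ev \<mu> r" using ev_bnd[OF z(2) c] ev_bnd_other[OF rz] by auto
        have "holds ?\<mu> f" if "f \<in> \<Theta> True" for f
        proof -
          have "holds ?\<mu> f = holds \<mu> f" using z(4)[OF that] by (intro holds_cong bnd_other) auto
          then show ?thesis using m that by blast
        qed
        then have "models ?\<mu> (add True {Mem z r} \<Theta> True)" using v e y by (auto simp: add_def)
        from 0(3)[OF this] have "\<theta>0 ?\<mu> \<or> y \<in> elems (E0 ?\<mu>)" using e by (auto simp: gsat_def)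
        moreover have X: "?\<mu> k = \<mu> k" if "k \<in> X" for k using that z(3) by (intro bnd_other) auto
        have "\<theta>0 ?\<mu> = \<theta>0 \<mu>" "E0 ?\<mu> = E0 \<mu>"
          using DB_dep[OF 0(2) v _ X] D_dep[OF 0(1) v _ X] m by blast+
        ultimately show ?thesis by simp
      qed
      then show ?thesis by blast
    qed
    have R0: "\<not> \<theta>0 \<mu>" if m: "models \<mu> (\<Theta> False)" for \<mu> :: "('u, 'i) valn"
      using 0(3)[of \<mu> False] m by (auto simp: add_def gsat_def)
    let ?gm = "\<lambda>y S S'. stype y = TSet T \<and> keys y \<subseteq> fst S \<union> loc False \<longrightarrow>
      (\<exists>p. stype p = T \<and> (inF p r \<in> snd S' True \<and> ninF p y \<in> snd S' False \<or>
                           ninF p r \<in> snd S' True \<and> inF p y \<in> snd S' False))"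
    have gstep: "\<exists>S'. good (Some r) S' \<and> le S S' \<and> ?gm y S S'"
      if g: "good (Some r) S" and l: "le (X, \<Theta>) S" for S y
    proof (cases "stype y = TSet T \<and> keys y \<subseteq> fst S \<union> loc False")
      case False
      then show ?thesis using g le_refl by blast
    next
      case True
      obtain X' \<Theta>' where S: "S = (X', \<Theta>')" by (cases S)
      have g': "good (Some r) (X', \<Theta>')" using g S by simp
      have wf: "wf_state (X', \<Theta>')" and nS: "\<not> Sep (Some r) X' \<Theta>'" using g' by (auto simp: good_def)
      have X': "X \<subseteq> X'" and \<Theta>': "\<And>b. \<Theta> b \<subseteq> \<Theta>' b" using l S by (auto simp: le_def)
      obtain p where p: "stype p = T" "linear p" "keys p \<inter> X' = {}" "\<And>b f. f \<in> \<Theta>' b \<Longrightarrow> keys p \<inter> fkeys f = {}"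
        "\<And>r'. Some r = Some r' \<Longrightarrow> keys r' \<inter> keys p = {}" "fst ` keys p \<subseteq> {None}"
        using fresh_for[OF g'] by metis
      have rp: "keys r \<inter> keys p = {}" using p(5) by blast
      have "k \<notin> keys p" if "k \<in> loc False" for k using p(6) that unfolding loc_def by force
      then have yp: "keys y \<inter> keys p = {}" using True p(3) S by auto
      \<comment> \<open>The two ways in which \<open>p\<close> can tell \<open>r\<close> from
        \<open>y\<close>. Each copy receives only the half that concerns its own object, so neither
        copy alone is forced to distinguish them.\<close>
      define F1 where "F1 = (\<lambda>b. if b then {inF p r} else {ninF p y})"
      define F2 where "F2 = (\<lambda>b. if b then {ninF p r} else {inF p y})"
      have "\<not> (Sep (Some r) (X' \<union> keys p) (\<lambda>b. F1 b \<union> \<Theta>' b) \<and> Sep (Some r) (X' \<union> keys p) (\<lambda>b. F2 b \<union> \<Theta>' b))"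
      proof
        assume a: "Sep (Some r) (X' \<union> keys p) (\<lambda>b. F1 b \<union> \<Theta>' b) \<and> Sep (Some r) (X' \<union> keys p) (\<lambda>b. F2 b \<union> \<Theta>' b)"
        obtain E1 \<theta>1 where 1: "D (X' \<union> keys p) (TSet (TSet T)) E1" "DB (X' \<union> keys p) \<theta>1"
          "\<And>b \<mu> :: ('u, 'i) valn. models \<mu> (F1 b \<union> \<Theta>' b) \<Longrightarrow> \<theta>1 \<mu> = b \<or> gsat (Some r) b \<mu> (E1 \<mu>)"
          using a unfolding Sep_def gty_def option.case tr by blast
        obtain E2 \<theta>2 where 2: "D (X' \<union> keys p) (TSet (TSet T)) E2" "DB (X' \<union> keys p) \<theta>2"
          "\<And>b \<mu> :: ('u, 'i) valn. models \<mu> (F2 b \<union> \<Theta>' b) \<Longrightarrow> \<theta>2 \<mu> = b \<or> gsat (Some r) b \<mu> (E2 \<mu>)"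
          using a unfolding Sep_def gty_def option.case tr by blast
        have E0': "D X' (TSet (stype p)) E0" using D_mono[OF 0(1) X'] p(1) by simp
        note fin = wf_stateD(1)[OF wf]
        \<comment> \<open>\<open>?W\<close> gathers whatever the two given expressions collect as
          \<open>p\<close> ranges over \<open>E0\<close>.\<close>
        let ?W = "\<lambda>\<mu>. mkset (\<Union>v\<in>elems (E0 \<mu>). elems (mkset (elems (E1 (bnd p v \<mu>)) \<union> elems (E2 (bnd p v \<mu>)))))"
        \<comment> \<open>The new candidate for \<open>r\<close>. On the left, unless
          \<open>r\<close> is in \<open>?W\<close>, condition \<open>\<theta>1\<close> holds at
          members of \<open>r\<close> and \<open>\<theta>2\<close> at the other elements of
          \<open>E0\<close>; if the two never overlap, \<open>\<theta>1\<close> carves out exactly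
          \<open>r\<close>.\<close>
        let ?V = "\<lambda>\<mu>. mkset {v \<in> elems (E0 \<mu>). \<theta>1 (bnd p v \<mu>)}"
        let ?E = "\<lambda>\<mu>. mkset (elems (?W \<mu>) \<union> elems (mkset {?V \<mu>}))"
        \<comment> \<open>An overlap excludes the right copy: there each \<open>v\<close> either
          belongs to \<open>y\<close> or not, so one of the two conditions is false at
          \<open>v\<close>.\<close>
        let ?\<theta> = "\<lambda>\<mu>. \<theta>0 \<mu> \<or> (\<exists>v\<in>elems (E0 \<mu>). \<theta>1 (bnd p v \<mu>) \<and> \<theta>2 (bnd p v \<mu>))"
        have V: "D X' (TSet T) ?V" using D_sep[OF fin p(2,3) 1(2) E0'] p(1) by simp
        have W: "D X' (TSet (TSet T)) ?W" by (rule D_big[OF fin p(2,3) D_un[OF 1(1) 2(1)] E0'])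
        have elE: "elems (?E \<mu>) = (\<Union>v\<in>elems (E0 \<mu>). elems (E1 (bnd p v \<mu>)) \<union> elems (E2 (bnd p v \<mu>))) \<union> {?V \<mu>}"
          for \<mu> :: "('u, 'i) valn"
          by (simp add: small_insert small_Un small_UN)
        have elV: "elems (?V \<mu>) = {v \<in> elems (E0 \<mu>). \<theta>1 (bnd p v \<mu>)}" for \<mu> :: "('u, 'i) valn"
          by (rule elems_mkset, rule small_subset[OF small_elems]) blast
        have st: "val (bnd p v \<mu>) \<and> ev (bnd p v \<mu>) p = v \<and> (\<forall>f\<in>\<Theta>' b. holds (bnd p v \<mu>) f)"
          if m: "models \<mu> (\<Theta>' b)" and v: "v \<in> elems (E0 \<mu>)" for b v and \<mu> :: "('u, 'i) valn"
        proof (intro conjI ballI)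
          have c: "cano v (stype p)" using D_cano[OF E0'] m v cano_elems by blast
          show "val (bnd p v \<mu>)" using m c val_bnd by blast
          show "ev (bnd p v \<mu>) p = v" by (rule ev_bnd[OF p(2) c])
          fix f assume f: "f \<in> \<Theta>' b"
          have "holds (bnd p v \<mu>) f = holds \<mu> f" using p(4)[OF f] by (intro holds_cong bnd_other) auto
          then show "holds (bnd p v \<mu>) f" using m f by blast
        qed
        have "Sep (Some r) X' \<Theta>'"
        proof (rule SepI)
          show "D X' (TSet (gty (Some r))) ?E" unfolding gty_def option.case tr by (rule D_un[OF W D_sng[OF V]])
          show "DB X' ?\<theta>"
            by (intro DB_or DB_mono[OF 0(2) X'] DB_ex[OF fin p(2,3) DB_and[OF 1(2) 2(2)] E0'])
          fix b and \<mu> :: "('u, 'i) valn" assume m: "models \<mu> (\<Theta>' b)"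
          then have mb: "models \<mu> (\<Theta> b)" using \<Theta>' by blast
          show "?\<theta> \<mu> = b \<or> gsat (Some r) b \<mu> (?E \<mu>)"
          proof (cases b)
            case b: True
            show ?thesis
            proof (rule ccontr)
              assume "\<not> ?thesis"
              then have n: "\<not> ?\<theta> \<mu>" "ev \<mu> r \<notin> elems (?E \<mu>)" using b by (auto simp: gsat_def)
              have sub: "elems (ev \<mu> r) \<subseteq> elems (E0 \<mu>)" using L0[of \<mu>] mb b n(1) by simp
              have "\<theta>1 (bnd p v \<mu>) \<longleftrightarrow> v \<in> elems (ev \<mu> r)" if v: "v \<in> elems (E0 \<mu>)" for v
              proof -
                note s = st[OF m v]
                have er: "ev (bnd p v \<mu>) r = ev \<mu> r" by (rule ev_bnd_other[OF rp])
                have ni: "\<not> gsat (Some r) b (bnd p v \<mu>) (E1 (bnd p v \<mu>))" "\<not> gsat (Some r) b (bnd p v \<mu>) (E2 (bnd p v \<mu>))"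
                  using n(2) v unfolding elE gsat_def by (auto simp: er)
                show ?thesis
                proof
                  assume "v \<in> elems (ev \<mu> r)"
                  then have "holds (bnd p v \<mu>) (inF p r)" using holds_inF(1)[of "bnd p v \<mu>" r p] s er tr p(1) by simp
                  then have "models (bnd p v \<mu>) (F1 b \<union> \<Theta>' b)" using s b by (auto simp: F1_def)
                  then show "\<theta>1 (bnd p v \<mu>)" using 1(3) ni(1) b by blast
                next
                  assume t1: "\<theta>1 (bnd p v \<mu>)"
                  show "v \<in> elems (ev \<mu> r)"
                  proof (rule ccontr)
                    assume "v \<notin> elems (ev \<mu> r)"
                    then have "holds (bnd p v \<mu>) (ninF p r)" using holds_inF(2)[of "bnd p v \<mu>" r p] s er tr p(1) by simp
                    then have "models (bnd p v \<mu>) (F2 b \<union> \<Theta>' b)" using s b by (auto simp: F2_def)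
                    then have "\<theta>2 (bnd p v \<mu>)" using 2(3) ni(2) b by blast
                    then show False using t1 v n(1) by blast
                  qed
                qed
              qed
              then have eV: "elems (?V \<mu>) = elems (ev \<mu> r)" unfolding elV using sub by blast
              have cV: "cano (?V \<mu>) (TSet T)" "cano (ev \<mu> r) (TSet T)"
                using D_cano[OF V] ev_cano[of \<mu> r] m tr by auto
              have Vr: "?V \<mu> = ev \<mu> r" by (rule iffD2[OF cano_set_eq[OF cV] eV])
              have "?V \<mu> \<in> elems (?E \<mu>)" unfolding elE by (rule UnI2, rule singletonI)
              then show False using n(2) unfolding Vr by (rule notE[rotated])
            qed
          next
            case b: False
            have "\<not> (\<theta>1 (bnd p v \<mu>) \<and> \<theta>2 (bnd p v \<mu>))" if v: "v \<in> elems (E0 \<mu>)" for v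
            proof -
              note s = st[OF m v]
              have ey: "ev (bnd p v \<mu>) y = ev \<mu> y" by (rule ev_bnd_other[OF yp])
              have "holds (bnd p v \<mu>) (ninF p y) \<or> holds (bnd p v \<mu>) (inF p y)"
                using holds_inF[of "bnd p v \<mu>" y p] s True p(1) by auto
              then have "models (bnd p v \<mu>) (F1 b \<union> \<Theta>' b) \<or> models (bnd p v \<mu>) (F2 b \<union> \<Theta>' b)"
                using s b by (auto simp: F1_def F2_def)
              then have "\<theta>1 (bnd p v \<mu>) = b \<or> \<theta>2 (bnd p v \<mu>) = b"
                using 1(3) 2(3) b unfolding gsat_def by blast
              then show ?thesis using b by blast
            qed
            moreover have "\<not> \<theta>0 \<mu>" using R0[of \<mu>] mb b by simp
            ultimately show ?thesis using b by blast
          qed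
        qed
        then show False using nS by blast
      qed
      moreover have "wf_state (X' \<union> keys p, \<lambda>b. F1 b \<union> \<Theta>' b)" "wf_state (X' \<union> keys p, \<lambda>b. F2 b \<union> \<Theta>' b)"
      proof -
        have w: "wff (inF p r)" "wff (ninF p r)" "wff (inF p y)" "wff (ninF p y)" using tr p(1) True by auto
        have k: "keys p \<union> keys r \<subseteq> X' \<union> keys p \<union> loc True" "keys p \<union> keys y \<subseteq> X' \<union> keys p \<union> loc False"
          using kr True S by auto
        show "wf_state (X' \<union> keys p, \<lambda>b. F1 b \<union> \<Theta>' b)"
          by (rule wf_state_common[OF wf p(6)]) (use w k in \<open>auto simp: F1_def split: if_splits\<close>)
        show "wf_state (X' \<union> keys p, \<lambda>b. F2 b \<union> \<Theta>' b)"
          by (rule wf_state_common[OF wf p(6)]) (use w k in \<open>auto simp: F2_def split: if_splits\<close>)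
      qed
      ultimately have "good (Some r) (X' \<union> keys p, \<lambda>b. F1 b \<union> \<Theta>' b) \<or> good (Some r) (X' \<union> keys p, \<lambda>b. F2 b \<union> \<Theta>' b)"
        by (auto simp: good_def)
      moreover have le1: "le S (X' \<union> keys p, \<lambda>b. F b \<union> \<Theta>' b)" for F unfolding S le_def by auto
      moreover have "?gm y S (X' \<union> keys p, \<lambda>b. F1 b \<union> \<Theta>' b)" "?gm y S (X' \<union> keys p, \<lambda>b. F2 b \<union> \<Theta>' b)"
        unfolding F1_def F2_def using p(1) by auto
      ultimately show ?thesis by blast
    qed
    obtain Sq where Sq: "hintikka TYPE('i) TYPE('u) (Some r) Sq" "Sq 0 = (X, \<Theta>)" "\<And>y n. \<exists>m\<ge>n. ?gm y (Sq m) (Sq (Suc m))"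
      using model_exists[where gm = ?gm, OF S0 gstep] by blast
    interpret hintikka UT IT "Some r" Sq by (rule Sq(1))
    have X: "X \<subseteq> XX" using Sq(2) unfolding XX_def by (metis UN_upper UNIV_I fst_conv)
    have "models \<nu> (\<Theta> b)" for b
      using val_\<nu> holds_\<nu> in_H[of _ 0 b] Sq(2) by auto
    then have "(ev \<nu> r, stype r) \<in> Sub \<nu> B" by (rule TSet.prems(4))
    moreover have "keys q \<subseteq> K False" if "q \<in> B" for q
      using TSet.prems(3)[OF that] X unfolding K_def by blast
    ultimately obtain y where "keys y \<subseteq> K False" "stype y = stype r" "ev \<nu> r = sval y"
      using Sub_sval by blast
    then have y: "keys y \<subseteq> K False" "stype y = TSet T" "ev \<nu> r = ev \<nu> y" using tr by (simp_all add: ev_\<nu>)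
    \<comment> \<open>Once all names of \<open>y\<close> are in use, the request for
      \<open>y\<close> yields an object that belongs to exactly one of \<open>r\<close> and
      \<open>y\<close>, although their values coincide.\<close>
    obtain n where "\<forall>m\<ge>n. keys y \<subseteq> fst (Sq m) \<union> loc False" using K_stage[OF finite_keys y(1)] by blast
    then obtain m p where p: "stype p = T" "inF p r \<in> snd (Sq (Suc m)) True \<and> ninF p y \<in> snd (Sq (Suc m)) False \<or>
       ninF p r \<in> snd (Sq (Suc m)) True \<and> inF p y \<in> snd (Sq (Suc m)) False"
      using Sq(3)[of n y] y(2) by blast
    then have "holds \<nu> (inF p r) \<and> holds \<nu> (ninF p y) \<or> holds \<nu> (ninF p r) \<and> holds \<nu> (inF p y)"
      using in_H holds_\<nu> by blast
    then show False
      using holds_inF[OF val_\<nu>, of r p] holds_inF[OF val_\<nu>, of y p] tr y(2,3) p(1) by auto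
  qed
qed

end

section \<open>Explicit definability\<close>

lemma wtf_cong: "(\<And>x. x \<in> fvf \<phi> \<Longrightarrow> \<Gamma> x = \<Gamma>' x) \<Longrightarrow> wtf \<Gamma> \<phi> = wtf \<Gamma>' \<phi>"
proof (induction \<phi> arbitrary: \<Gamma> \<Gamma>')
  case (FEqU t u)
  have "ttype \<Gamma> t = ttype \<Gamma>' t" "ttype \<Gamma> u = ttype \<Gamma>' u" by (rule ttype_cong, rule FEqU, simp)+
  then show ?case by simp
next
  case (FNeqU t u)
  have "ttype \<Gamma> t = ttype \<Gamma>' t" "ttype \<Gamma> u = ttype \<Gamma>' u" by (rule ttype_cong, rule FNeqU, simp)+
  then show ?case by simp
next
  case (FOr p q)
  have "wtf \<Gamma> p = wtf \<Gamma>' p" by (rule FOr.IH(1), rule FOr.prems) simp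
  moreover have "wtf \<Gamma> q = wtf \<Gamma>' q" by (rule FOr.IH(2), rule FOr.prems) simp
  ultimately show ?case by simp
next
  case (FAnd p q)
  have "wtf \<Gamma> p = wtf \<Gamma>' p" by (rule FAnd.IH(1), rule FAnd.prems) simp
  moreover have "wtf \<Gamma> q = wtf \<Gamma>' q" by (rule FAnd.IH(2), rule FAnd.prems) simp
  ultimately show ?case by simp
next
  case (FAll x t p)
  have "ttype \<Gamma> t = ttype \<Gamma>' t" by (rule ttype_cong, rule FAll.prems) simp
  moreover have "wtf (\<Gamma>(x := T)) p = wtf (\<Gamma>'(x := T)) p" for T
    by (rule FAll.IH) (use FAll.prems in auto)
  ultimately show ?case by simp
next
  case (FEx x t p)
  have "ttype \<Gamma> t = ttype \<Gamma>' t" by (rule ttype_cong, rule FEx.prems) simp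
  moreover have "wtf (\<Gamma>(x := T)) p = wtf (\<Gamma>'(x := T)) p" for T
    by (rule FEx.IH) (use FEx.prems in auto)
  ultimately show ?case by simp
qed simp_all

lemma sat_cong: "(\<And>x. x \<in> fvf \<phi> \<Longrightarrow> \<sigma> x = \<sigma>' x) \<Longrightarrow> sat \<sigma> \<phi> = sat \<sigma>' \<phi>"
proof (induction \<phi> arbitrary: \<sigma> \<sigma>')
  case (FEqU t u)
  have "teval \<sigma> t = teval \<sigma>' t" "teval \<sigma> u = teval \<sigma>' u" by (rule teval_cong, rule FEqU, simp)+
  then show ?case by simp
next
  case (FNeqU t u)
  have "teval \<sigma> t = teval \<sigma>' t" "teval \<sigma> u = teval \<sigma>' u" by (rule teval_cong, rule FNeqU, simp)+
  then show ?case by simp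
next
  case (FOr p q)
  have "sat \<sigma> p = sat \<sigma>' p" by (rule FOr.IH(1), rule FOr.prems) simp
  moreover have "sat \<sigma> q = sat \<sigma>' q" by (rule FOr.IH(2), rule FOr.prems) simp
  ultimately show ?case by simp
next
  case (FAnd p q)
  have "sat \<sigma> p = sat \<sigma>' p" by (rule FAnd.IH(1), rule FAnd.prems) simp
  moreover have "sat \<sigma> q = sat \<sigma>' q" by (rule FAnd.IH(2), rule FAnd.prems) simp
  ultimately show ?case by simp
next
  case (FAll x t p)
  have "teval \<sigma> t = teval \<sigma>' t" by (rule teval_cong, rule FAll.prems) simp
  moreover have "sat (\<sigma>(x := v)) p = sat (\<sigma>'(x := v)) p" for v
    by (rule FAll.IH) (use FAll.prems in auto)
  ultimately show ?case by simp
next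
  case (FEx x t p)
  have "teval \<sigma> t = teval \<sigma>' t" by (rule teval_cong, rule FEx.prems) simp
  moreover have "sat (\<sigma>(x := v)) p = sat (\<sigma>'(x := v)) p" for v
    by (rule FEx.IH) (use FEx.prems in auto)
  ultimately show ?case by simp
qed simp_all

lemma teval_canon:
  assumes "ttype \<Gamma> t = Some T" "\<And>x. x \<in> fvt t \<Longrightarrow> hastype (\<sigma> x) (\<Gamma> x)"
  shows "hastype (teval \<sigma> t) T \<and> teval (\<lambda>x. canon (\<sigma> x)) t = canon (teval \<sigma> t)"
  using assms
proof (induction t arbitrary: T)
  case (TPair t u)
  then obtain A B where A: "ttype \<Gamma> t = Some A" "ttype \<Gamma> u = Some B" "T = TProd A B"
    by (auto split: option.splits)
  have "hastype (teval \<sigma> t) A \<and> teval (\<lambda>x. canon (\<sigma> x)) t = canon (teval \<sigma> t)"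
    by (rule TPair.IH(1)[OF A(1)], rule TPair.prems(2)) simp
  moreover have "hastype (teval \<sigma> u) B \<and> teval (\<lambda>x. canon (\<sigma> x)) u = canon (teval \<sigma> u)"
    by (rule TPair.IH(2)[OF A(2)], rule TPair.prems(2)) simp
  ultimately show ?case using A(3) by simp
next
  case (TPi1 t)
  then obtain B where B: "ttype \<Gamma> t = Some (TProd T B)" by (auto split: option.splits ty.splits)
  have "hastype (teval \<sigma> t) (TProd T B) \<and> teval (\<lambda>x. canon (\<sigma> x)) t = canon (teval \<sigma> t)"
    by (rule TPi1.IH[OF B], rule TPi1.prems(2)) simp
  then show ?case by auto
next
  case (TPi2 t)
  then obtain B where B: "ttype \<Gamma> t = Some (TProd B T)" by (auto split: option.splits ty.splits)
  have "hastype (teval \<sigma> t) (TProd B T) \<and> teval (\<lambda>x. canon (\<sigma> x)) t = canon (teval \<sigma> t)"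
    by (rule TPi2.IH[OF B], rule TPi2.prems(2)) simp
  then show ?case by auto
qed auto

text \<open>Formulas compare only atoms, which normalisation fixes, and quantifiers range over
  members, with which normalisation commutes.\<close>

lemma sat_canon:
  assumes "wtf \<Gamma> \<phi>" "\<And>x. x \<in> fvf \<phi> \<Longrightarrow> hastype (\<sigma> x) (\<Gamma> x)"
  shows "sat (\<lambda>x. canon (\<sigma> x)) \<phi> = sat \<sigma> \<phi>"
  using assms
proof (induction \<phi> arbitrary: \<Gamma> \<sigma>)
  case (FEqU t u)
  have "hastype (teval \<sigma> t) TUr \<and> teval (\<lambda>x. canon (\<sigma> x)) t = canon (teval \<sigma> t)"
    by (rule teval_canon) (use FEqU in auto)
  moreover have "hastype (teval \<sigma> u) TUr \<and> teval (\<lambda>x. canon (\<sigma> x)) u = canon (teval \<sigma> u)"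
    by (rule teval_canon) (use FEqU in auto)
  ultimately show ?case by auto
next
  case (FNeqU t u)
  have "hastype (teval \<sigma> t) TUr \<and> teval (\<lambda>x. canon (\<sigma> x)) t = canon (teval \<sigma> t)"
    by (rule teval_canon) (use FNeqU in auto)
  moreover have "hastype (teval \<sigma> u) TUr \<and> teval (\<lambda>x. canon (\<sigma> x)) u = canon (teval \<sigma> u)"
    by (rule teval_canon) (use FNeqU in auto)
  ultimately show ?case by auto
next
  case (FOr p q)
  have "sat (\<lambda>x. canon (\<sigma> x)) p = sat \<sigma> p" by (rule FOr.IH(1)) (use FOr.prems in auto)
  moreover have "sat (\<lambda>x. canon (\<sigma> x)) q = sat \<sigma> q" by (rule FOr.IH(2)) (use FOr.prems in auto)
  ultimately show ?case by simp
next
  case (FAnd p q)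
  have "sat (\<lambda>x. canon (\<sigma> x)) p = sat \<sigma> p" by (rule FAnd.IH(1)) (use FAnd.prems in auto)
  moreover have "sat (\<lambda>x. canon (\<sigma> x)) q = sat \<sigma> q" by (rule FAnd.IH(2)) (use FAnd.prems in auto)
  ultimately show ?case by simp
next
  case (FAll x t p)
  obtain T where T: "ttype \<Gamma> t = Some (TSet T)" "wtf (\<Gamma>(x := T)) p" using FAll.prems(1) by auto
  have t: "hastype (teval \<sigma> t) (TSet T)" "teval (\<lambda>x. canon (\<sigma> x)) t = canon (teval \<sigma> t)"
    using teval_canon[OF T(1), of \<sigma>] FAll.prems(2) by auto
  have "sat ((\<lambda>x. canon (\<sigma> x))(x := canon v)) p = sat (\<sigma>(x := v)) p" if "v \<in> elems (teval \<sigma> t)" for v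
  proof -
    have v: "hastype v T" using t(1) that by (rule hastype_elems)
    have "sat (\<lambda>y. canon ((\<sigma>(x := v)) y)) p = sat (\<sigma>(x := v)) p"
      by (rule FAll.IH[OF T(2)]) (use FAll.prems(2) v in auto)
    moreover have "(\<lambda>y. canon ((\<sigma>(x := v)) y)) = (\<lambda>x. canon (\<sigma> x))(x := canon v)" by auto
    ultimately show ?thesis by simp
  qed
  then show ?case using t(2) by (simp add: elems_canon)
next
  case (FEx x t p)
  obtain T where T: "ttype \<Gamma> t = Some (TSet T)" "wtf (\<Gamma>(x := T)) p" using FEx.prems(1) by auto
  have t: "hastype (teval \<sigma> t) (TSet T)" "teval (\<lambda>x. canon (\<sigma> x)) t = canon (teval \<sigma> t)"
    using teval_canon[OF T(1), of \<sigma>] FEx.prems(2) by auto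
  have "sat ((\<lambda>x. canon (\<sigma> x))(x := canon v)) p = sat (\<sigma>(x := v)) p" if "v \<in> elems (teval \<sigma> t)" for v
  proof -
    have v: "hastype v T" using t(1) that by (rule hastype_elems)
    have "sat (\<lambda>y. canon ((\<sigma>(x := v)) y)) p = sat (\<sigma>(x := v)) p"
      by (rule FEx.IH[OF T(2)]) (use FEx.prems(2) v in auto)
    moreover have "(\<lambda>y. canon ((\<sigma>(x := v)) y)) = (\<lambda>x. canon (\<sigma> x))(x := canon v)" by auto
    ultimately show ?thesis by simp
  qed
  then show ?case using t(2) by (simp add: elems_canon)
qed simp_all

lemma finite_fvf: "finite (fvf \<phi>)"
proof -
  have "finite (fvt t)" for t by (induction t) auto
  then show ?thesis by (induction \<phi>) auto
qed

lemma lk_map: "lk (map (\<lambda>x. (x, P x)) xs) x = (if x \<in> set xs then P x else SU)"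
  by (induction xs) auto

lemma ekeys_map: "ekeys (map (\<lambda>x. (x, P x)) xs) = (\<Union>x\<in>set xs. keys (P x))"
  by (auto simp: ekeys_def)

lemma ev_eq_keys: "ev \<mu> p = ev \<mu>' p \<Longrightarrow> k \<in> keys p \<Longrightarrow> \<mu> k = \<mu>' k"
  by (induction p) auto

section \<open>Two copies of the formula and the resulting expression\<close>

context inf_types begin

text \<open>Each variable gets a linear pattern disjoint from all earlier ones. Realising an
  assignment is part of the induction because it depends on this disjointness: binding the new
  pattern leaves the values of the earlier ones intact.\<close>

lemma fresh_env:
  assumes "finite V" "finite A"
  shows "\<exists>P. (\<forall>x\<in>V. stype (P x) = \<Gamma> x \<and> fst ` keys (P x) \<subseteq> {s} \<and> keys (P x) \<inter> A = {}) \<and>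
    (\<forall>\<sigma> (\<mu> :: ('u, 'i) valn). (\<forall>x\<in>V. cano (\<sigma> x) (\<Gamma> x)) \<longrightarrow> val \<mu> \<longrightarrow>
       (\<exists>\<mu>'. val \<mu>' \<and> (\<forall>x\<in>V. ev \<mu>' (P x) = \<sigma> x) \<and> (\<forall>k. k \<in> A \<or> fst k \<noteq> s \<longrightarrow> \<mu>' k = \<mu> k)))"
  using assms(1)
proof (induction V)
  case empty
  then show ?case by auto
next
  case (insert x V)
  from insert.IH obtain P where P: "\<forall>x\<in>V. stype (P x) = \<Gamma> x \<and> fst ` keys (P x) \<subseteq> {s} \<and> keys (P x) \<inter> A = {}"
    "\<And>\<sigma> (\<mu> :: ('u, 'i) valn). \<forall>x\<in>V. cano (\<sigma> x) (\<Gamma> x) \<Longrightarrow> val \<mu> \<Longrightarrow>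
       \<exists>\<mu>'. val \<mu>' \<and> (\<forall>x\<in>V. ev \<mu>' (P x) = \<sigma> x) \<and> (\<forall>k. k \<in> A \<or> fst k \<noteq> s \<longrightarrow> \<mu>' k = \<mu> k)" by blast
  have "finite (A \<union> (\<Union>v\<in>V. keys (P v)))" using assms(2) insert.hyps by simp
  then obtain p where p: "stype p = \<Gamma> x" "linear p" "keys p \<inter> (A \<union> (\<Union>v\<in>V. keys (P v))) = {}" "fst ` keys p \<subseteq> {s}"
    using fresh_sv by meson
  let ?P = "P(x := p)"
  have "\<exists>\<mu>'. val \<mu>' \<and> (\<forall>v\<in>insert x V. ev \<mu>' (?P v) = \<sigma> v) \<and> (\<forall>k. k \<in> A \<or> fst k \<noteq> s \<longrightarrow> \<mu>' k = \<mu> k)"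
    if \<sigma>: "\<forall>v\<in>insert x V. cano (\<sigma> v) (\<Gamma> v)" and \<mu>: "val \<mu>" for \<sigma> and \<mu> :: "('u, 'i) valn"
  proof -
    obtain \<mu>' where \<mu>': "val \<mu>'" "\<forall>x\<in>V. ev \<mu>' (P x) = \<sigma> x" "\<forall>k. k \<in> A \<or> fst k \<noteq> s \<longrightarrow> \<mu>' k = \<mu> k"
      using P(2)[of \<sigma> \<mu>] \<sigma> \<mu> by blast
    let ?\<mu> = "bnd p (\<sigma> x) \<mu>'"
    have c: "cano (\<sigma> x) (stype p)" using \<sigma> p(1) by simp
    show ?thesis
    proof (intro exI[of _ ?\<mu>] conjI ballI allI impI)
      show "val ?\<mu>" using val_bnd[OF \<mu>'(1) c] .
      show "ev ?\<mu> (?P v) = \<sigma> v" if v: "v \<in> insert x V" for v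
      proof (cases "v = x")
        case True
        then show ?thesis using ev_bnd[OF p(2) c] by simp
      next
        case False
        then have "keys (P v) \<inter> keys p = {}" using v p(3) by blast
        from ev_bnd_other[OF this, of "\<sigma> x" \<mu>'] show ?thesis using False v \<mu>'(2) by simp
      qed
      show "?\<mu> k = \<mu> k" if "k \<in> A \<or> fst k \<noteq> s" for k
      proof -
        have "k \<notin> keys p" using that p(3,4) by blast
        then show ?thesis using bnd_other \<mu>'(3) that by metis
      qed
    qed
  qed
  moreover have "\<forall>v\<in>insert x V. stype (?P v) = \<Gamma> v \<and> fst ` keys (?P v) \<subseteq> {s} \<and> keys (?P v) \<inter> A = {}"
    using P(1) p by auto
  ultimately show ?case by blast
qed

text \<open>The statement for normal forms, where \<open>veq\<close> has become equality.\<close>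

lemma canonical_definability:
  fixes \<phi> :: fml and \<Gamma> :: "nat \<Rightarrow> ty" and oin oout :: nat
  defines "V \<equiv> fvf \<phi> \<union> {oin, oout}"
  assumes ne: "oin \<noteq> oout" and wt: "wtf \<Gamma> \<phi>"
    and impl: "\<And>\<sigma>1 \<sigma>2 :: nat \<Rightarrow> ('u, 'i) nval. \<lbrakk>\<And>x. x \<in> V \<Longrightarrow> cano (\<sigma>1 x) (\<Gamma> x); \<And>x. x \<in> V \<Longrightarrow> cano (\<sigma>2 x) (\<Gamma> x);
      sat \<sigma>1 \<phi>; sat \<sigma>2 \<phi>; \<sigma>1 oin = \<sigma>2 oin\<rbrakk> \<Longrightarrow> \<sigma>1 oout = \<sigma>2 oout"
  shows "\<exists>E. etype \<Gamma> E = Some (\<Gamma> oout) \<and> fve E \<subseteq> {oin} \<and>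
    (\<forall>\<sigma> :: nat \<Rightarrow> ('u, 'i) nval. (\<forall>x\<in>V. cano (\<sigma> x) (\<Gamma> x)) \<longrightarrow> sat \<sigma> \<phi> \<longrightarrow> eval E \<sigma> = \<sigma> oout)"
proof -
  have fV: "finite V" using finite_fvf by (simp add: V_def)
  obtain xs where xs: "set xs = V" using finite_list[OF fV] by blast
  obtain pi where pi: "stype pi = \<Gamma> oin" "linear pi" "fst ` keys pi \<subseteq> {None}"
    using fresh_sv[of "{}" "\<Gamma> oin" None] by auto
  have fV': "finite (V - {oin})" using fV by simp
  have "\<exists>Q. \<forall>b. (\<forall>x\<in>V - {oin}. stype (Q b x) = \<Gamma> x \<and> fst ` keys (Q b x) \<subseteq> {Some b} \<and> keys (Q b x) \<inter> {} = {}) \<and>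
    (\<forall>\<sigma> (\<mu> :: ('u, 'i) valn). (\<forall>x\<in>V - {oin}. cano (\<sigma> x) (\<Gamma> x)) \<longrightarrow> val \<mu> \<longrightarrow>
       (\<exists>\<mu>'. val \<mu>' \<and> (\<forall>x\<in>V - {oin}. ev \<mu>' (Q b x) = \<sigma> x) \<and> (\<forall>k. k \<in> {} \<or> fst k \<noteq> Some b \<longrightarrow> \<mu>' k = \<mu> k)))"
    (is "\<exists>Q. ?R Q")
    by (rule choice, rule allI, rule fresh_env[OF fV' finite.emptyI])
  then obtain Q where Q': "?R Q"
    by (rule exE)
  have Q: "\<And>b x. x \<in> V - {oin} \<Longrightarrow> stype (Q b x) = \<Gamma> x \<and> fst ` keys (Q b x) \<subseteq> {Some b}"
    using Q' by blast
  have Q2: "\<exists>\<mu>'. val \<mu>' \<and> (\<forall>x\<in>V - {oin}. ev \<mu>' (Q b x) = \<sigma> x) \<and> (\<forall>k. fst k \<noteq> Some b \<longrightarrow> \<mu>' k = \<mu> k)"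
    if "\<forall>x\<in>V - {oin}. cano (\<sigma> x) (\<Gamma> x)" "val \<mu>" for b \<sigma> and \<mu> :: "('u, 'i) valn"
    using Q'[rule_format, of b, THEN conjunct2, rule_format, of \<sigma> \<mu>] that by simp
  \<comment> \<open>The input is read by the same shared pattern in both copies, every other
    variable by names private to its copy.\<close>
  define P where "P = (\<lambda>b. (Q b)(oin := pi))"
  define es where "es = (\<lambda>b. map (\<lambda>x. (x, P b x)) xs)"
  define \<Theta> where "\<Theta> = (\<lambda>b. {Fm \<phi> (es b)})"
  have Pt: "stype (P b x) = \<Gamma> x" if "x \<in> V" for b x using Q that pi(1) by (simp add: P_def)
  have Qk: "keys (Q b x) \<subseteq> loc b" if "x \<in> V - {oin}" for b x using Q[OF that] unfolding loc_def by blast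
  have Pk: "keys (P b x) \<subseteq> keys pi \<union> loc b" if "x \<in> V" for b x
    using Qk[of x b] that by (cases "x = oin") (auto simp: P_def)
  have oV: "oin \<in> V" "oout \<in> V" "oout \<in> V - {oin}" using ne by (auto simp: V_def)
  have holdsP: "holds \<mu> (Fm \<phi> (es b)) \<longleftrightarrow> sat (\<lambda>x. ev \<mu> (P b x)) \<phi>" for b and \<mu> :: "('u, 'i) valn"
    unfolding holds.simps es_def by (rule sat_cong) (simp add: lk_map xs V_def)
  have wffP: "wff (Fm \<phi> (es b))" for b
  proof -
    have "wtf (\<lambda>k. stype (lk (es b) k)) \<phi> = wtf \<Gamma> \<phi>"
      by (rule wtf_cong) (use Pt in \<open>simp add: es_def lk_map xs V_def\<close>)
    then show ?thesis using wt by simp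
  qed
  have keysP: "ekeys (es b) \<subseteq> keys pi \<union> loc b" for b
    using Pk by (auto simp: es_def ekeys_map xs)
  have wf1: "wf_state (keys pi, \<Theta>)"
    unfolding wf_state_def fst_conv snd_conv
  proof (intro conjI allI ballI impI)
    show "fst ` keys pi \<subseteq> {None}" by (rule pi(3))
    fix b f assume "f \<in> \<Theta> b"
    then have f: "f = Fm \<phi> (es b)" by (simp add: \<Theta>_def)
    show "wff f" unfolding f by (rule wffP)
    show "fkeys f \<subseteq> keys pi \<union> {k. fst k = Some b}" unfolding f fkeys.simps using keysP unfolding loc_def .
  qed (simp_all add: \<Theta>_def)
  have imp: "ev \<mu> (P True oout) = ev \<mu> (P False oout)" if m: "\<And>b. models \<mu> (\<Theta> b)" for \<mu> :: "('u, 'i) valn"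
  proof -
    have v: "val \<mu>" and s: "sat (\<lambda>x. ev \<mu> (P b x)) \<phi>" for b using m[of b] holdsP by (auto simp: \<Theta>_def)
    have "cano (ev \<mu> (P b x)) (\<Gamma> x)" if "x \<in> V" for b x using ev_cano[OF v, of "P b x"] Pt[OF that] by simp
    then show ?thesis using s impl[of "\<lambda>x. ev \<mu> (P True x)" "\<lambda>x. ev \<mu> (P False x)"] by (simp add: P_def)
  qed
  let ?r = "P True oout" and ?r' = "P False oout"
  have rP: "?r = Q True oout" "?r' = Q False oout" using ne by (auto simp: P_def)
  have tr: "stype ?r = \<Gamma> oout" "stype ?r' = \<Gamma> oout" using Pt oV by auto
  have "Sep (Some ?r) (keys pi) \<Theta>"
  proof (rule collect[OF wf1, of ?r "{?r'}"])
    show "fst ` keys ?r \<subseteq> {Some True}" using Q[OF oV(3), of True] rP by simp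
    show "keys q \<subseteq> keys pi \<union> loc False" if "q \<in> {?r'}" for q using Pk[of oout False] oV that by simp
    show "(ev \<mu> ?r, stype ?r) \<in> Sub \<mu> {?r'}" if "\<And>b. models \<mu> (\<Theta> b)" for \<mu> :: "('u, 'i) valn"
      using Sub.base[of ?r' "{?r'}" \<mu>] imp[OF that] tr by simp
  qed
  then obtain E1 \<theta>1 where 1: "D (keys pi) (TSet (\<Gamma> oout)) E1" "DB (keys pi) \<theta>1"
    "\<And>b \<mu> :: ('u, 'i) valn. models \<mu> (\<Theta> b) \<Longrightarrow> \<theta>1 \<mu> = b \<or> gsat (Some ?r) b \<mu> (E1 \<mu>)"
    unfolding Sep_def gty_def option.case tr by blast
  obtain px where px: "stype px = \<Gamma> oout" "linear px" "keys px \<inter> keys pi = {}" "fst ` keys px \<subseteq> {None}"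
    using fresh_sv[of "keys pi" "\<Gamma> oout" None] by auto
  \<comment> \<open>With \<open>px\<close> a candidate for the output, the left copy says that it is
    the output and the right copy that it is not. A joint model is impossible, as the outputs agree;
    the resulting \<open>\<theta>2\<close> therefore recognises the output from the input.\<close>
  define G where "G = (\<lambda>b. if b then {eqF px ?r} else {neF px ?r'})"
  have "Sep None (keys pi \<union> keys px) (\<lambda>b. G b \<union> \<Theta> b)"
  proof (rule ccontr)
    assume nS: "\<not> ?thesis"
    have "wf_state (keys pi \<union> keys px, \<lambda>b. G b \<union> \<Theta> b)"
    proof (rule wf_state_common[OF wf1 px(4)])
      have "wff (eqF px ?r)" "wff (neF px ?r')" using px(1) tr by auto
      moreover have "keys px \<union> keys ?r \<subseteq> keys pi \<union> keys px \<union> loc True" "keys px \<union> keys ?r' \<subseteq> keys pi \<union> keys px \<union> loc False"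
        using Pk[of oout] oV by blast+
      ultimately show "wff f \<and> fkeys f \<subseteq> keys pi \<union> keys px \<union> loc b" if "f \<in> G b" for b f
        using that by (cases b) (simp_all add: G_def)
    qed (auto simp: G_def split: if_splits)
    then have S0: "good None (keys pi \<union> keys px, \<lambda>b. G b \<union> \<Theta> b)" using nS by (simp add: good_def)
    obtain Sq where Sq: "hintikka TYPE('i) TYPE('u) None Sq" "Sq 0 = (keys pi \<union> keys px, \<lambda>b. G b \<union> \<Theta> b)"
      by (rule model_exists[where gm = "\<lambda>_ _ _. True", OF S0]) (blast intro: le_refl)+
    interpret hintikka UT IT None Sq by (rule Sq(1))
    have m: "models \<nu> (G b \<union> \<Theta> b)" for b
      using val_\<nu> holds_\<nu> in_H[of _ 0 b] Sq(2) by auto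
    then have "models \<nu> (\<Theta> b)" for b by blast
    then have "ev \<nu> ?r = ev \<nu> ?r'" by (rule imp)
    moreover have "holds \<nu> (eqF px ?r)" using m[of True] by (simp add: G_def)
    moreover have "holds \<nu> (neF px ?r')" using m[of False] by (simp add: G_def)
    ultimately show False using holds_eqF[OF val_\<nu>, of ?r px] holds_eqF[OF val_\<nu>, of ?r' px] tr px(1) by simp
  qed
  then obtain \<theta>2 where 2: "DB (keys pi \<union> keys px) \<theta>2"
    "\<And>b \<mu> :: ('u, 'i) valn. models \<mu> (G b \<union> \<Theta> b) \<Longrightarrow> \<theta>2 \<mu> = b"
    unfolding Sep_def gsat_def by blast
  have E1': "D (keys pi) (TSet (stype px)) E1" using 1(1) px(1) by simp
  let ?E2 = "\<lambda>\<mu>. mkset {y \<in> elems (E1 \<mu>). \<theta>2 (bnd px y \<mu>)}"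
  have E2: "D (keys pi) (TSet (\<Gamma> oout)) ?E2"
    using D_sep[OF finite_keys px(2,3) 2(1) E1'] px(1) by simp
  \<comment> \<open>One assignment is used for both copies at once, which brings both sides of each
    separator to bear on the same valuation.\<close>
  have realize: "\<exists>\<mu>. val \<mu> \<and> (\<forall>b. \<forall>x\<in>V. ev \<mu> (P b x) = \<sigma> x)"
    if \<sigma>: "\<forall>x\<in>V. cano (\<sigma> x) (\<Gamma> x)" for \<sigma> :: "nat \<Rightarrow> ('u, 'i) nval"
  proof -
    have c: "cano (\<sigma> oin) (stype pi)" using \<sigma> oV pi(1) by simp
    obtain \<mu>0 :: "('u, 'i) valn" where "val \<mu>0" using val_dflt by blast
    then have v1: "val (bnd pi (\<sigma> oin) \<mu>0)" using c by (rule val_bnd)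
    obtain \<mu>1 where \<mu>1: "val \<mu>1" "\<forall>x\<in>V - {oin}. ev \<mu>1 (Q True x) = \<sigma> x"
      "\<forall>k. fst k \<noteq> Some True \<longrightarrow> \<mu>1 k = bnd pi (\<sigma> oin) \<mu>0 k" using Q2[OF _ v1, of \<sigma> True] \<sigma> by blast
    obtain \<mu>2 where \<mu>2: "val \<mu>2" "\<forall>x\<in>V - {oin}. ev \<mu>2 (Q False x) = \<sigma> x"
      "\<forall>k. fst k \<noteq> Some False \<longrightarrow> \<mu>2 k = \<mu>1 k" using Q2[OF _ \<mu>1(1), of \<sigma> False] \<sigma> by blast
    have "ev \<mu>2 pi = ev (bnd pi (\<sigma> oin) \<mu>0) pi"
    proof (rule ev_cong)
      fix k assume "k \<in> keys pi"
      then have "fst k = None" using pi(3) by blast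
      then show "\<mu>2 k = bnd pi (\<sigma> oin) \<mu>0 k" 
        using \<mu>1(3)[rule_format, of k] \<mu>2(3)[rule_format, of k] by simp
    qed
    then have i: "ev \<mu>2 pi = \<sigma> oin" using ev_bnd[OF pi(2) c] by simp
    have t: "ev \<mu>2 (Q True x) = \<sigma> x" if x: "x \<in> V - {oin}" for x
    proof -
      have "ev \<mu>2 (Q True x) = ev \<mu>1 (Q True x)"
      proof (rule ev_cong)
        fix k assume "k \<in> keys (Q True x)"
        then have "fst k = Some True" using Q[OF x] by blast
        then show "\<mu>2 k = \<mu>1 k" using \<mu>2(3)[rule_format, of k] by simp
      qed
      then show ?thesis using \<mu>1(2) x by simp
    qed
    have "ev \<mu>2 (P b x) = \<sigma> x" if "x \<in> V" for b x
      using that i t \<mu>2(2) by (cases b; cases "x = oin") (auto simp: P_def)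
    then show ?thesis using \<mu>2(1) by blast
  qed
  have E2_eq: "elems (?E2 \<mu>) = {\<sigma> oout}"
    if v: "val \<mu>" and e: "\<And>b x. x \<in> V \<Longrightarrow> ev \<mu> (P b x) = \<sigma> x" and s: "sat \<sigma> \<phi>" for \<mu> and \<sigma> :: "nat \<Rightarrow> ('u, 'i) nval"
  proof -
    have hP: "holds \<mu>' (Fm \<phi> (es b))" if "\<And>b x. x \<in> V \<Longrightarrow> ev \<mu>' (P b x) = \<sigma> x" for b and \<mu>' :: "('u, 'i) valn"
    proof -
      have "sat (\<lambda>x. ev \<mu>' (P b x)) \<phi> = sat \<sigma> \<phi>" by (rule sat_cong) (use that in \<open>simp add: V_def\<close>)
      then show ?thesis using s holdsP by simp
    qed
    have "models \<mu> (\<Theta> b)" for b using v hP[of \<mu>, OF e] by (simp add: \<Theta>_def)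
    \<comment> \<open>On the right \<open>\<theta>1\<close> is false here, and on the left the only
      other alternative is that the output belongs to \<open>E1\<close>.\<close>
    from 1(3)[OF this, of True] 1(3)[OF this, of False] have o1: "\<sigma> oout \<in> elems (E1 \<mu>)"
      using e oV by (auto simp: gsat_def)
    have \<theta>2: "\<theta>2 (bnd px y \<mu>) \<longleftrightarrow> y = \<sigma> oout" if y: "y \<in> elems (E1 \<mu>)" for y
    proof -
      let ?\<mu> = "bnd px y \<mu>"
      have c: "cano y (stype px)" using D_cano[OF E1' v] y cano_elems by blast
      have v': "val ?\<mu>" using v c by (rule val_bnd)
      have e': "ev ?\<mu> (P b x) = \<sigma> x" if x: "x \<in> V" for b x
      proof -
        have "k \<notin> keys px" if "k \<in> loc b" for k using px(4) that unfolding loc_def by force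
        then have "keys (P b x) \<inter> keys px = {}" using Pk[OF x, of b] px(3) by blast
        from ev_bnd_other[OF this, of y \<mu>] show ?thesis using e[OF x] by simp
      qed
      have ex: "ev ?\<mu> px = y" by (rule ev_bnd[OF px(2) c])
      have T: "holds ?\<mu> f" if "f \<in> \<Theta> b" for f b using hP[of ?\<mu> b, OF e'] that by (simp add: \<Theta>_def)
      show ?thesis
      proof (cases "y = \<sigma> oout")
        case True
        then have "holds ?\<mu> (eqF px ?r)" using holds_eqF[OF v', of ?r px] tr px(1) ex e'[OF oV(2)] by simp
        then have "models ?\<mu> (G True \<union> \<Theta> True)" using T v' by (auto simp: G_def)
        from 2(2)[OF this] show ?thesis using True by simp
      next
        case False
        then have "holds ?\<mu> (neF px ?r')" using holds_eqF[OF v', of ?r' px] tr px(1) ex e'[OF oV(2)] by simp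
        then have "models ?\<mu> (G False \<union> \<Theta> False)" using T v' by (auto simp: G_def)
        from 2(2)[OF this] show ?thesis using False by simp
      qed
    qed
    have "elems (?E2 \<mu>) = {y \<in> elems (E1 \<mu>). \<theta>2 (bnd px y \<mu>)}"
      by (rule elems_mkset, rule small_subset[OF small_elems]) blast
    also have "\<dots> = {\<sigma> oout}" using o1 \<theta>2 by blast
    finally show ?thesis .
  qed
  have "finite (snd ` snd ` keys pi)" by simp
  then obtain n where n: "n \<notin> snd ` snd ` keys pi" using ex_new_if_finite infinite_UNIV_nat by blast
  \<comment> \<open>The pattern \<open>pi\<close> may spread the input over several names, whereas
    the final expression has one input variable; \<open>k\<close> holds the whole input and
    \<open>pi\<close> is matched against it.\<close>
  define k where "k = (None :: bool option, \<Gamma> oin, n)"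
  have k: "k \<notin> keys pi" using n by (force simp: k_def)
  have "D ({k} \<union> keys pi) (TSet (\<Gamma> oout)) ?E2" by (rule D_mono[OF E2]) auto
  moreover have "D {k} (stype pi) (\<lambda>\<mu>. \<mu> k)" using D_var[of k "{k}"] by (simp add: k_def pi(1))
  ultimately have Dk: "D {k} (TSet (\<Gamma> oout)) (\<lambda>\<mu>. ?E2 (bnd pi (\<mu> k) \<mu>))"
    by (rule D_bnd[OF pi(2), rotated]) (use k in auto)
  then obtain G0 where G0: "etype tenv G0 = Some (TSet (\<Gamma> oout))" "fve G0 \<subseteq> to_nat ` {k}"
    "\<And>\<mu> :: ('u, 'i) valn. val \<mu> \<Longrightarrow> eval G0 (venv \<mu>) = ?E2 (bnd pi (\<mu> k) \<mu>)"
    using DE[OF Dk] by blast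
  let ?c = "to_nat k"
  \<comment> \<open>The union over the singleton of \<open>oin\<close> binds the variable coding
    \<open>k\<close> to the input, which takes the place of a renaming.\<close>
  let ?E = "EGet (\<Gamma> oout) (EBigU ?c G0 (ESng (EVar oin)))"
  have "etype (\<Gamma>(?c := \<Gamma> oin)) G0 = etype tenv G0"
    by (rule etype_cong) (use G0(2) in \<open>auto simp: k_def\<close>)
  then have "etype \<Gamma> ?E = Some (\<Gamma> oout)" using G0(1) by simp
  moreover have "fve ?E \<subseteq> {oin}" using G0(2) by auto
  moreover have "eval ?E \<sigma> = \<sigma> oout" if \<sigma>: "\<forall>x\<in>V. cano (\<sigma> x) (\<Gamma> x)" and s: "sat \<sigma> \<phi>" for \<sigma> :: "nat \<Rightarrow> ('u, 'i) nval"
  proof -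
    obtain \<mu> :: "('u, 'i) valn" where \<mu>: "val \<mu>" "\<And>b x. x \<in> V \<Longrightarrow> ev \<mu> (P b x) = \<sigma> x"
      using realize[OF \<sigma>] by blast
    have ci: "cano (\<sigma> oin) (\<Gamma> oin)" using \<sigma> oV by blast
    let ?\<mu> = "\<mu>(k := \<sigma> oin)"
    have v: "val ?\<mu>" using \<mu>(1) ci by (intro val_upd) (simp_all add: k_def)
    have v': "val (bnd pi (\<sigma> oin) ?\<mu>)" using v ci pi(1) by (intro val_bnd) simp_all
    have "eval G0 (\<sigma>(?c := \<sigma> oin)) = eval G0 (venv ?\<mu>)"
      by (rule eval_cong) (use G0(2) in \<open>auto simp: venv_def\<close>)
    also have "\<dots> = ?E2 (bnd pi (\<sigma> oin) ?\<mu>)" using G0(3)[OF v] by simp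
    also have "\<dots> = ?E2 \<mu>"
    proof (rule D_dep[OF E2 v' \<mu>(1)])
      fix j assume j: "j \<in> keys pi"
      have "ev (bnd pi (\<sigma> oin) ?\<mu>) pi = ev \<mu> pi"
        using ev_bnd[OF pi(2), of "\<sigma> oin" ?\<mu>] ci pi(1) \<mu>(2)[OF oV(1), of True] by (simp add: P_def)
      then show "bnd pi (\<sigma> oin) ?\<mu> j = \<mu> j" using j by (rule ev_eq_keys)
    qed
    finally have "elems (eval G0 (\<sigma>(?c := \<sigma> oin))) = {\<sigma> oout}" using E2_eq[OF \<mu> s] by simp
    then have "elems (eval (EBigU ?c G0 (ESng (EVar oin))) \<sigma>) = {\<sigma> oout}" by simp
    then show ?thesis by (simp add: veq_iff del: eval.simps(10))
  qed
  ultimately show ?thesis by blast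
qed

end

theorem mainTheorem1:
  fixes \<phi> :: fml and \<Gamma> :: "nat \<Rightarrow> ty" and oin oout :: nat
  assumes "infinite (UNIV :: 'u set)"
    and "infinite (UNIV :: 'i set)"
    and "oin \<noteq> oout"
    and "wtf \<Gamma> \<phi>"
    and "\<forall>\<sigma>1 \<sigma>2 :: nat \<Rightarrow> ('u, 'i) nval.
           wt_asg \<Gamma> (fvf \<phi> \<union> {oin, oout}) \<sigma>1 \<and> wt_asg \<Gamma> (fvf \<phi> \<union> {oin, oout}) \<sigma>2 \<and>
           sat \<sigma>1 \<phi> \<and> sat \<sigma>2 \<phi> \<and> veq (\<sigma>1 oin) (\<sigma>2 oin) \<longrightarrow> veq (\<sigma>1 oout) (\<sigma>2 oout)"
  shows "\<exists>E. etype \<Gamma> E = Some (\<Gamma> oout) \<and> fve E \<subseteq> {oin} \<and>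
           (\<forall>\<sigma> :: nat \<Rightarrow> ('u, 'i) nval.
              wt_asg \<Gamma> (fvf \<phi> \<union> {oin, oout}) \<sigma> \<and> sat \<sigma> \<phi> \<longrightarrow> veq (eval E \<sigma>) (\<sigma> oout))"
proof -
  interpret inf_types "TYPE('u)" "TYPE('i)" by unfold_locales (fact assms)+
  let ?V = "fvf \<phi> \<union> {oin, oout}"
  have "\<exists>E. etype \<Gamma> E = Some (\<Gamma> oout) \<and> fve E \<subseteq> {oin} \<and>
    (\<forall>\<sigma> :: nat \<Rightarrow> ('u, 'i) nval. (\<forall>x\<in>?V. cano (\<sigma> x) (\<Gamma> x)) \<longrightarrow> sat \<sigma> \<phi> \<longrightarrow> eval E \<sigma> = \<sigma> oout)"
  proof (rule canonical_definability[OF assms(3,4)])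
    fix \<sigma>1 \<sigma>2 :: "nat \<Rightarrow> ('u, 'i) nval"
    assume c: "\<And>x. x \<in> ?V \<Longrightarrow> cano (\<sigma>1 x) (\<Gamma> x)" "\<And>x. x \<in> ?V \<Longrightarrow> cano (\<sigma>2 x) (\<Gamma> x)"
      and s: "sat \<sigma>1 \<phi>" "sat \<sigma>2 \<phi>" "\<sigma>1 oin = \<sigma>2 oin"
    have "wt_asg \<Gamma> ?V \<sigma>1" "wt_asg \<Gamma> ?V \<sigma>2" using c by (auto simp: wt_asg_def cano_def)
    moreover have "veq (\<sigma>1 oin) (\<sigma>2 oin)" using s(3) by (simp add: veq_iff)
    ultimately have "veq (\<sigma>1 oout) (\<sigma>2 oout)" using assms(5) s by blast
    then show "\<sigma>1 oout = \<sigma>2 oout" using c[of oout] by (simp add: cano_veq)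
  qed
  then obtain E where E: "etype \<Gamma> E = Some (\<Gamma> oout)" "fve E \<subseteq> {oin}"
    "\<And>\<sigma> :: nat \<Rightarrow> ('u, 'i) nval. \<forall>x\<in>?V. cano (\<sigma> x) (\<Gamma> x) \<Longrightarrow> sat \<sigma> \<phi> \<Longrightarrow> eval E \<sigma> = \<sigma> oout"
    by blast
  have "veq (eval E \<sigma>) (\<sigma> oout)" if w: "wt_asg \<Gamma> ?V \<sigma>" and s: "sat \<sigma> \<phi>" for \<sigma> :: "nat \<Rightarrow> ('u, 'i) nval"
  proof -
    \<comment> \<open>Satisfaction and evaluation both respect normalisation, so the claim for an
      arbitrary assignment reduces to its normal form.\<close>
    let ?\<sigma> = "\<lambda>x. canon (\<sigma> x)"
    have h: "hastype (\<sigma> x) (\<Gamma> x)" if "x \<in> ?V" for x using w that unfolding wt_asg_def by blast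
    then have "\<forall>x\<in>?V. cano (?\<sigma> x) (\<Gamma> x)" by (simp add: cano_def hastype_canon)
    moreover have "sat ?\<sigma> \<phi>" using sat_canon[OF assms(4), of \<sigma>] h s by simp
    ultimately have "eval E ?\<sigma> = canon (\<sigma> oout)" by (rule E(3))
    moreover have "canon (eval E \<sigma>) = eval E ?\<sigma>" using eval_sound[OF E(1), of \<sigma>] E(2) h by blast
    ultimately show ?thesis by (simp add: veq_iff)
  qed
  then show ?thesis using E(1,2) by blast
qed

end
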